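(* Suppose that the standing assumptions on $b,f,g$ stated in the context hold. Let $\bar u(\cdot)\in L^\infty$ be an optimal control, i.e. a minimizer of $J$ over $L^2$, and suppose that the second-order coercivity condition (see context) holds at $\bar u(\cdot)$ with constant $\alpha>0$. If the initial control $u^0(\cdot)$ is sufficiently close to $\bar u(\cdot)$ in $L^\infty$, then the following statements hold: (i) Newton's method (see context) started at $u^0(\cdot)$ generates a sequence $\{u^k(\cdot)\}$ that converges quadratically to $\bar u(\cdot)$ in $L^\infty$. (ii) A radius $r_3$ that guarantees this convergence (i.e. it suffices that $\|u^0-\bar u\|_\infty\le r_3$) is given by $$r_3=\min\left\{\frac{\alpha}{C_3(1+\|\bar u\|_1)},\ \frac{\sqrt{C_3^2(1+\|\bar u\|_1)^2+C_3T\gamma}-C_3(1+\|\bar u\|_1)}{C_3T}\right\},$$ where $C_3$ and $\gamma$ are the explicit constants given in the context. (iii) The gradients $\{J'(u^k(\cdot))\}$ converge quadratically to zero in $L^\infty$.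
   Context: Setting. Fix $T>0$, $n,m\in\mathbb{N}$, $x_0\in\mathbb{R}^n$ and maps $b:[0,T]\times\mathbb{R}^n\times\mathbb{R}^m\to\mathbb{R}^n$, $f:[0,T]\times\mathbb{R}^n\times\mathbb{R}^m\to\mathbb{R}$, $g:\mathbb{R}^n\to\mathbb{R}$. $|\cdot|$ is the Euclidean norm (for matrices and higher-order arrays, that of the entries). For $\beta\in[1,\infty]$, $L^\beta=L^\beta(0,T;\mathbb{R}^m)$ with norm $\|\cdot\|_\beta$. Derivatives. $b_x,b_u$ are Jacobians ($n\times n$, $n\times m$); gradients $f_x,f_u,g_x,H_x,H_u$ are column vectors; $H_{xu}$ is the derivative of $H_x$ with respect to $u$ (an $n\times m$ matrix), $H_{ux}=H_{xu}^\top$; $\varphi_{(x,u)^2}$ is the full second derivative (Hessian) of $\varphi$ in $(x,u)$, and $\varphi_{(x,u)^2}(y,v)^2$ denotes its quadratic form evaluated at the vector $(y,v)$. Standing assumptions. $b,f,g$ are measurable; for every $t$, $b(t,\cdot,\cdot)$ and $f(t,\cdot,\cdot)$ are twice differentiable, and $g$ is twice differentiable; there is a constant $L>0$, independent of $t$, such that for all $t\in[0,T]$, $x,\bar x\in\mathbb{R}^n$, $u,\bar u\in\mathbb{R}^m$: $|b(t,x,u)|\le L(|x|+|u|+1)$, $|b_x(t,x,u)|+|b_u(t,x,u)|\le L$, $|b_{(x,u)^2}(t,x,u)|\le L$, $|b_{(x,u)^2}(t,x,u)-b_{(x,u)^2}(t,\bar x,\bar u)|\le L(|x-\bar x|+|u-\bar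 u|)$; $|f(t,x,u)|\le L(|x|^2+|u|^2+1)$, $|f_x(t,x,u)|+|f_u(t,x,u)|\le L(|x|+|u|+1)$, $|f_{(x,u)^2}(t,x,u)|\le L$, $|f_{(x,u)^2}(t,x,u)-f_{(x,u)^2}(t,\bar x,\bar u)|\le L(|x-\bar x|+|u-\bar u|)$; $|g(x)|\le L(|x|^2+1)$, $|g_x(x)|\le L(|x|+1)$, $|g_{xx}(x)|\le L$, $|g_{xx}(x)-g_{xx}(\bar x)|\le L|x-\bar x|$. State, cost, adjoint. For $u(\cdot)\in L^2$, the state $x(\cdot)$ is the unique solution of $\dot x(t)=b(t,x(t),u(t))$, $x(0)=x_0$; the cost is $J(u(\cdot))=\int_0^Tf(t,x(t),u(t))\,dt+g(x(T))$; the adjoint $p(\cdot)$ is the unique solution of $\dot p(t)=-b_x(t,x(t),u(t))^\top p(t)-f_x(t,x(t),u(t))$, $p(T)=g_x(x(T))$. The Hamiltonian is $H(t,x,u,p)=b(t,x,u)^\top p+f(t,x,u)$. The gradient (Riesz representative in $L^2$ of the Fr\'echet derivative of $J$) is $J'(u(\cdot))(t)=H_u(t,x(t),u(t),p(t))$. Second-order coercivity condition at $\bar u(\cdot)$ with constant $\alpha>0$: with $\bar x,\bar p$ the state and adjoint of $\bar u$, for every $v(\cdot)\in L^2$, $\int_0^TH_{(x,u)^2}(t,\bar x(t),\bar u(t),\bar p(t))(y(t),v(t))^2dt+y(T)^\top g_{xx}(\bar x(T))y(T)\ge\alpha\|v\|_2^2$, where $\dot y(t)=b_x(t,\bar x(t),\bar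 u(t))y(t)+b_u(t,\bar x(t),\bar u(t))v(t)$, $y(0)=0$. Newton's method. Given $u^k(\cdot)$, compute its state $x^k(\cdot)$ and adjoint $p^k(\cdot)$; if $J'(u^k(\cdot))=H_u(\cdot,x^k,u^k,p^k)=0$, stop. Otherwise let $v^k(\cdot)$ be the solution of: minimize over $v(\cdot)\in L^2$ $\frac12\int_0^T\{2\langle H_u(t,x^k(t),u^k(t),p^k(t)),v(t)\rangle+H_{(x,u)^2}(t,x^k(t),u^k(t),p^k(t))(y(t),v(t))^2\}dt+\frac12\langle g_{xx}(x^k(T))y(T),y(T)\rangle$ subject to $\dot y(t)=b_x(t,x^k(t),u^k(t))y(t)+b_u(t,x^k(t),u^k(t))v(t)$, $y(0)=0$. If $v^k(\cdot)=0$, stop; otherwise set $u^{k+1}(\cdot)=u^k(\cdot)+v^k(\cdot)$ and repeat. If the method stops at $u^k$, the sequence is understood to be constant from then on. Quadratic convergence of a sequence $z^k\to z$ in a normed space means $z^k\to z$ and there is $C>0$ with $\|z^{k+1}-z\|\le C\|z^k-z\|^2$ for all $k$. Constants. $C_x=\max\{e^{LT}(|x_0|+LT),\,Le^{LT}\}$, $K_p=Le^{LT}(1+C_x)(T+1)$, $C_p=\max\{K_p,\,Le^{LT}[C_x+(C_xT+1)(1+K_p)]\}$, $C_H=\max\{L(C_p+C_x+C_pC_x),\,L(1+C_p)\}$, $C_1=\max\{C_x,C_p,C_H\}$; $C_y=Le^{LT}[(C_1+Le^{LT}+C_1LTe^{LT})T+1]$, $K_\psi=e^{LT}[LC_y+C_1(C_yT+1)]$,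 $C_\psi=\max\{K_\psi,\,e^{LT}[LC_y(C_1T+1)+LK_\psi T(C_1T+1)+C_1(C_yT^2+2C_yT+T+1)]\}$, $C_2=\max\{C_y,C_\psi\}$; $C_3=TC_2[L(C_1T+2)+C_1(T+2)]+C_1(T+1)$; $C_h=C_1e^{LT}(TLe^{LT}+1)+L^2e^{2LT}$, $\gamma=\dfrac{\alpha^2}{T(LC_h+C_1Le^{LT})(1+\|\bar u\|_1)+\alpha}$. *)

theory Defs
  imports "HOL-Analysis.Analysis" "HOL-Probability.Essential_Supremum"
begin

section \<open>Lebesgue spaces on a bounded interval\<close>

text \<open>Elements of the spaces are functions; two of them are the same point of the space iff they
  agree almost everywhere on \<open>[0,T]\<close>. Values outside \<open>[0,T]\<close> never matter.\<close>

definition L2 :: "real \<Rightarrow> (real \<Rightarrow> 'a::euclidean_space) set" where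
  "L2 T = {u \<in> borel_measurable (lebesgue_on {0..T}).
             integrable (lebesgue_on {0..T}) (\<lambda>t. (norm (u t))\<^sup>2)}"

definition Linf :: "real \<Rightarrow> (real \<Rightarrow> 'a::euclidean_space) set" where
  "Linf T = {u \<in> borel_measurable (lebesgue_on {0..T}).
               esssup (lebesgue_on {0..T}) (\<lambda>t. ereal (norm (u t))) < \<infinity>}"

definition norm_L1 :: "real \<Rightarrow> (real \<Rightarrow> 'a::euclidean_space) \<Rightarrow> real" where
  "norm_L1 T u = (LINT t|lebesgue_on {0..T}. norm (u t))"

definition norm_L2 :: "real \<Rightarrow> (real \<Rightarrow> 'a::euclidean_space) \<Rightarrow> real" where
  "norm_L2 T u = sqrt (LINT t|lebesgue_on {0..T}. (norm (u t))\<^sup>2)"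

definition norm_Linf :: "real \<Rightarrow> (real \<Rightarrow> 'a::euclidean_space) \<Rightarrow> real" where
  "norm_Linf T u = real_of_ereal (esssup (lebesgue_on {0..T}) (\<lambda>t. ereal (norm (u t))))"

definition ae_eq :: "real \<Rightarrow> (real \<Rightarrow> 'a) \<Rightarrow> (real \<Rightarrow> 'a) \<Rightarrow> bool" where
  "ae_eq T u v \<longleftrightarrow> (AE t in lebesgue_on {0..T}. u t = v t)"

definition quadratically_convergent_Linf ::
  "real \<Rightarrow> (nat \<Rightarrow> real \<Rightarrow> 'a::euclidean_space) \<Rightarrow> (real \<Rightarrow> 'a) \<Rightarrow> bool" where
  "quadratically_convergent_Linf T z zlim \<longleftrightarrow>
     zlim \<in> Linf T \<and> (\<forall>k. z k \<in> Linf T) \<and>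
     (\<lambda>k. norm_Linf T (\<lambda>t. z k t - zlim t)) \<longlonglongrightarrow> 0 \<and>
     (\<exists>C>0. \<forall>k. norm_Linf T (\<lambda>t. z (Suc k) t - zlim t)
                  \<le> C * (norm_Linf T (\<lambda>t. z k t - zlim t))\<^sup>2)"

section \<open>Derivatives\<close>

definition grad :: "('a::real_inner \<Rightarrow> real) \<Rightarrow> 'a \<Rightarrow> 'a" where
  "grad \<phi> z = (THE D. GDERIV \<phi> z :> D)"

definition hess :: "(real^'k \<Rightarrow> real) \<Rightarrow> real^'k \<Rightarrow> real^'k^'k" where
  "hess \<phi> z = jacobian (grad \<phi>) (at z)"

definition twice_differentiable ::
  "('a::real_normed_vector \<Rightarrow> 'b::real_normed_vector) \<Rightarrow> bool" where
  "twice_differentiable \<phi> \<longleftrightarrow>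
     (\<exists>\<phi>'. (\<forall>z. (\<phi> has_derivative blinfun_apply (\<phi>' z)) (at z)) \<and>
           (\<forall>z. \<phi>' differentiable (at z)))"

text \<open>The pair \<open>(x,u)\<close> is treated as one vector indexed by the disjoint sum of the index types, so
  that second derivatives in \<open>(x,u)\<close> are genuine matrices. The library norm on iterated vectors is
  the Euclidean norm of all entries.\<close>

definition join :: "real^'n \<Rightarrow> real^'m \<Rightarrow> real^('n + 'm)" where
  "join x u = (\<chi> i. case i of Inl j \<Rightarrow> x $ j | Inr j \<Rightarrow> u $ j)"

definition xpart :: "real^('n::finite + 'm::finite) \<Rightarrow> real^'n" where
  "xpart z = (\<chi> j. z $ Inl j)"

definition upart :: "real^('n::finite + 'm::finite) \<Rightarrow> real^'m" where
  "upart z = (\<chi> j. z $ Inr j)"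

definition on_join :: "(real^'n \<Rightarrow> real^'m \<Rightarrow> 'c) \<Rightarrow> real^('n + 'm) \<Rightarrow> 'c" where
  "on_join \<phi> z = \<phi> (xpart z) (upart z)"

definition jac_x :: "(real \<Rightarrow> real^'n \<Rightarrow> real^'m \<Rightarrow> real^'n) \<Rightarrow> real \<Rightarrow> real^'n \<Rightarrow> real^'m \<Rightarrow> real^'n^'n" where
  "jac_x b t x u = jacobian (\<lambda>x'. b t x' u) (at x)"

definition jac_u :: "(real \<Rightarrow> real^'n \<Rightarrow> real^'m \<Rightarrow> real^'n) \<Rightarrow> real \<Rightarrow> real^'n \<Rightarrow> real^'m \<Rightarrow> real^'m^'n" where
  "jac_u b t x u = jacobian (\<lambda>u'. b t x u') (at u)"

definition grad_x :: "(real \<Rightarrow> real^'n \<Rightarrow> real^'m \<Rightarrow> real) \<Rightarrow> real \<Rightarrow> real^'n \<Rightarrow> real^'m \<Rightarrow> real^'n" where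
  "grad_x f t x u = grad (\<lambda>x'. f t x' u) x"

definition grad_u :: "(real \<Rightarrow> real^'n \<Rightarrow> real^'m \<Rightarrow> real) \<Rightarrow> real \<Rightarrow> real^'n \<Rightarrow> real^'m \<Rightarrow> real^'m" where
  "grad_u f t x u = grad (\<lambda>u'. f t x u') u"

definition hess_xu ::
  "(real \<Rightarrow> real^'n \<Rightarrow> real^'m \<Rightarrow> real) \<Rightarrow> real \<Rightarrow> real^'n \<Rightarrow> real^'m \<Rightarrow> real^('n + 'm)^('n + 'm)" where
  "hess_xu f t x u = hess (on_join (f t)) (join x u)"

definition hess_xu_vec ::
  "(real \<Rightarrow> real^'n \<Rightarrow> real^'m \<Rightarrow> real^'n) \<Rightarrow> real \<Rightarrow> real^'n \<Rightarrow> real^'m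
     \<Rightarrow> real^('n + 'm)^('n + 'm)^'n" where
  "hess_xu_vec b t x u = (\<chi> i. hess_xu (\<lambda>t x u. b t x u $ i) t x u)"

section \<open>Standing assumptions\<close>

text \<open>Measurability in \<open>(t,x,u)\<close> is with respect to the product of the Lebesgue sets of \<open>[0,T]\<close> and
  the Borel sets of the \<open>(x,u)\<close> space; this is implied by Borel measurability.\<close>

definition standing_assumptions ::
  "real \<Rightarrow> real \<Rightarrow> (real \<Rightarrow> real^'n \<Rightarrow> real^'m \<Rightarrow> real^'n) \<Rightarrow>
   (real \<Rightarrow> real^'n \<Rightarrow> real^'m \<Rightarrow> real) \<Rightarrow> (real^'n \<Rightarrow> real) \<Rightarrow> bool" where
  "standing_assumptions T L b f g \<longleftrightarrow>
     (\<lambda>(t, x, u). b t x u) \<in> borel_measurable (lebesgue_on {0..T} \<Otimes>\<^sub>M borel) \<and>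
     (\<lambda>(t, x, u). f t x u) \<in> borel_measurable (lebesgue_on {0..T} \<Otimes>\<^sub>M borel) \<and>
     g \<in> borel_measurable borel \<and>
     (\<forall>t\<in>{0..T}. twice_differentiable (on_join (b t)) \<and> twice_differentiable (on_join (f t))) \<and>
     twice_differentiable g \<and>
     (\<forall>t\<in>{0..T}. \<forall>x u.
        norm (b t x u) \<le> L * (norm x + norm u + 1) \<and>
        norm (jac_x b t x u) + norm (jac_u b t x u) \<le> L \<and>
        norm (hess_xu_vec b t x u) \<le> L \<and>
        \<bar>f t x u\<bar> \<le> L * ((norm x)\<^sup>2 + (norm u)\<^sup>2 + 1) \<and>
        norm (grad_x f t x u) + norm (grad_u f t x u) \<le> L * (norm x + norm u + 1) \<and>
        norm (hess_xu f t x u) \<le> L) \<and>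
     (\<forall>t\<in>{0..T}. \<forall>x u x' u'.
        norm (hess_xu_vec b t x u - hess_xu_vec b t x' u') \<le> L * (norm (x - x') + norm (u - u')) \<and>
        norm (hess_xu f t x u - hess_xu f t x' u') \<le> L * (norm (x - x') + norm (u - u'))) \<and>
     (\<forall>x. \<bar>g x\<bar> \<le> L * ((norm x)\<^sup>2 + 1) \<and> norm (grad g x) \<le> L * (norm x + 1) \<and>
          norm (hess g x) \<le> L) \<and>
     (\<forall>x x'. norm (hess g x - hess g x') \<le> L * norm (x - x'))"

section \<open>State, cost, adjoint, Hamiltonian\<close>

text \<open>Solutions of \<open>x' = F t x\<close> on \<open>[0,T]\<close> in the sense of Caratheodory: \<open>x\<close> is the integral of the
  right-hand side, i.e. absolutely continuous and satisfying the equation almost everywhere.\<close>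

definition ode_solution ::
  "real \<Rightarrow> (real \<Rightarrow> 'a \<Rightarrow> 'a) \<Rightarrow> (real \<Rightarrow> 'a::euclidean_space) \<Rightarrow> bool" where
  "ode_solution T F x \<longleftrightarrow>
     integrable (lebesgue_on {0..T}) (\<lambda>s. F s (x s)) \<and>
     (\<forall>t\<in>{0..T}. x t = x 0 + (LINT s|lebesgue_on {0..t}. F s (x s)))"

text \<open>Solutions are unique on \<open>[0,T]\<close>; \<open>extensional\<close> pins down the irrelevant values elsewhere, so
  that the definite description is justified.\<close>

definition state ::
  "real \<Rightarrow> (real \<Rightarrow> real^'n \<Rightarrow> real^'m \<Rightarrow> real^'n) \<Rightarrow> real^'n \<Rightarrow> (real \<Rightarrow> real^'m) \<Rightarrow> real \<Rightarrow> real^'n" where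
  "state T b x0 u =
     (THE x. x \<in> extensional {0..T} \<and> ode_solution T (\<lambda>t x. b t x (u t)) x \<and> x 0 = x0)"

definition cost ::
  "real \<Rightarrow> (real \<Rightarrow> real^'n \<Rightarrow> real^'m \<Rightarrow> real^'n) \<Rightarrow> (real \<Rightarrow> real^'n \<Rightarrow> real^'m \<Rightarrow> real) \<Rightarrow>
   (real^'n \<Rightarrow> real) \<Rightarrow> real^'n \<Rightarrow> (real \<Rightarrow> real^'m) \<Rightarrow> real" where
  "cost T b f g x0 u =
     (let x = state T b x0 u
      in (LINT t|lebesgue_on {0..T}. f t (x t) (u t)) + g (x T))"

definition adjoint_state ::
  "real \<Rightarrow> (real \<Rightarrow> real^'n \<Rightarrow> real^'m \<Rightarrow> real^'n) \<Rightarrow> (real \<Rightarrow> real^'n \<Rightarrow> real^'m \<Rightarrow> real) \<Rightarrow>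
   (real^'n \<Rightarrow> real) \<Rightarrow> real^'n \<Rightarrow> (real \<Rightarrow> real^'m) \<Rightarrow> real \<Rightarrow> real^'n" where
  "adjoint_state T b f g x0 u =
     (let x = state T b x0 u
      in THE p. p \<in> extensional {0..T} \<and>
           ode_solution T (\<lambda>t p. - (transpose (jac_x b t (x t) (u t)) *v p) - grad_x f t (x t) (u t)) p \<and>
           p T = grad g (x T))"

definition hamiltonian ::
  "(real \<Rightarrow> real^'n \<Rightarrow> real^'m \<Rightarrow> real^'n) \<Rightarrow> (real \<Rightarrow> real^'n \<Rightarrow> real^'m \<Rightarrow> real) \<Rightarrow>
   real^'n \<Rightarrow> real \<Rightarrow> real^'n \<Rightarrow> real^'m \<Rightarrow> real" where
  "hamiltonian b f p t x u = b t x u \<bullet> p + f t x u"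

text \<open>The Riesz representative in \<open>L\<^sup>2\<close> of the derivative of the cost: the partial gradient
  in \<open>u\<close> of the Hamiltonian along state and adjoint.\<close>

definition cost_gradient ::
  "real \<Rightarrow> (real \<Rightarrow> real^'n \<Rightarrow> real^'m \<Rightarrow> real^'n) \<Rightarrow> (real \<Rightarrow> real^'n \<Rightarrow> real^'m \<Rightarrow> real) \<Rightarrow>
   (real^'n \<Rightarrow> real) \<Rightarrow> real^'n \<Rightarrow> (real \<Rightarrow> real^'m) \<Rightarrow> real \<Rightarrow> real^'m" where
  "cost_gradient T b f g x0 u t =
     grad_u (hamiltonian b f (adjoint_state T b f g x0 u t)) t (state T b x0 u t) (u t)"

definition optimal_control ::
  "real \<Rightarrow> (real \<Rightarrow> real^'n \<Rightarrow> real^'m \<Rightarrow> real^'n) \<Rightarrow> (real \<Rightarrow> real^'n \<Rightarrow> real^'m \<Rightarrow> real) \<Rightarrow>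
   (real^'n \<Rightarrow> real) \<Rightarrow> real^'n \<Rightarrow> (real \<Rightarrow> real^'m) \<Rightarrow> bool" where
  "optimal_control T b f g x0 u \<longleftrightarrow>
     u \<in> L2 T \<and> (\<forall>w\<in>L2 T. cost T b f g x0 u \<le> cost T b f g x0 w)"

section \<open>Linearized state and second variation\<close>

definition linearized_state ::
  "real \<Rightarrow> (real \<Rightarrow> real^'n \<Rightarrow> real^'m \<Rightarrow> real^'n) \<Rightarrow> real^'n \<Rightarrow> (real \<Rightarrow> real^'m) \<Rightarrow>
   (real \<Rightarrow> real^'m) \<Rightarrow> real \<Rightarrow> real^'n" where
  "linearized_state T b x0 u v =
     (let x = state T b x0 u
      in THE y. y \<in> extensional {0..T} \<and>
           ode_solution T (\<lambda>t y. jac_x b t (x t) (u t) *v y + jac_u b t (x t) (u t) *v v t) y \<and>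
           y 0 = 0)"

definition hamiltonian_quadratic ::
  "real \<Rightarrow> (real \<Rightarrow> real^'n \<Rightarrow> real^'m \<Rightarrow> real^'n) \<Rightarrow> (real \<Rightarrow> real^'n \<Rightarrow> real^'m \<Rightarrow> real) \<Rightarrow>
   (real^'n \<Rightarrow> real) \<Rightarrow> real^'n \<Rightarrow> (real \<Rightarrow> real^'m) \<Rightarrow> (real \<Rightarrow> real^'m) \<Rightarrow> real \<Rightarrow> real" where
  "hamiltonian_quadratic T b f g x0 u v t =
     (let w = join (linearized_state T b x0 u v t) (v t)
      in w \<bullet> (hess_xu (hamiltonian b f (adjoint_state T b f g x0 u t)) t (state T b x0 u t) (u t) *v w))"

definition terminal_quadratic ::
  "real \<Rightarrow> (real \<Rightarrow> real^'n \<Rightarrow> real^'m \<Rightarrow> real^'n) \<Rightarrow> (real^'n \<Rightarrow> real) \<Rightarrow> real^'n \<Rightarrow>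
   (real \<Rightarrow> real^'m) \<Rightarrow> (real \<Rightarrow> real^'m) \<Rightarrow> real" where
  "terminal_quadratic T b g x0 u v =
     (let yT = linearized_state T b x0 u v T in yT \<bullet> (hess g (state T b x0 u T) *v yT))"

definition coercive_at ::
  "real \<Rightarrow> (real \<Rightarrow> real^'n \<Rightarrow> real^'m \<Rightarrow> real^'n) \<Rightarrow> (real \<Rightarrow> real^'n \<Rightarrow> real^'m \<Rightarrow> real) \<Rightarrow>
   (real^'n \<Rightarrow> real) \<Rightarrow> real^'n \<Rightarrow> (real \<Rightarrow> real^'m) \<Rightarrow> real \<Rightarrow> bool" where
  "coercive_at T b f g x0 u \<alpha> \<longleftrightarrow>
     (\<forall>v\<in>L2 T. (LINT t|lebesgue_on {0..T}. hamiltonian_quadratic T b f g x0 u v t)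
                 + terminal_quadratic T b g x0 u v \<ge> \<alpha> * (norm_L2 T v)\<^sup>2)"

section \<open>Newton's method\<close>

definition newton_objective ::
  "real \<Rightarrow> (real \<Rightarrow> real^'n \<Rightarrow> real^'m \<Rightarrow> real^'n) \<Rightarrow> (real \<Rightarrow> real^'n \<Rightarrow> real^'m \<Rightarrow> real) \<Rightarrow>
   (real^'n \<Rightarrow> real) \<Rightarrow> real^'n \<Rightarrow> (real \<Rightarrow> real^'m) \<Rightarrow> (real \<Rightarrow> real^'m) \<Rightarrow> real" where
  "newton_objective T b f g x0 u v =
     1 / 2 * (LINT t|lebesgue_on {0..T}.
                2 * (cost_gradient T b f g x0 u t \<bullet> v t) + hamiltonian_quadratic T b f g x0 u v t)
     + 1 / 2 * terminal_quadratic T b g x0 u v"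

definition newton_direction ::
  "real \<Rightarrow> (real \<Rightarrow> real^'n \<Rightarrow> real^'m \<Rightarrow> real^'n) \<Rightarrow> (real \<Rightarrow> real^'n \<Rightarrow> real^'m \<Rightarrow> real) \<Rightarrow>
   (real^'n \<Rightarrow> real) \<Rightarrow> real^'n \<Rightarrow> (real \<Rightarrow> real^'m) \<Rightarrow> (real \<Rightarrow> real^'m) \<Rightarrow> bool" where
  "newton_direction T b f g x0 u v \<longleftrightarrow>
     v \<in> L2 T \<and>
     (\<forall>w\<in>L2 T. newton_objective T b f g x0 u v \<le> newton_objective T b f g x0 u w)"

definition unique_newton_direction ::
  "real \<Rightarrow> (real \<Rightarrow> real^'n \<Rightarrow> real^'m \<Rightarrow> real^'n) \<Rightarrow> (real \<Rightarrow> real^'n \<Rightarrow> real^'m \<Rightarrow> real) \<Rightarrow>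
   (real^'n \<Rightarrow> real) \<Rightarrow> real^'n \<Rightarrow> (real \<Rightarrow> real^'m) \<Rightarrow> bool" where
  "unique_newton_direction T b f g x0 u \<longleftrightarrow>
     (\<exists>v. newton_direction T b f g x0 u v) \<and>
     (\<forall>v w. newton_direction T b f g x0 u v \<and> newton_direction T b f g x0 u w \<longrightarrow> ae_eq T v w)"

definition stationary ::
  "real \<Rightarrow> (real \<Rightarrow> real^'n \<Rightarrow> real^'m \<Rightarrow> real^'n) \<Rightarrow> (real \<Rightarrow> real^'n \<Rightarrow> real^'m \<Rightarrow> real) \<Rightarrow>
   (real^'n \<Rightarrow> real) \<Rightarrow> real^'n \<Rightarrow> (real \<Rightarrow> real^'m) \<Rightarrow> bool" where
  "stationary T b f g x0 u \<longleftrightarrow> ae_eq T (cost_gradient T b f g x0 u) (\<lambda>t. 0)"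

text \<open>When the method stops at \<open>u k\<close>, the sequence stays constant. Stopping because the direction
  vanishes needs no separate clause: then \<open>u (Suc k)\<close> equals \<open>u k\<close>, and the direction
  at \<open>u (Suc k)\<close> vanishes again when directions are unique.\<close>

definition newton_sequence ::
  "real \<Rightarrow> (real \<Rightarrow> real^'n \<Rightarrow> real^'m \<Rightarrow> real^'n) \<Rightarrow> (real \<Rightarrow> real^'n \<Rightarrow> real^'m \<Rightarrow> real) \<Rightarrow>
   (real^'n \<Rightarrow> real) \<Rightarrow> real^'n \<Rightarrow> (real \<Rightarrow> real^'m) \<Rightarrow> (nat \<Rightarrow> real \<Rightarrow> real^'m) \<Rightarrow> bool" where
  "newton_sequence T b f g x0 u0 u \<longleftrightarrow>
     ae_eq T (u 0) u0 \<and>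
     (\<forall>k. if stationary T b f g x0 (u k) then ae_eq T (u (Suc k)) (u k)
          else (\<exists>v. newton_direction T b f g x0 (u k) v \<and>
                    ae_eq T (u (Suc k)) (\<lambda>t. u k t + v t)))"

text \<open>The method started at \<open>u0\<close> can be carried out: it produces a sequence, and each subproblem
  that has to be solved along the way has exactly one solution in \<open>L\<^sup>2\<close>.\<close>

definition newton_well_defined ::
  "real \<Rightarrow> (real \<Rightarrow> real^'n \<Rightarrow> real^'m \<Rightarrow> real^'n) \<Rightarrow> (real \<Rightarrow> real^'n \<Rightarrow> real^'m \<Rightarrow> real) \<Rightarrow>
   (real^'n \<Rightarrow> real) \<Rightarrow> real^'n \<Rightarrow> (real \<Rightarrow> real^'m) \<Rightarrow> bool" where
  "newton_well_defined T b f g x0 u0 \<longleftrightarrow>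
     (\<exists>u. newton_sequence T b f g x0 u0 u) \<and>
     (\<forall>u. newton_sequence T b f g x0 u0 u \<longrightarrow>
        (\<forall>k. \<not> stationary T b f g x0 (u k) \<longrightarrow> unique_newton_direction T b f g x0 (u k)))"

section \<open>Constants\<close>

definition C_x :: "real \<Rightarrow> real \<Rightarrow> real^'n \<Rightarrow> real" where
  "C_x T L x0 = max (exp (L * T) * (norm x0 + L * T)) (L * exp (L * T))"

definition K_p :: "real \<Rightarrow> real \<Rightarrow> real^'n \<Rightarrow> real" where
  "K_p T L x0 = L * exp (L * T) * (1 + C_x T L x0) * (T + 1)"

definition C_p :: "real \<Rightarrow> real \<Rightarrow> real^'n \<Rightarrow> real" where
  "C_p T L x0 = max (K_p T L x0)
     (L * exp (L * T) * (C_x T L x0 + (C_x T L x0 * T + 1) * (1 + K_p T L x0)))"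

definition C_H :: "real \<Rightarrow> real \<Rightarrow> real^'n \<Rightarrow> real" where
  "C_H T L x0 = max (L * (C_p T L x0 + C_x T L x0 + C_p T L x0 * C_x T L x0))
                    (L * (1 + C_p T L x0))"

definition C_1 :: "real \<Rightarrow> real \<Rightarrow> real^'n \<Rightarrow> real" where
  "C_1 T L x0 = max (C_x T L x0) (max (C_p T L x0) (C_H T L x0))"

definition C_y :: "real \<Rightarrow> real \<Rightarrow> real^'n \<Rightarrow> real" where
  "C_y T L x0 = L * exp (L * T) *
     ((C_1 T L x0 + L * exp (L * T) + C_1 T L x0 * L * T * exp (L * T)) * T + 1)"

definition K_psi :: "real \<Rightarrow> real \<Rightarrow> real^'n \<Rightarrow> real" where
  "K_psi T L x0 = exp (L * T) * (L * C_y T L x0 + C_1 T L x0 * (C_y T L x0 * T + 1))"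

definition C_psi :: "real \<Rightarrow> real \<Rightarrow> real^'n \<Rightarrow> real" where
  "C_psi T L x0 = max (K_psi T L x0)
     (exp (L * T) *
       (L * C_y T L x0 * (C_1 T L x0 * T + 1) + L * K_psi T L x0 * T * (C_1 T L x0 * T + 1)
        + C_1 T L x0 * (C_y T L x0 * T\<^sup>2 + 2 * C_y T L x0 * T + T + 1)))"

definition C_2 :: "real \<Rightarrow> real \<Rightarrow> real^'n \<Rightarrow> real" where
  "C_2 T L x0 = max (C_y T L x0) (C_psi T L x0)"

definition C_3 :: "real \<Rightarrow> real \<Rightarrow> real^'n \<Rightarrow> real" where
  "C_3 T L x0 = T * C_2 T L x0 * (L * (C_1 T L x0 * T + 2) + C_1 T L x0 * (T + 2))
                + C_1 T L x0 * (T + 1)"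

definition C_h :: "real \<Rightarrow> real \<Rightarrow> real^'n \<Rightarrow> real" where
  "C_h T L x0 = C_1 T L x0 * exp (L * T) * (T * L * exp (L * T) + 1) + L\<^sup>2 * exp (2 * L * T)"

definition gamma_const :: "real \<Rightarrow> real \<Rightarrow> real^'n \<Rightarrow> real \<Rightarrow> (real \<Rightarrow> real^'m) \<Rightarrow> real" where
  "gamma_const T L x0 \<alpha> ubar =
     \<alpha>\<^sup>2 / (T * (L * C_h T L x0 + C_1 T L x0 * L * exp (L * T)) * (1 + norm_L1 T ubar) + \<alpha>)"

definition r_3 :: "real \<Rightarrow> real \<Rightarrow> real^'n \<Rightarrow> real \<Rightarrow> (real \<Rightarrow> real^'m) \<Rightarrow> real" where
  "r_3 T L x0 \<alpha> ubar =
     min (\<alpha> / (C_3 T L x0 * (1 + norm_L1 T ubar)))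
         ((sqrt ((C_3 T L x0)\<^sup>2 * (1 + norm_L1 T ubar)\<^sup>2 + C_3 T L x0 * T * gamma_const T L x0 \<alpha> ubar)
           - C_3 T L x0 * (1 + norm_L1 T ubar)) / (C_3 T L x0 * T))"

end

theory Submission
  imports Defs
begin

text \<open>Write \<open>J'(u) = H\<^sub>u\<close> and \<open>J''(u)\<close> for the operator that sends \<open>v\<close> to the control component of
  \<open>D\<^sup>T \<psi> + H'' (y, v)\<close>, where \<open>y\<close> solves the linearized state equation and \<open>\<psi>\<close> its adjoint equation.
  Coercivity forces the control block of \<open>H''\<close> to be at least \<open>\<alpha>\<close> almost everywhere (test with controls
  supported on small sets), which lifts the bound \<open>\<alpha>\<close> in \<open>L\<^sup>2\<close> to \<open>\<parallel>v\<parallel> \<le> \<parallel>J''(ubar) v\<parallel> / \<gamma>\<close> in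
  \<open>L\<^sup>\<infinity>\<close>. Gronwall estimates give
  \<open>\<parallel>(J''(u) - J''(ubar)) v\<parallel> \<le> C\<^sub>3 (1 + \<parallel>ubar\<parallel>\<^sub>1) e \<parallel>v\<parallel>\<close> and
  \<open>\<parallel>J'(u) - J'(ubar) - J''(u) (u - ubar)\<parallel> \<le> q C\<^sub>3 (1 + \<parallel>ubar\<parallel>\<^sub>1 + T e) e\<^sup>2\<close> with \<open>e = \<parallel>u - ubar\<parallel>\<close>
  and some \<open>q < 1\<close>. The Newton equation \<open>J''(u) v = - J'(u)\<close> is solvable because it is a linear two-point
  boundary value problem without nontrivial homogeneous solutions. Since \<open>J'(ubar) = 0\<close>, the new error
  \<open>e'\<close> satisfies \<open>(\<gamma> - C\<^sub>3 (1 + \<parallel>ubar\<parallel>\<^sub>1) e) e' \<le> q C\<^sub>3 (1 + \<parallel>ubar\<parallel>\<^sub>1 + T e) e\<^sup>2\<close>, and \<open>e \<le> r\<^sub>3\<close> says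
  precisely that \<open>C\<^sub>3 (1 + \<parallel>ubar\<parallel>\<^sub>1 + T e) e \<le> \<gamma> - C\<^sub>3 (1 + \<parallel>ubar\<parallel>\<^sub>1) e\<close>; hence \<open>e' \<le> q e\<close>.\<close>

section \<open>Joined vectors, gradients and Hessians\<close>

text \<open>Coercivity lives in L2, but J'' is Lipschitz only for perturbations in L\<infinity>: a
  product |u - ubar| |v| is controlled in L2 by the supremum of u - ubar. Hence the inverse bound
  has to be lifted. It is lifted only at ubar; at an iterate u, J''(u) is compared with J''(ubar).
  The factor q < 1 is needed because the ball of radius r_3 is closed: with C_3 itself in the
  remainder, the radius would give only e' \<le> e. Expanding H_u and H_x at one fixed adjoint saves
  the term T L C_p, so q = 1 - T L C_p / C_3. Inside the ball the gradient is comparable to the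
  error from both sides. The lower estimate shows that the stopping test can succeed only at ubar;
  both together carry the quadratic rate over to the gradients. The data are merely measurable in
  time, so equations are understood in integral form and measurability of derivatives is recovered
  from difference quotients. Symmetry of the Hessians, on which all expansions of quadratic forms
  rest, is derived from their Lipschitz continuity.\<close>

lemma xpart_join [simp]: "xpart (join x u) = x"
  and upart_join [simp]: "upart (join x u) = u"
  and join_parts [simp]: "join (xpart z) (upart z) = z"
  by (simp_all add: xpart_def upart_def join_def vec_eq_iff split: sum.split)

lemma inner_join: "join x u \<bullet> z = x \<bullet> xpart z + u \<bullet> upart z"
  by (simp add: inner_vec_def UNIV_Plus_UNIV[symmetric] sum.Plus join_def xpart_def upart_def
      del: UNIV_Plus_UNIV)

lemma inner_parts: "w \<bullet> z = xpart w \<bullet> xpart z + upart w \<bullet> upart z"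
  using inner_join[of "xpart w" "upart w" z] by simp

lemma norm_join_sq: "(norm (join x u))\<^sup>2 = (norm x)\<^sup>2 + (norm u)\<^sup>2"
  by (simp add: power2_norm_eq_inner inner_join)

lemma norm_join_le: "norm (join x u) \<le> norm x + norm u"
proof (rule power2_le_imp_le)
  show "(norm (join x u))\<^sup>2 \<le> (norm x + norm u)\<^sup>2"
    by (simp add: norm_join_sq power2_sum)
qed simp

lemma norm_xpart_le: "norm (xpart z) \<le> norm z"
  and norm_upart_le: "norm (upart z) \<le> norm z"
  using norm_join_sq[of "xpart z" "upart z"] by (auto intro: power2_le_imp_le)

lemma linear_xpart: "linear xpart" and linear_upart: "linear upart"
  by (auto intro!: linearI simp: xpart_def upart_def vec_eq_iff)

lemma linear_join: "linear (\<lambda>p. join (fst p) (snd p))"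
  by (auto intro!: linearI simp: join_def vec_eq_iff split: sum.split)

lemma parts_add [simp]: "xpart (z + w) = xpart z + xpart w" "upart (z + w) = upart z + upart w"
  and parts_diff [simp]: "xpart (z - w) = xpart z - xpart w" "upart (z - w) = upart z - upart w"
  and parts_minus [simp]: "xpart (- z) = - xpart z" "upart (- z) = - upart z"
  and parts_scaleR [simp]: "xpart (c *\<^sub>R z) = c *\<^sub>R xpart z" "upart (c *\<^sub>R z) = c *\<^sub>R upart z"
  by (simp_all add: xpart_def upart_def vec_eq_iff)

lemma join_add: "join (x + x') (u + u') = join x u + join x' u'"
  and join_diff: "join (x - x') (u - u') = join x u - join x' u'"
  and join_scaleR: "join (c *\<^sub>R x) (c *\<^sub>R u) = c *\<^sub>R join x u"
  by (simp_all add: join_def vec_eq_iff split: sum.split)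

lemma join_zero [simp]: "join 0 0 = 0"
  by (simp add: join_def vec_eq_iff split: sum.split)

lemma bounded_linear_parts: "bounded_linear xpart" "bounded_linear upart"
  "bounded_linear (\<lambda>p. join (fst p) (snd p))"
  by (simp_all add: linear_conv_bounded_linear[symmetric] linear_xpart linear_upart linear_join)

lemma borel_measurable_parts [measurable]:
  "xpart \<in> borel_measurable borel" "upart \<in> borel_measurable borel"
  by (auto intro!: borel_measurable_continuous_onI linear_continuous_on bounded_linear_parts)

lemma borel_measurable_join [measurable]:
  assumes [measurable]: "x \<in> borel_measurable M" "u \<in> borel_measurable M"
  shows "(\<lambda>t. join (x t) (u t)) \<in> borel_measurable M"
proof -
  have [measurable]: "(\<lambda>p. join (fst p) (snd p)) \<in> borel_measurable borel"
    by (auto intro!: borel_measurable_continuous_onI linear_continuous_on bounded_linear_parts)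
  have "(\<lambda>t. (\<lambda>p. join (fst p) (snd p)) (x t, u t)) \<in> borel_measurable M"
    by measurable
  then show ?thesis by simp
qed

text \<open>The library norm of a matrix is the Frobenius norm, so Cauchy-Schwarz row by row
  suffices, and the assumed bounds on arrays of derivatives apply directly.\<close>

lemma norm_matrix_vector_le: "norm (A *v x) \<le> norm A * norm x"
  for A :: "real^'n^'m"
proof -
  have "norm (A *v x) \<le> L2_set (\<lambda>i. norm (A $ i) * norm x) UNIV"
    unfolding norm_vec_def[of "A *v x"]
    using Cauchy_Schwarz_ineq2[of "A $ _" x]
    by (intro L2_set_mono) (auto simp: matrix_vector_mult_def inner_vec_def)
  also have "\<dots> = norm A * norm x"
    by (simp add: norm_vec_def[of A] L2_set_left_distrib)
  finally show ?thesis .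
qed

lemma inner_matrix_transpose: "(transpose A *v p) \<bullet> y = p \<bullet> (A *v y)"
  for A :: "real^'n^'m"
  by (simp add: dot_lmul_matrix[symmetric])

lemma norm_transpose_vector_le: "norm (transpose A *v p) \<le> norm A * norm p"
  for A :: "real^'n^'m"
proof (cases "transpose A *v p = 0")
  case False
  have "(norm (transpose A *v p))\<^sup>2 = p \<bullet> (A *v (transpose A *v p))"
    by (metis inner_matrix_transpose power2_norm_eq_inner)
  also have "\<dots> \<le> norm p * (norm A * norm (transpose A *v p))"
    by (intro order_trans[OF norm_cauchy_schwarz] mult_left_mono norm_matrix_vector_le) simp
  finally show ?thesis using False by (simp add: power2_eq_square mult_ac)
qed simp

lemma transpose_minus: "transpose (A - B) = transpose A - transpose B"
  by (simp add: transpose_def vec_eq_iff)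

lemma continuous_on_vec_nth: "continuous_on UNIV (\<lambda>v :: 'a::real_normed_vector^'n. v $ i)"
  by (intro continuous_intros)

lemma borel_measurable_vec_nth [measurable]:
  "(\<lambda>v :: 'a::{real_normed_vector,second_countable_topology}^'n. v $ i) \<in> borel_measurable borel"
  by (intro borel_measurable_continuous_onI continuous_on_vec_nth)

lemma borel_measurable_vec_lambda:
  fixes F :: "'i::finite \<Rightarrow> 't \<Rightarrow> 'a::euclidean_space"
  assumes "\<And>i. F i \<in> borel_measurable M"
  shows "(\<lambda>t. \<chi> i. F i t) \<in> borel_measurable M"
proof (subst borel_measurable_euclidean_space, safe)
  fix b :: "'a^'i" assume "b \<in> Basis"
  then obtain i e where b: "b = axis i e" by (auto simp: Basis_vec_def)
  show "(\<lambda>t. (\<chi> i. F i t) \<bullet> b) \<in> borel_measurable M"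
    using assms[of i] by (simp add: b inner_axis)
qed

lemma borel_measurable_matrix_vector [measurable]:
  fixes A :: "'t \<Rightarrow> real^'n^'m"
  assumes [measurable]: "A \<in> borel_measurable M" "x \<in> borel_measurable M"
  shows "(\<lambda>t. A t *v x t) \<in> borel_measurable M"
  unfolding matrix_vector_mult_def by (intro borel_measurable_vec_lambda) measurable

lemma borel_measurable_transpose [measurable]:
  fixes A :: "'t \<Rightarrow> real^'n^'m"
  assumes [measurable]: "A \<in> borel_measurable M"
  shows "(\<lambda>t. transpose (A t)) \<in> borel_measurable M"
  unfolding transpose_def by (intro borel_measurable_vec_lambda) measurable

lemma grad_eqI: "(\<phi> has_derivative (\<lambda>h. h \<bullet> D)) (at z) \<Longrightarrow> grad \<phi> z = D"
  unfolding grad_def gderiv_def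
proof (rule the_equality)
  fix E assume D: "(\<phi> has_derivative (\<lambda>h. h \<bullet> D)) (at z)" and E: "(\<phi> has_derivative (\<lambda>h. h \<bullet> E)) (at z)"
  from has_derivative_unique[OF E D] have "\<forall>h. h \<bullet> E = h \<bullet> D" by (simp add: fun_eq_iff)
  then show "E = D" using vector_eq_ldot by blast
qed

text \<open>Summing the values on \<open>Basis\<close> turns the operator-valued derivative of
  \<open>twice_differentiable\<close> into a Riesz vector. This is linear in the operator, so
  differentiability of the derivative passes to \<open>grad\<close>.\<close>

lemma
  fixes \<phi> :: "real^'k \<Rightarrow> real"
  assumes "twice_differentiable \<phi>"
  shows has_derivative_grad: "(\<phi> has_derivative (\<lambda>h. h \<bullet> grad \<phi> z)) (at z)"
    and has_derivative_hess: "(grad \<phi> has_derivative (\<lambda>h. hess \<phi> z *v h)) (at z)"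
proof -
  obtain \<phi>' where d: "\<And>z. (\<phi> has_derivative blinfun_apply (\<phi>' z)) (at z)"
    and d2: "\<And>z. \<phi>' differentiable (at z)"
    using assms unfolding twice_differentiable_def by auto
  define G where "G z = (\<Sum>i\<in>Basis. blinfun_apply (\<phi>' z) i *\<^sub>R i)" for z
  have *: "blinfun_apply (\<phi>' z) = (\<lambda>h. h \<bullet> G z)" for z
  proof
    fix h
    have "blinfun_apply (\<phi>' z) h = blinfun_apply (\<phi>' z) (\<Sum>i\<in>Basis. (h \<bullet> i) *\<^sub>R i)"
      by (simp add: euclidean_representation)
    also have "\<dots> = h \<bullet> G z"
      by (simp add: blinfun.sum_right blinfun.scaleR_right G_def inner_sum_right mult.commute)
    finally show "blinfun_apply (\<phi>' z) h = h \<bullet> G z" .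
  qed
  have G: "(\<phi> has_derivative (\<lambda>h. h \<bullet> G z)) (at z)" for z
    using d[of z] by (simp add: *)
  have eq: "grad \<phi> = G"
    using grad_eqI[OF G] by auto
  show "(\<phi> has_derivative (\<lambda>h. h \<bullet> grad \<phi> z)) (at z)"
    using G eq by simp
  obtain D where "(\<phi>' has_derivative D) (at z)"
    using d2[of z] unfolding differentiable_def by blast
  then have "(G has_derivative (\<lambda>h. \<Sum>i\<in>Basis. blinfun_apply (D h) i *\<^sub>R i)) (at z)"
    unfolding G_def
    by (auto intro!: derivative_eq_intros bounded_linear.has_derivative[OF blinfun.bounded_linear_left])
  then have "grad \<phi> differentiable (at z)"
    unfolding eq differentiable_def by blast
  then show "(grad \<phi> has_derivative (\<lambda>h. hess \<phi> z *v h)) (at z)"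
    unfolding hess_def by (simp add: jacobian_works[symmetric])
qed

lemma hess_eqI:
  fixes \<phi> :: "real^'k \<Rightarrow> real"
  assumes "(grad \<phi> has_derivative (\<lambda>h. Q *v h)) (at z)"
  shows "hess \<phi> z = Q"
  using frechet_derivative_at[OF assms] unfolding hess_def jacobian_def
  by (metis matrix_of_matrix_vector_mul)

text \<open>With \<open>p\<close> an adjoint value this covers the Hamiltonian; with
  \<open>p\<close> a unit vector and a constant \<open>f\<close> it covers the components of the
  dynamics.\<close>

lemma twice_differentiable_inner_add:
  fixes b :: "'a::real_normed_vector \<Rightarrow> 'b::real_inner"
  assumes "twice_differentiable b" "twice_differentiable f"
  shows "twice_differentiable (\<lambda>z. b z \<bullet> p + f z)"
proof -
  obtain b' where b: "\<And>z. (b has_derivative blinfun_apply (b' z)) (at z)"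
    "\<And>z. b' differentiable (at z)"
    using assms unfolding twice_differentiable_def by auto
  obtain f' where f: "\<And>z. (f has_derivative blinfun_apply (f' z)) (at z)"
    "\<And>z. f' differentiable (at z)"
    using assms unfolding twice_differentiable_def by auto
  define \<phi>' where "\<phi>' z = (blinfun_inner_left p o\<^sub>L b' z) + f' z" for z
  have "((\<lambda>z. b z \<bullet> p + f z) has_derivative blinfun_apply (\<phi>' z)) (at z)" for z
    unfolding \<phi>'_def
    by (auto intro!: derivative_eq_intros b f simp: fun_eq_iff blinfun.add_left inner_commute)
  moreover have "\<phi>' differentiable (at z)" for z
  proof -
    obtain B F where "(b' has_derivative B) (at z)" "(f' has_derivative F) (at z)"
      using b(2)[of z] f(2)[of z] unfolding differentiable_def by blast
    then have "(\<phi>' has_derivative (\<lambda>h. (blinfun_inner_left p o\<^sub>L B h) + F h)) (at z)"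
      unfolding \<phi>'_def
      by (auto intro!: derivative_eq_intros
          bounded_linear.has_derivative[OF bounded_bilinear.bounded_linear_right
            [OF bounded_bilinear_blinfun_compose]])
    then show ?thesis unfolding differentiable_def by blast
  qed
  ultimately show ?thesis unfolding twice_differentiable_def by blast
qed

lemma twice_differentiable_const: "twice_differentiable (\<lambda>z. c)"
  unfolding twice_differentiable_def by (intro exI[of _ "\<lambda>_. 0"]) (auto simp: zero_blinfun.rep_eq)

lemma grad_lipschitz:
  fixes \<phi> :: "real^'k \<Rightarrow> real"
  assumes "twice_differentiable \<phi>" "\<And>z. norm (hess \<phi> z) \<le> B"
  shows "norm (grad \<phi> z - grad \<phi> z') \<le> B * norm (z - z')"
proof (rule differentiable_bound[where S = UNIV])
  show "(grad \<phi> has_derivative (\<lambda>h. hess \<phi> z *v h)) (at z within UNIV)" for z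
    using has_derivative_hess[OF assms(1)] .
  show "onorm ((*v) (hess \<phi> z)) \<le> B" for z
    by (rule onorm_le)
      (meson assms(2) norm_matrix_vector_le mult_right_mono norm_ge_zero order_trans)
qed auto

text \<open>The Hessian sits at \<open>z\<close>, the end that will be the current iterate, because
  Newton's method uses J''(u) and not the derivative at the limit.\<close>

lemma grad_linearization:
  fixes \<phi> :: "real^'k \<Rightarrow> real"
  assumes "twice_differentiable \<phi>"
    "\<And>\<xi>. \<xi> \<in> closed_segment z' z \<Longrightarrow> norm (hess \<phi> \<xi> - hess \<phi> z) \<le> B"
  shows "norm (grad \<phi> z - grad \<phi> z' - hess \<phi> z *v (z - z')) \<le> B * norm (z - z')"
proof -
  have seg: "z' + t *\<^sub>R (z - z') \<in> closed_segment z' z" if "t \<in> {0..1}" for t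
    using that unfolding closed_segment_def by (intro CollectI exI[of _ t]) (auto simp: algebra_simps)
  have D: "(grad \<phi> has_derivative (\<lambda>h. hess \<phi> \<xi> *v h)) (at \<xi> within closed_segment z' z)" for \<xi>
    using has_derivative_hess[OF assms(1)] has_derivative_at_withinI by blast
  have O: "onorm ((*v) (hess \<phi> \<xi>) - (*v) (hess \<phi> z)) \<le> B" if "\<xi> \<in> closed_segment z' z" for \<xi>
  proof (rule onorm_le)
    fix h
    have "norm ((hess \<phi> \<xi> - hess \<phi> z) *v h) \<le> B * norm h"
      by (meson assms(2)[OF that] norm_matrix_vector_le mult_right_mono norm_ge_zero order_trans)
    then show "norm (((*v) (hess \<phi> \<xi>) - (*v) (hess \<phi> z)) h) \<le> B * norm h"
      by (simp add: matrix_vector_mult_diff_rdistrib)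
  qed
  show ?thesis
    using differentiable_bound_linearization[of z' z "closed_segment z' z" "grad \<phi>"
        "\<lambda>\<xi> h. hess \<phi> \<xi> *v h" z B, OF seg D O]
    by (simp add: mult.commute)
qed

lemma linearization_bound:
  fixes \<phi> :: "real^'k \<Rightarrow> real"
  assumes "twice_differentiable \<phi>" "\<And>z. norm (hess \<phi> z) \<le> B"
  shows "\<bar>\<phi> z - \<phi> z' - (z - z') \<bullet> grad \<phi> z'\<bar> \<le> B * (norm (z - z'))\<^sup>2"
proof -
  have B: "B \<ge> 0" using assms(2)[of 0] by (smt (verit) norm_ge_zero)
  have seg: "z' + t *\<^sub>R (z - z') \<in> closed_segment z' z" if "t \<in> {0..1}" for t
    using that unfolding closed_segment_def by (intro CollectI exI[of _ t]) (auto simp: algebra_simps)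
  have D: "(\<phi> has_derivative (\<lambda>h. h \<bullet> grad \<phi> \<xi>)) (at \<xi> within closed_segment z' z)" for \<xi>
    using has_derivative_grad[OF assms(1)] has_derivative_at_withinI by blast
  have O: "onorm ((\<lambda>h. h \<bullet> grad \<phi> \<xi>) - (\<lambda>h. h \<bullet> grad \<phi> z')) \<le> B * norm (z - z')"
    if "\<xi> \<in> closed_segment z' z" for \<xi>
  proof (rule onorm_le)
    fix h
    have "norm (h \<bullet> grad \<phi> \<xi> - h \<bullet> grad \<phi> z') \<le> norm h * norm (grad \<phi> \<xi> - grad \<phi> z')"
      by (metis Cauchy_Schwarz_ineq2 inner_diff_right real_norm_def)
    also have "\<dots> \<le> norm h * (B * norm (\<xi> - z'))"
      by (intro mult_left_mono grad_lipschitz assms) simp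
    also have "\<dots> \<le> norm h * (B * norm (z - z'))"
      using that B segment_bound1[OF that] by (intro mult_left_mono) (auto simp: norm_minus_commute)
    finally show "norm (((\<lambda>h. h \<bullet> grad \<phi> \<xi>) - (\<lambda>h. h \<bullet> grad \<phi> z')) h) \<le> B * norm (z - z') * norm h"
      by (simp add: mult_ac)
  qed
  show ?thesis
    using differentiable_bound_linearization[of z' z "closed_segment z' z" \<phi>
        "\<lambda>\<xi> h. h \<bullet> grad \<phi> \<xi>" z' "B * norm (z - z')", OF seg D O]
    by (simp add: power2_eq_square mult_ac)
qed

text \<open>Two mean value steps, in direction \<open>h\<close> and then in direction
  \<open>k\<close>, express the mixed second difference by the Hessian at a point within O(s) of
  \<open>z\<close>; Lipschitz continuity supplies the extra factor s.\<close>

lemma second_difference_bound: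
  fixes \<phi> :: "real^'k \<Rightarrow> real"
  assumes "twice_differentiable \<phi>" "\<And>z z'. norm (hess \<phi> z - hess \<phi> z') \<le> B * norm (z - z')"
    and "0 < s"
  shows "\<bar>\<phi> (z + s *\<^sub>R h + s *\<^sub>R k) - \<phi> (z + s *\<^sub>R h) - \<phi> (z + s *\<^sub>R k) + \<phi> z
           - s\<^sup>2 * (h \<bullet> (hess \<phi> z *v k))\<bar> \<le> s ^ 3 * (B * (norm h + norm k) * norm h * norm k)"
proof -
  note dg = has_derivative_grad[OF assms(1)] and dh = has_derivative_hess[OF assms(1)]
  have B: "0 \<le> B * norm (z - z')" for z z' :: "real^'k"
    using assms(2)[of z z'] by (smt (verit) norm_ge_zero)
  define \<psi> where "\<psi> \<tau> = \<phi> (z + \<tau> *\<^sub>R h + s *\<^sub>R k) - \<phi> (z + \<tau> *\<^sub>R h)" for \<tau> :: real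
  have D\<psi>: "DERIV \<psi> \<tau> :> h \<bullet> (grad \<phi> (z + \<tau> *\<^sub>R h + s *\<^sub>R k) - grad \<phi> (z + \<tau> *\<^sub>R h))" for \<tau>
    unfolding \<psi>_def has_field_derivative_def
    by (auto intro!: derivative_eq_intros has_derivative_compose[OF _ dg] simp: algebra_simps)
  obtain \<tau> where \<tau>: "0 < \<tau>" "\<tau> < s"
    "\<psi> s - \<psi> 0 = (s - 0) * (h \<bullet> (grad \<phi> (z + \<tau> *\<^sub>R h + s *\<^sub>R k) - grad \<phi> (z + \<tau> *\<^sub>R h)))"
    using MVT2[OF assms(3) D\<psi>] by auto
  define \<omega> where "\<omega> \<sigma> = h \<bullet> grad \<phi> (z + \<tau> *\<^sub>R h + \<sigma> *\<^sub>R k)" for \<sigma> :: real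
  have D\<omega>: "DERIV \<omega> \<sigma> :> h \<bullet> (hess \<phi> (z + \<tau> *\<^sub>R h + \<sigma> *\<^sub>R k) *v k)" for \<sigma>
    unfolding \<omega>_def has_field_derivative_def
    by (auto intro!: derivative_eq_intros has_derivative_compose[OF _ dh]
        simp: algebra_simps matrix_vector_mult_scaleR)
  obtain \<sigma> where \<sigma>: "0 < \<sigma>" "\<sigma> < s"
    "\<omega> s - \<omega> 0 = (s - 0) * (h \<bullet> (hess \<phi> (z + \<tau> *\<^sub>R h + \<sigma> *\<^sub>R k) *v k))"
    using MVT2[OF assms(3) D\<omega>] by auto
  let ?\<xi> = "z + \<tau> *\<^sub>R h + \<sigma> *\<^sub>R k"
  have "\<phi> (z + s *\<^sub>R h + s *\<^sub>R k) - \<phi> (z + s *\<^sub>R h) - \<phi> (z + s *\<^sub>R k) + \<phi> z = \<psi> s - \<psi> 0"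
    by (simp add: \<psi>_def)
  also have "\<dots> = s * (\<omega> s - \<omega> 0)"
    using \<tau>(3) by (simp add: \<omega>_def inner_diff_right)
  also have "\<dots> = s\<^sup>2 * (h \<bullet> (hess \<phi> ?\<xi> *v k))"
    using \<sigma>(3) by (simp add: power2_eq_square)
  finally have "\<bar>\<phi> (z + s *\<^sub>R h + s *\<^sub>R k) - \<phi> (z + s *\<^sub>R h) - \<phi> (z + s *\<^sub>R k) + \<phi> z
      - s\<^sup>2 * (h \<bullet> (hess \<phi> z *v k))\<bar> = s\<^sup>2 * \<bar>h \<bullet> ((hess \<phi> ?\<xi> - hess \<phi> z) *v k)\<bar>"
    by (simp add: matrix_vector_mult_diff_rdistrib inner_diff_right abs_mult
        flip: right_diff_distrib)
  also have "\<dots> \<le> s\<^sup>2 * (norm h * (norm (hess \<phi> ?\<xi> - hess \<phi> z) * norm k))"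
    by (intro mult_left_mono order_trans[OF Cauchy_Schwarz_ineq2] norm_matrix_vector_le) auto
  also have "\<dots> \<le> s\<^sup>2 * (norm h * ((B * norm (?\<xi> - z)) * norm k))"
    by (intro mult_left_mono mult_right_mono assms(2)) auto
  also have "\<dots> \<le> s\<^sup>2 * (norm h * ((B * (s * (norm h + norm k))) * norm k))"
  proof (cases "norm h = 0")
    case False
    then have "0 \<le> B" using B[of h 0] by (simp add: zero_le_mult_iff)
    moreover have "norm (?\<xi> - z) \<le> s * (norm h + norm k)"
    proof -
      have "norm (?\<xi> - z) \<le> norm (\<tau> *\<^sub>R h) + norm (\<sigma> *\<^sub>R k)"
        using norm_triangle_ineq[of "\<tau> *\<^sub>R h" "\<sigma> *\<^sub>R k"] by (simp add: add.assoc)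
      also have "\<dots> \<le> s * norm h + s * norm k"
        using \<tau> \<sigma> by (intro add_mono) (auto intro: mult_right_mono)
      finally show ?thesis by (simp add: distrib_left)
    qed
    ultimately show ?thesis by (intro mult_left_mono mult_right_mono) auto
  qed auto
  finally show ?thesis by (simp add: power2_eq_square power3_eq_cube mult_ac)
qed

text \<open>The mixed second difference does not change when \<open>h\<close> and \<open>k\<close>
  are swapped, so s^2 times the two bilinear values differ by O(s^3); letting s tend to 0 gives
  equality.\<close>

lemma hess_symmetric:
  fixes \<phi> :: "real^'k \<Rightarrow> real"
  assumes "twice_differentiable \<phi>" "\<And>z z'. norm (hess \<phi> z - hess \<phi> z') \<le> B * norm (z - z')"
  shows "transpose (hess \<phi> z) = hess \<phi> z"
proof -
  have eq: "h \<bullet> (hess \<phi> z *v k) = k \<bullet> (hess \<phi> z *v h)" for h k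
  proof -
    let ?C = "B * (norm h + norm k) * norm h * norm k"
    let ?d = "h \<bullet> (hess \<phi> z *v k) - k \<bullet> (hess \<phi> z *v h)"
    have *: "\<bar>?d\<bar> \<le> s * (2 * ?C)" if "0 < s" for s
    proof -
      let ?D = "\<phi> (z + s *\<^sub>R h + s *\<^sub>R k) - \<phi> (z + s *\<^sub>R h) - \<phi> (z + s *\<^sub>R k) + \<phi> z"
      have 1: "\<bar>?D - s\<^sup>2 * (h \<bullet> (hess \<phi> z *v k))\<bar> \<le> s ^ 3 * ?C"
        by (rule second_difference_bound[OF assms that])
      have 2: "\<bar>?D - s\<^sup>2 * (k \<bullet> (hess \<phi> z *v h))\<bar> \<le> s ^ 3 * ?C"
        using second_difference_bound[OF assms that, of z k h]
        by (simp add: algebra_simps)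
      have "s\<^sup>2 * \<bar>?d\<bar> = \<bar>s\<^sup>2 * (h \<bullet> (hess \<phi> z *v k)) - s\<^sup>2 * (k \<bullet> (hess \<phi> z *v h))\<bar>"
        by (simp add: abs_mult flip: right_diff_distrib)
      also have "\<dots> \<le> s ^ 3 * (2 * ?C)"
        using 1 2 by linarith
      finally have "s\<^sup>2 * \<bar>?d\<bar> \<le> s ^ 3 * (2 * ?C)" .
      then have "s\<^sup>2 * \<bar>?d\<bar> \<le> s\<^sup>2 * (s * (2 * ?C))"
        by (simp add: power2_eq_square power3_eq_cube mult_ac)
      then show ?thesis using that by simp
    qed
    have "\<bar>?d\<bar> \<le> 0"
    proof (rule tendsto_lowerbound)
      show "((\<lambda>s. s * (2 * ?C)) \<longlongrightarrow> 0) (at_right 0)"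
        by (auto intro!: tendsto_eq_intros)
      show "\<forall>\<^sub>F s in at_right 0. \<bar>?d\<bar> \<le> s * (2 * ?C)"
        using * by (auto simp: eventually_at_right_field intro!: exI[of _ 1])
    qed auto
    then show ?thesis by simp
  qed
  have "(transpose (hess \<phi> z) *v h) \<bullet> k = (hess \<phi> z *v h) \<bullet> k" for h k
    by (metis inner_matrix_transpose eq inner_commute)
  then show ?thesis
    unfolding matrix_eq using vector_eq_rdot by blast
qed

section \<open>Measurability of derivatives along measurable curves\<close>

lemma borel_measurable_grad:
  fixes \<phi> :: "'t \<Rightarrow> real^'k \<Rightarrow> real"
  assumes meas: "\<And>z. z \<in> borel_measurable M \<Longrightarrow> (\<lambda>t. \<phi> t (z t)) \<in> borel_measurable M"
    and deriv: "\<And>t z. t \<in> space M \<Longrightarrow> (\<phi> t has_derivative (\<lambda>h. h \<bullet> grad (\<phi> t) z)) (at z)"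
    and [measurable]: "z \<in> borel_measurable M"
  shows "(\<lambda>t. grad (\<phi> t) (z t)) \<in> borel_measurable M"
proof (subst borel_measurable_euclidean_space, safe)
  fix e :: "real^'k" assume "e \<in> Basis"
  show "(\<lambda>t. grad (\<phi> t) (z t) \<bullet> e) \<in> borel_measurable M"
  \<comment> \<open>A directional derivative is the limit of difference quotients with step 1/(n+1).
    Each quotient also evaluates \<phi> along a shifted curve, which is why \<open>meas\<close>
    quantifies over all measurable curves.\<close>
  proof (rule borel_measurable_LIMSEQ_real)
    show "(\<lambda>t. (\<phi> t (z t + (1 / real (Suc n)) *\<^sub>R e) - \<phi> t (z t)) * real (Suc n)) \<in> borel_measurable M" for n
      using meas[of z] meas[of "\<lambda>t. z t + (1 / real (Suc n)) *\<^sub>R e"] by measurable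
    fix t assume t: "t \<in> space M"
    have "DERIV (\<lambda>s. \<phi> t (z t + s *\<^sub>R e)) 0 :> grad (\<phi> t) (z t) \<bullet> e"
    proof -
      have "((\<lambda>s. \<phi> t (z t + s *\<^sub>R e)) has_derivative
          (\<lambda>s. (s *\<^sub>R e) \<bullet> grad (\<phi> t) (z t + 0 *\<^sub>R e))) (at 0)"
        by (rule has_derivative_compose[OF _ deriv[OF t]]) (auto intro!: derivative_eq_intros)
      then show ?thesis
        unfolding has_field_derivative_def by (simp add: inner_commute mult.commute[of _ "e \<bullet> _"])
    qed
    then have lim: "(\<lambda>s. (\<phi> t (z t + s *\<^sub>R e) - \<phi> t (z t)) / s) \<midarrow>0\<rightarrow> grad (\<phi> t) (z t) \<bullet> e"
      by (simp add: DERIV_def)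
    have "filterlim (\<lambda>n. 1 / real (Suc n)) (at 0) sequentially"
      using LIMSEQ_inverse_real_of_nat by (auto simp: filterlim_at inverse_eq_divide)
    from filterlim_compose[OF lim this]
    show "(\<lambda>n. (\<phi> t (z t + (1 / real (Suc n)) *\<^sub>R e) - \<phi> t (z t)) * real (Suc n))
        \<longlonglongrightarrow> grad (\<phi> t) (z t) \<bullet> e"
      by simp
  qed
qed

text \<open>Row i of the Hessian is the gradient of the i-th component of the gradient, so the
  previous lemma is used twice: for the component and for its own gradient.\<close>

lemma borel_measurable_hess:
  fixes \<phi> :: "'t \<Rightarrow> real^'k \<Rightarrow> real"
  assumes meas: "\<And>z. z \<in> borel_measurable M \<Longrightarrow> (\<lambda>t. \<phi> t (z t)) \<in> borel_measurable M"
    and td: "\<And>t. t \<in> space M \<Longrightarrow> twice_differentiable (\<phi> t)"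
    and z: "z \<in> borel_measurable M"
  shows "(\<lambda>t. hess (\<phi> t) (z t)) \<in> borel_measurable M"
proof -
  have der: "((\<lambda>z. grad (\<phi> t) z $ i) has_derivative (\<lambda>h. h \<bullet> (hess (\<phi> t) z $ i))) (at z)"
    if "t \<in> space M" for t z i
    using bounded_linear.has_derivative[OF bounded_linear_vec_nth has_derivative_hess[OF td[OF that]],
        of i z]
    by (simp add: matrix_vector_mult_def inner_vec_def mult.commute)
  have row: "(\<lambda>t. hess (\<phi> t) (z t) $ i) \<in> borel_measurable M" for i
  proof -
    have "(\<lambda>t. grad (\<lambda>z. grad (\<phi> t) z $ i) (z t)) \<in> borel_measurable M"
    proof (rule borel_measurable_grad)
      show "(\<lambda>t. grad (\<phi> t) (z t) $ i) \<in> borel_measurable M" if "z \<in> borel_measurable M" for z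
        using measurable_compose[OF borel_measurable_grad[OF meas has_derivative_grad[OF td] that]
            borel_measurable_vec_nth] .
      show "((\<lambda>z. grad (\<phi> t) z $ i) has_derivative (\<lambda>h. h \<bullet> grad (\<lambda>z. grad (\<phi> t) z $ i) z)) (at z)"
        if "t \<in> space M" for t z
        using der[OF that] grad_eqI[OF der[OF that]] by simp
    qed fact
    then show ?thesis
      by (rule measurable_cong[THEN iffD1, rotated]) (rule grad_eqI[OF der])
  qed
  have "(\<lambda>t. \<chi> i. hess (\<phi> t) (z t) $ i) \<in> borel_measurable M"
    by (rule borel_measurable_vec_lambda) (rule row)
  then show ?thesis by simp
qed

section \<open>Caratheodory differential equations\<close>

abbreviation MT :: "real \<Rightarrow> real measure" where "MT T \<equiv> lebesgue_on {0..T}"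

lemma finite_measure_lebesgue_on: "finite_measure (lebesgue_on {a..b::real})"
  by (rule finite_measureI) (auto simp: emeasure_restrict_space emeasure_lborel_Icc_eq)

lemma measure_lebesgue_on [simp]: "0 \<le> T \<Longrightarrow> measure (MT T) {0..T} = T"
  by (simp add: measure_restrict_space)

lemma integrable_const_MT [simp]: "integrable (MT T) (\<lambda>t. c :: 'a::euclidean_space)"
  by (intro finite_measure.integrable_const finite_measure_lebesgue_on)

lemma AE_MT_I: "(\<And>t. t \<in> {0..T} \<Longrightarrow> P t) \<Longrightarrow> AE t in MT T. P t"
  by (rule AE_I2) simp

lemma MT_nontrivial: "0 < T \<Longrightarrow> emeasure (MT T) (space (MT T)) \<noteq> 0"
  by (simp add: emeasure_restrict_space)

text \<open>An interval of positive length is not null, so a statement without \<open>t\<close> that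
  holds almost everywhere holds outright. This extracts signs of constants, such as 0 \<le> e, from
  almost-everywhere bounds.\<close>

lemma AE_MT_const: "0 < T \<Longrightarrow> (AE t in MT T. P) \<Longrightarrow> P"
  using MT_nontrivial[of T] ae_filter_eq_bot_iff[of "MT T"] trivial_limit_def[of "ae_filter (MT T)"]
  by (cases P) auto

lemma integrable_bounded_MT:
  fixes f :: "real \<Rightarrow> 'a::euclidean_space"
  assumes "f \<in> borel_measurable (MT T)" "AE t in MT T. norm (f t) \<le> C"
  shows "integrable (MT T) f"
  by (rule finite_measure.integrable_const_bound[OF finite_measure_lebesgue_on assms(2,1)])

text \<open>Completeness of Lebesgue measure; needed because controls are determined only up to null
  sets.\<close>

lemma borel_measurable_AE_MT:
  fixes f g :: "real \<Rightarrow> 'a::euclidean_space"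
  assumes "f \<in> borel_measurable (MT T)" "AE t in MT T. f t = g t"
  shows "g \<in> borel_measurable (MT T)"
proof -
  have "(\<lambda>x. indicator {0..T} x *\<^sub>R f x) \<in> borel_measurable lebesgue"
    using assms(1) by (simp add: borel_measurable_restrict_space_iff)
  moreover have "AE x in lebesgue. indicator {0..T} x *\<^sub>R f x = indicator {0..T} x *\<^sub>R g x"
    using assms(2) by (auto simp: AE_restrict_space_iff elim!: eventually_mono simp: indicator_def)
  ultimately have "(\<lambda>x. indicator {0..T} x *\<^sub>R g x) \<in> borel_measurable lebesgue"
    by (rule borel_measurable_AE)
  then show ?thesis by (simp add: borel_measurable_restrict_space_iff)
qed

lemma integrable_MT_sub: "integrable (MT T) f \<Longrightarrow> t \<le> T \<Longrightarrow> integrable (MT t) f"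
  for f :: "real \<Rightarrow> 'a::euclidean_space"
  by (rule integrable_subinterval) auto

lemma integral_MT_indicator:
  fixes f :: "real \<Rightarrow> 'a::euclidean_space"
  assumes "t \<in> {0..T}"
  shows "(LINT s|MT t. f s) = (LINT s|MT T. indicator {0..t} s *\<^sub>R f s)"
proof -
  have "(LINT s|MT t. f s) = (LINT s|lebesgue. indicator {0..t} s *\<^sub>R f s)"
    by (simp add: integral_restrict_space)
  also have "\<dots> = (LINT s|lebesgue. indicator {0..T} s *\<^sub>R indicator {0..t} s *\<^sub>R f s)"
    using assms by (intro Bochner_Integration.integral_cong) (auto simp: indicator_def)
  also have "\<dots> = (LINT s|MT T. indicator {0..t} s *\<^sub>R f s)"
    by (simp add: integral_restrict_space)
  finally show ?thesis .
qed

lemma integral_MT_combine: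
  fixes f :: "real \<Rightarrow> 'a::euclidean_space"
  assumes "integrable (MT T) f" "t \<in> {0..T}"
  shows "(LINT s|MT T. f s) = (LINT s|MT t. f s) + (LINT s|lebesgue_on {t..T}. f s)"
proof -
  have "integrable (MT t) f" "integrable (lebesgue_on {t..T}) f"
    using assms integrable_subinterval[OF assms(1)] by auto
  then have "has_bochner_integral (MT T) f ((LINT s|MT t. f s) + (LINT s|lebesgue_on {t..T}. f s))"
    using assms(2) by (intro has_bochner_integral_combine[of 0 t T]) (auto simp: has_bochner_integral_integrable)
  then show ?thesis by (rule has_bochner_integral_integral_eq)
qed

lemma AE_lebesgue_on_mono:
  assumes "AE x in lebesgue_on B. P x" "A \<subseteq> B" "A \<in> sets lebesgue" "B \<in> sets lebesgue"
  shows "AE x in lebesgue_on A. P x"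
  using assms by (auto simp: AE_restrict_space_iff elim!: eventually_mono)

lemma integral_mono_set_MT:
  fixes r :: "real \<Rightarrow> real"
  assumes "integrable (MT T) r" "AE s in MT T. 0 \<le> r s" "0 \<le> a" "b \<le> T"
  shows "(LINT s|lebesgue_on {a..b}. r s) \<le> (LINT s|MT T. r s)"
proof -
  have "integrable (lebesgue_on {a..b}) r"
    using assms by (intro integrable_subinterval[OF assms(1)]) auto
  then have "integrable lebesgue (\<lambda>s. indicator {a..b} s *\<^sub>R r s)"
    by (simp add: integrable_restrict_space)
  moreover have eq: "(\<lambda>s. indicator {a..b} s *\<^sub>R r s)
      = (\<lambda>s. indicator {0..T} s *\<^sub>R (indicator {a..b} s * r s))"
    using assms by (auto simp: indicator_def)
  ultimately have "integrable lebesgue (\<lambda>s. indicator {0..T} s *\<^sub>R (indicator {a..b} s * r s))"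
    by simp
  then have *: "integrable (MT T) (\<lambda>s. indicator {a..b} s * r s)"
    by (simp add: integrable_restrict_space)
  have "(LINT s|lebesgue_on {a..b}. r s) = (LINT s|lebesgue. indicator {a..b} s *\<^sub>R r s)"
    by (simp add: integral_restrict_space)
  also have "\<dots> = (LINT s|MT T. indicator {a..b} s * r s)"
    by (simp only: eq) (simp add: integral_restrict_space)
  also have "\<dots> \<le> (LINT s|MT T. r s)"
    using * assms(1,2) by (intro integral_mono_AE) (auto elim!: eventually_mono simp: indicator_def)
  finally show ?thesis .
qed

section \<open>Gronwall inequalities and a priori bounds\<close>

lemma gronwall_forward:
  fixes \<phi> :: "real \<Rightarrow> real"
  assumes cont: "continuous_on {0..T} \<phi>" and "0 \<le> L"
    and le: "\<And>t. t \<in> {0..T} \<Longrightarrow> \<phi> t \<le> c + L * integral {0..t} \<phi>"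
    and t: "t \<in> {0..T}"
  shows "\<phi> t \<le> c * exp (L * t)"
proof -
  \<comment> \<open>The integral majorant divided by its expected growth: by \<open>le\<close> its
    derivative is non-positive, so it stays below its initial value \<open>c\<close>.\<close>
  define h where "h t = (c + L * integral {0..t} \<phi>) * exp (- (L * t))" for t
  have "(h has_real_derivative (L * \<phi> s - L * (c + L * integral {0..s} \<phi>)) * exp (- (L * s)))
      (at s within {0..t})" if "s \<in> {0..t}" for s
    unfolding h_def
    by (auto intro!: derivative_eq_intros integral_has_real_derivative[OF continuous_on_subset[OF cont]]
        that simp: algebra_simps) (use that t in auto)
  then obtain s where s: "s \<in> {0..t}"
    "h t - h 0 = ((L * \<phi> s - L * (c + L * integral {0..s} \<phi>)) * exp (- (L * s))) * (t - 0)"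
    using mvt_very_simple[of 0 t h "\<lambda>s x. ((L * \<phi> s - L * (c + L * integral {0..s} \<phi>)) * exp (- (L * s))) * x"] t
    by (auto simp: has_field_derivative_def)
  have "L * \<phi> s - L * (c + L * integral {0..s} \<phi>) \<le> 0"
    using le[of s] s(1) t assms(2) by (simp add: mult_left_mono)
  then have "h t \<le> h 0"
    using s t by (smt (verit) atLeastAtMost_iff exp_ge_zero mult_nonneg_nonneg mult_nonpos_nonneg)
  then have "c + L * integral {0..t} \<phi> \<le> c * exp (L * t)"
    by (simp add: h_def exp_minus field_simps)
  then show ?thesis using le[OF t] by linarith
qed

lemma gronwall_backward:
  fixes \<phi> :: "real \<Rightarrow> real"
  assumes cont: "continuous_on {0..T} \<phi>" and "0 \<le> L"
    and le: "\<And>t. t \<in> {0..T} \<Longrightarrow> \<phi> t \<le> c + L * integral {t..T} \<phi>"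
    and t: "t \<in> {0..T}"
  shows "\<phi> t \<le> c * exp (L * (T - t))"
proof -
  \<comment> \<open>The integral over {t..T} is written as a difference of integrals starting at 0,
    so that the fundamental theorem applies at the upper limit.\<close>
  define h where "h t = (c + L * (integral {0..T} \<phi> - integral {0..t} \<phi>)) * exp (L * t)" for t
  have split: "integral {0..T} \<phi> - integral {0..s} \<phi> = integral {s..T} \<phi>" if "s \<in> {0..T}" for s
    using Henstock_Kurzweil_Integration.integral_combine[of 0 s T \<phi>] that
      integrable_continuous_real[OF cont] by simp
  have der: "(h has_real_derivative (- L * \<phi> s + L * (c + L * integral {s..T} \<phi>)) * exp (L * s))
      (at s within {t..T})" if "s \<in> {t..T}" for s
  proof -
    have s: "s \<in> {0..T}" using that t by auto
    have "(h has_real_derivative (- L * \<phi> s + L * (c + L * integral {s..T} \<phi>)) * exp (L * s))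
        (at s within {0..T})"
      unfolding h_def
      by (rule derivative_eq_intros integral_has_real_derivative[OF cont s] refl | simp)+
        (simp add: split[OF s] algebra_simps)
    then show ?thesis by (rule DERIV_subset) (use t in auto)
  qed
  obtain s where s: "s \<in> {t..T}"
    "h T - h t = ((- L * \<phi> s + L * (c + L * integral {s..T} \<phi>)) * exp (L * s)) * (T - t)"
    using mvt_very_simple[of t T h "\<lambda>s x. ((- L * \<phi> s + L * (c + L * integral {s..T} \<phi>)) * exp (L * s)) * x"]
      t der by (auto simp: has_field_derivative_def)
  have "0 \<le> - L * \<phi> s + L * (c + L * integral {s..T} \<phi>)"
    using mult_left_mono[OF le[of s] assms(2)] s(1) t by simp
  then have "h t \<le> h T"
    using s t by (smt (verit) atLeastAtMost_iff exp_ge_zero mult_nonneg_nonneg)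
  then have "(c + L * integral {t..T} \<phi>) * exp (L * t) \<le> c * exp (L * T)"
    using split[OF t] by (simp add: h_def)
  then have "c + L * integral {t..T} \<phi> \<le> c * exp (L * (T - t))"
    by (simp add: exp_diff right_diff_distrib field_simps)
  then show ?thesis using le[OF t] by linarith
qed

lemma ode_solution_integrable: "ode_solution T F x \<Longrightarrow> integrable (MT T) (\<lambda>t. F t (x t))"
  by (simp add: ode_solution_def)

lemma ode_solution_eq:
  "ode_solution T F x \<Longrightarrow> t \<in> {0..T} \<Longrightarrow> x t = x 0 + (LINT s|MT t. F s (x s))"
  unfolding ode_solution_def by blast

lemma ode_solution_continuous:
  assumes "ode_solution T F x" shows "continuous_on {0..T} x"
proof -
  have "continuous_on {0..T} (\<lambda>t. x 0 + (LINT s|MT t. F s (x s)))"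
    by (intro continuous_intros indefinite_integral_continuous_real ode_solution_integrable assms)
  then show ?thesis
    by (rule continuous_on_eq) (rule ode_solution_eq[OF assms, symmetric])
qed

lemma continuous_measurable_MT: "continuous_on {0..T} x \<Longrightarrow> x \<in> borel_measurable (MT T)"
  for x :: "real \<Rightarrow> 'a::euclidean_space"
  by (rule continuous_imp_measurable_on_sets_lebesgue) auto

lemma ode_solution_increment:
  assumes "ode_solution T F x" "0 \<le> s" "s \<le> t" "t \<le> T"
  shows "x t - x s = (LINT r|lebesgue_on {s..t}. F r (x r))"
proof -
  have "integrable (MT t) (\<lambda>r. F r (x r))"
    using assms ode_solution_integrable integrable_MT_sub by blast
  from integral_MT_combine[OF this, of s]
  have split: "(LINT r|MT t. F r (x r)) = (LINT r|MT s. F r (x r)) + (LINT r|lebesgue_on {s..t}. F r (x r))"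
    using assms by simp
  have "x s = x 0 + (LINT r|MT s. F r (x r))" "x t = x 0 + (LINT r|MT t. F r (x r))"
    using assms by (auto intro: ode_solution_eq)
  then show ?thesis unfolding split by (metis add_diff_cancel_left add.assoc add_diff_cancel_left')
qed

text \<open>The source of every factor exp (L * T). Growth is required only along the solution
  itself, so the right-hand side may ignore its second argument; differences of solutions of
  different equations are estimated in this way.\<close>

lemma
  assumes sol: "ode_solution T F x" and L: "0 \<le> L" and T: "0 \<le> T"
    and le: "AE s in MT T. norm (F s (x s)) \<le> L * norm (x s) + r s"
    and r: "integrable (MT T) r" "AE s in MT T. 0 \<le> r s"
    and t: "t \<in> {0..T}"
  shows ode_bound_forward: "norm (x t) \<le> exp (L * T) * (norm (x 0) + (LINT s|MT T. r s))"
    and ode_bound_backward: "norm (x t) \<le> exp (L * T) * (norm (x T) + (LINT s|MT T. r s))"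
proof -
  have cont: "continuous_on {0..T} (\<lambda>t. norm (x t))"
    by (intro continuous_intros ode_solution_continuous[OF sol])
  have incr: "norm (x b - x a) \<le> (LINT s|MT T. r s) + L * integral {a..b} (\<lambda>s. norm (x s))"
    if ab: "0 \<le> a" "a \<le> b" "b \<le> T" for a b
  proof -
    have i: "integrable (lebesgue_on {a..b}) (\<lambda>s. F s (x s))" "integrable (lebesgue_on {a..b}) r"
      using integrable_subinterval[OF ode_solution_integrable[OF sol]] integrable_subinterval[OF r(1)] that
      by simp_all
    have c: "continuous_on {a..b} (\<lambda>s. norm (x s))"
      using that by (intro continuous_on_subset[OF cont]) auto
    note ic = continuous_imp_integrable_real[OF c]
    have "norm (x b - x a) \<le> (LINT s|lebesgue_on {a..b}. norm (F s (x s)))"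
      unfolding ode_solution_increment[OF sol ab] by (rule integral_norm_bound)
    also have "\<dots> \<le> (LINT s|lebesgue_on {a..b}. L * norm (x s) + r s)"
      using i ic AE_lebesgue_on_mono[OF le, of "{a..b}"] that by (intro integral_mono_AE) auto
    also have "\<dots> = L * (LINT s|lebesgue_on {a..b}. norm (x s)) + (LINT s|lebesgue_on {a..b}. r s)"
      using i ic by simp
    also have "(LINT s|lebesgue_on {a..b}. norm (x s)) = integral {a..b} (\<lambda>s. norm (x s))"
      using ic by (intro lebesgue_integral_eq_integral) auto
    finally show ?thesis
      using integral_mono_set_MT[OF r, of a b] that by simp
  qed
  have r0: "0 \<le> (LINT s|MT T. r s)"
    using r by (intro integral_nonneg_AE)
  have "norm (x t) \<le> (norm (x 0) + (LINT s|MT T. r s)) * exp (L * t)"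
  proof (rule gronwall_forward[OF cont L _ t])
    fix t assume "t \<in> {0..T}"
    then show "norm (x t) \<le> norm (x 0) + (LINT s|MT T. r s) + L * integral {0..t} (\<lambda>s. norm (x s))"
      using incr[of 0 t] norm_triangle_sub[of "x t" "x 0"] by simp
  qed
  also have "\<dots> \<le> (norm (x 0) + (LINT s|MT T. r s)) * exp (L * T)"
    using t L r0 by (intro mult_left_mono) (auto intro: mult_left_mono)
  finally show "norm (x t) \<le> exp (L * T) * (norm (x 0) + (LINT s|MT T. r s))"
    by (simp add: mult.commute)
  have "norm (x t) \<le> (norm (x T) + (LINT s|MT T. r s)) * exp (L * (T - t))"
  proof (rule gronwall_backward[OF cont L _ t])
    fix t assume "t \<in> {0..T}"
    then show "norm (x t) \<le> norm (x T) + (LINT s|MT T. r s) + L * integral {t..T} (\<lambda>s. norm (x s))"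
      using incr[of t T] norm_triangle_sub[of "x t" "x T"] by (simp add: norm_minus_commute)
  qed
  also have "\<dots> \<le> (norm (x T) + (LINT s|MT T. r s)) * exp (L * T)"
    using t L r0 by (intro mult_left_mono) (auto intro: mult_left_mono)
  finally show "norm (x t) \<le> exp (L * T) * (norm (x T) + (LINT s|MT T. r s))"
    by (simp add: mult.commute)
qed

lemma ode_solution_combine:
  assumes x: "ode_solution T F x" and y: "ode_solution T G y"
    and H: "\<And>t. t \<in> {0..T} \<Longrightarrow> H t (x t + c *\<^sub>R y t) = F t (x t) + c *\<^sub>R G t (y t)"
  shows "ode_solution T H (\<lambda>t. x t + c *\<^sub>R y t)"
  unfolding ode_solution_def
proof (intro conjI ballI)
  have i: "integrable (MT T) (\<lambda>t. F t (x t))" "integrable (MT T) (\<lambda>t. G t (y t))"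
    using x y by (auto intro: ode_solution_integrable)
  then have "integrable (MT T) (\<lambda>t. F t (x t) + c *\<^sub>R G t (y t))" by simp
  then show "integrable (MT T) (\<lambda>t. H t (x t + c *\<^sub>R y t))"
    by (rule Bochner_Integration.integrable_cong[THEN iffD1, rotated 2]) (auto simp: H)
  fix t assume t: "t \<in> {0..T}"
  have "(LINT s|MT t. H s (x s + c *\<^sub>R y s)) = (LINT s|MT t. F s (x s) + c *\<^sub>R G s (y s))"
    using t by (intro Bochner_Integration.integral_cong) (auto simp: H)
  also have "\<dots> = (LINT s|MT t. F s (x s)) + c *\<^sub>R (LINT s|MT t. G s (y s))"
    using i t by (simp add: integrable_MT_sub[of T])
  finally show "x t + c *\<^sub>R y t = x 0 + c *\<^sub>R y 0 + (LINT s|MT t. H s (x s + c *\<^sub>R y s))"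
    using ode_solution_eq[OF x t] ode_solution_eq[OF y t] by (simp add: algebra_simps)
qed

lemma ode_solution_diff:
  assumes x: "ode_solution T F x" and y: "ode_solution T G y"
    and H: "\<And>t. t \<in> {0..T} \<Longrightarrow> H t (x t - y t) = F t (x t) - G t (y t)"
  shows "ode_solution T H (\<lambda>t. x t - y t)"
  using ode_solution_combine[OF x y, of H "-1"] H by simp

lemma ode_solution_cong:
  assumes "ode_solution T F x" "\<And>t. t \<in> {0..T} \<Longrightarrow> G t (x t) = F t (x t)"
    "\<And>t. t \<in> {0..T} \<Longrightarrow> y t = x t" "0 \<le> T"
  shows "ode_solution T G y"
proof -
  have "integrable (MT T) (\<lambda>t. G t (y t)) \<longleftrightarrow> integrable (MT T) (\<lambda>t. F t (x t))"
    using assms by (intro Bochner_Integration.integrable_cong) auto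
  moreover have "(LINT s|MT t. G s (y s)) = (LINT s|MT t. F s (x s))" if "t \<in> {0..T}" for t
    using assms that by (intro Bochner_Integration.integral_cong) auto
  moreover have "y t = x t" "y 0 = x 0" if "t \<in> {0..T}" for t
    using assms that by auto
  ultimately show ?thesis
    using assms(1) unfolding ode_solution_def by metis
qed

text \<open>The difference satisfies the growth bound with zero source, so agreement at either end
  forces it to vanish. This covers initial and terminal value problems alike.\<close>

lemma ode_solution_unique:
  assumes x: "ode_solution T F x" and y: "ode_solution T F y" and "0 \<le> L"
    and lip: "\<And>t. t \<in> {0..T} \<Longrightarrow> norm (F t (x t) - F t (y t)) \<le> L * norm (x t - y t)"
    and eq: "x 0 = y 0 \<or> x T = y T" and t: "t \<in> {0..T}"
  shows "x t = y t"
proof -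
  let ?H = "\<lambda>t (_::'a). F t (x t) - F t (y t)"
  have sol: "ode_solution T ?H (\<lambda>t. x t - y t)"
    by (rule ode_solution_diff[OF x y]) simp
  have le: "AE s in MT T. norm (F s (x s) - F s (y s)) \<le> L * norm (x s - y s) + 0"
    using lip by (intro AE_MT_I) simp
  from eq show ?thesis
  proof
    assume "x 0 = y 0"
    then show ?thesis
      using ode_bound_forward[OF sol assms(3) _ le _ _ t] t by simp
  next
    assume "x T = y T"
    then show ?thesis
      using ode_bound_backward[OF sol assms(3) _ le _ _ t] t by simp
  qed
qed

section \<open>Existence of solutions and linear boundary value problems\<close>

lemma integral_exp_MT:
  assumes "0 < K" "0 \<le> t"
  shows "(LINT s|MT t. exp (K * s)) = (exp (K * t) - 1) / K"
proof -
  have "((\<lambda>s. exp (K * s)) has_integral (exp (K * t) / K - exp (K * 0) / K)) {0..t}"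
    using assms
    by (intro fundamental_theorem_of_calculus)
       (auto intro!: derivative_eq_intros simp flip: has_real_derivative_iff_has_vector_derivative)
  moreover have "integrable (MT t) (\<lambda>s. exp (K * s))"
    by (intro continuous_imp_integrable_real continuous_intros)
  ultimately show ?thesis
    using lebesgue_integral_eq_integral[of "{0..t}" "\<lambda>s. exp (K * s)"] assms
    by (simp add: integral_unique diff_divide_distrib)
qed

lemma integrable_superposition:
  fixes F :: "real \<Rightarrow> 'a::euclidean_space \<Rightarrow> 'a"
  assumes meas: "\<And>x. x \<in> borel_measurable (MT T) \<Longrightarrow> (\<lambda>t. F t (x t)) \<in> borel_measurable (MT T)"
    and lip: "\<And>t x y. t \<in> {0..T} \<Longrightarrow> norm (F t x - F t y) \<le> L * norm (x - y)"
    and int: "integrable (MT T) (\<lambda>t. F t 0)"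
    and x: "continuous_on {0..T} x"
  shows "integrable (MT T) (\<lambda>t. F t (x t))"
proof (rule Bochner_Integration.integrable_bound)
  show "integrable (MT T) (\<lambda>t. L * norm (x t) + norm (F t 0))"
    using integrable_norm[OF int] continuous_imp_integrable_real[OF continuous_on_norm[OF x]]
    by (intro Bochner_Integration.integrable_add integrable_mult_right)
  show "(\<lambda>t. F t (x t)) \<in> borel_measurable (MT T)"
    using x by (intro meas continuous_measurable_MT)
  show "AE t in MT T. norm (F t (x t)) \<le> norm (L * norm (x t) + norm (F t 0))"
  proof (rule AE_MT_I)
    fix t assume "t \<in> {0..T}"
    then show "norm (F t (x t)) \<le> norm (L * norm (x t) + norm (F t 0))"
      using lip[of t "x t" 0] norm_triangle_sub[of "F t (x t)" "F t 0"] by simp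
  qed
qed

text \<open>Integrating exp (K s) gains a factor 1/K, so with the weight exp (- K t) the integral
  operator has Lipschitz constant L/K \<le> 1/2 on the whole interval at once.\<close>

lemma picard_contraction:
  fixes F :: "real \<Rightarrow> 'a::euclidean_space \<Rightarrow> 'a"
  assumes t: "t \<in> {0..T}" and L: "0 \<le> L"
    and lip: "\<And>t x y. t \<in> {0..T} \<Longrightarrow> norm (F t x - F t y) \<le> L * norm (x - y)"
    and i: "integrable (MT T) (\<lambda>s. F s (exp (K * s) *\<^sub>R z s))"
      "integrable (MT T) (\<lambda>s. F s (exp (K * s) *\<^sub>R w s))"
    and K: "0 < K" "2 * L \<le> K" and d: "\<And>s. norm (z s - w s) \<le> d" "0 \<le> d"
  shows "norm (exp (- (K * t)) *\<^sub>R ((LINT s|MT t. F s (exp (K * s) *\<^sub>R z s))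
      - (LINT s|MT t. F s (exp (K * s) *\<^sub>R w s)))) \<le> 1 / 2 * d"
proof -
  let ?D = "\<lambda>s. F s (exp (K * s) *\<^sub>R z s) - F s (exp (K * s) *\<^sub>R w s)"
  have i': "integrable (MT t) (\<lambda>s. F s (exp (K * s) *\<^sub>R z s))"
      "integrable (MT t) (\<lambda>s. F s (exp (K * s) *\<^sub>R w s))"
    using i t integrable_MT_sub by auto
  have "norm (LINT s|MT t. ?D s) \<le> (LINT s|MT t. norm (?D s))"
    by (rule integral_norm_bound)
  also have "\<dots> \<le> (LINT s|MT t. (L * d) * exp (K * s))"
  proof (rule integral_mono)
    show "integrable (MT t) (\<lambda>s. norm (?D s))"
      using i' by (intro integrable_norm Bochner_Integration.integrable_diff)
    show "integrable (MT t) (\<lambda>s. (L * d) * exp (K * s))"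
      by (intro continuous_imp_integrable_real continuous_intros)
    show "norm (?D s) \<le> (L * d) * exp (K * s)" if "s \<in> space (MT t)" for s
    proof -
      have "norm (?D s) \<le> L * norm (exp (K * s) *\<^sub>R z s - exp (K * s) *\<^sub>R w s)"
        using that t by (intro lip) auto
      also have "\<dots> = L * exp (K * s) * norm (z s - w s)"
        by (simp flip: scaleR_diff_right)
      also have "\<dots> \<le> L * exp (K * s) * d"
        using L d by (intro mult_left_mono) auto
      finally show ?thesis by (simp add: mult_ac)
    qed
  qed
  also have "\<dots> = L * d * ((exp (K * t) - 1) / K)"
    using K t by (simp add: integral_exp_MT)
  also have "\<dots> \<le> K / 2 * d * (exp (K * t) / K)"
    using K d t L by (intro mult_mono) (auto simp: divide_right_mono)
  finally have "norm (LINT s|MT t. ?D s) \<le> 1 / 2 * d * exp (K * t)"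
    using K by simp
  then have "exp (- (K * t)) * norm (LINT s|MT t. ?D s) \<le> exp (- (K * t)) * (1 / 2 * d * exp (K * t))"
    by (rule mult_left_mono) simp
  also have "\<dots> = 1 / 2 * d" by (simp add: exp_minus)
  finally show ?thesis using i' by simp
qed

text \<open>Banach's fixed point theorem in the weighted supremum norm of Bielecki.\<close>

lemma ode_solution_exists:
  fixes F :: "real \<Rightarrow> 'a::euclidean_space \<Rightarrow> 'a"
  assumes T: "0 < T" and L: "0 \<le> L"
    and meas: "\<And>x. x \<in> borel_measurable (MT T) \<Longrightarrow> (\<lambda>t. F t (x t)) \<in> borel_measurable (MT T)"
    and lip: "\<And>t x y. t \<in> {0..T} \<Longrightarrow> norm (F t x - F t y) \<le> L * norm (x - y)"
    and int: "integrable (MT T) (\<lambda>t. F t 0)"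
  obtains x where "ode_solution T F x" "x 0 = x0"
proof -
  define K where "K = 2 * L + 1"
  have K: "0 < K" "2 * L \<le> K" using L by (auto simp: K_def)
  \<comment> \<open>Clamping time to {0..T} makes the iterates bounded continuous functions on the
    whole line, as the complete space \<open>bcontfun\<close> requires.\<close>
  define c where "c t = max 0 (min T t)" for t
  have c: "c t \<in> {0..T}" and c_id: "t \<in> {0..T} \<Longrightarrow> c t = t" for t
    using T by (auto simp: c_def)
  have cont_c: "continuous_on UNIV c"
    unfolding c_def by (intro continuous_intros)
  define I where "I z t = (LINT s|MT t. F s (exp (K * s) *\<^sub>R z s))" for z :: "real \<Rightarrow> 'a" and t
  define \<Phi> where "\<Phi> z t = exp (- (K * c t)) *\<^sub>R (x0 + I z (c t))" for z t
  have int_z: "integrable (MT T) (\<lambda>s. F s (exp (K * s) *\<^sub>R z s))" if "continuous_on UNIV z" for z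
    by (rule integrable_superposition[OF meas lip int])
       (auto intro!: continuous_intros continuous_on_subset[OF that])
  have \<Phi>_bc: "\<Phi> z \<in> bcontfun" if z: "continuous_on UNIV z" for z
  proof -
    let ?G = "\<lambda>t. exp (- (K * t)) *\<^sub>R (x0 + I z t)"
    have cont: "continuous_on {0..T} ?G"
      unfolding I_def
      by (intro continuous_intros indefinite_integral_continuous_real int_z z)
    have "\<Phi> z = (\<lambda>t. ?G (c t))" by (rule ext) (simp add: \<Phi>_def)
    moreover have "continuous_on UNIV (\<lambda>t. ?G (c t))"
      by (rule continuous_on_compose2[OF cont cont_c]) (use c in blast)
    moreover have "bounded (range (\<lambda>t. ?G (c t)))"
      by (rule bounded_subset[OF compact_imp_bounded[OF compact_continuous_image[OF cont]]])
        (use c in auto)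
    ultimately show ?thesis by (simp add: bcontfun_def)
  qed
  define \<Psi> where "\<Psi> z = Bcontfun (\<Phi> (apply_bcontfun z))" for z
  have \<Psi>: "apply_bcontfun (\<Psi> z) = \<Phi> (apply_bcontfun z)" for z
    unfolding \<Psi>_def by (rule Bcontfun_inverse) (auto intro: \<Phi>_bc)
  have "dist (\<Psi> z) (\<Psi> w) \<le> 1 / 2 * dist z w" for z w
  proof (rule dist_bound)
    fix t
    have "dist (\<Psi> z t) (\<Psi> w t) = norm (exp (- (K * c t)) *\<^sub>R (I z (c t) - I w (c t)))"
      by (simp add: \<Psi> \<Phi>_def dist_norm flip: scaleR_diff_right)
    also have "\<dots> \<le> 1 / 2 * dist z w"
      unfolding I_def
      by (rule picard_contraction[OF c L lip int_z int_z K])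
        (auto simp: dist_norm[symmetric] dist_bounded)
    finally show "dist (\<Psi> z t) (\<Psi> w t) \<le> 1 / 2 * dist z w" .
  qed
  then have "\<exists>!z. \<Psi> z = z" by (intro banach_fix_type[of "1/2"]) auto
  then obtain z where z: "\<Psi> z = z" by blast
  let ?x = "\<lambda>t. exp (K * t) *\<^sub>R apply_bcontfun z t"
  have x: "?x t = x0 + I z t" if "t \<in> {0..T}" for t
  proof -
    have "apply_bcontfun z t = exp (- (K * t)) *\<^sub>R (x0 + I z t)"
    proof -
      have "apply_bcontfun z t = \<Phi> (apply_bcontfun z) t" using \<Psi>[of z] z by metis
      then show ?thesis unfolding \<Phi>_def c_id[OF that] .
    qed
    then show ?thesis by (simp add: exp_minus)
  qed
  have "integrable (MT 0) (\<lambda>s. F s (exp (K * s) *\<^sub>R apply_bcontfun z s))"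
    using T by (intro integrable_MT_sub[OF int_z]) auto
  from lebesgue_integral_eq_integral[OF this] have "I z 0 = 0"
    by (simp add: I_def)
  then have x_0: "?x 0 = x0" using x[of 0] T by simp
  have "ode_solution T F ?x"
    unfolding ode_solution_def x_0
    using int_z[of z] x by (auto simp: I_def)
  then show ?thesis using that x_0 by blast
qed

text \<open>Shooting. By superposition the terminal condition is a linear equation for the parameter
  \<open>\<xi>\<close>, with the map \<open>N\<close> that sends \<open>\<xi>\<close> to
  \<open>l\<close> of the homogeneous solution at T. \<open>N\<close> is an endomorphism of a
  finite-dimensional space, so its injectivity, which is hypothesis \<open>inj\<close>, gives
  solvability.\<close>

lemma linear_boundary_value_problem:
  fixes A :: "real \<Rightarrow> 'a::euclidean_space \<Rightarrow> 'a" and \<iota> :: "'b::euclidean_space \<Rightarrow> 'a" and l :: "'a \<Rightarrow> 'b"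
  assumes T: "0 < T" and L: "0 \<le> L"
    and lin: "\<And>t. t \<in> {0..T} \<Longrightarrow> linear (A t)"
    and bound: "\<And>t x. t \<in> {0..T} \<Longrightarrow> norm (A t x) \<le> L * norm x"
    and meas: "\<And>x. x \<in> borel_measurable (MT T) \<Longrightarrow> (\<lambda>t. A t (x t)) \<in> borel_measurable (MT T)"
    and c: "integrable (MT T) c"
    and lins: "linear \<iota>" "linear l"
    and inj: "\<And>z \<xi>. ode_solution T A z \<Longrightarrow> z 0 = \<iota> \<xi> \<Longrightarrow> l (z T) = 0 \<Longrightarrow> \<xi> = 0"
  obtains z \<xi> where "ode_solution T (\<lambda>t x. A t x + c t) z" "z 0 = \<iota> \<xi>" "l (z T) = d"
proof -
  have A0: "t \<in> {0..T} \<Longrightarrow> A t 0 = 0" for t using lin linear_0 by blast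
  have Adiff: "t \<in> {0..T} \<Longrightarrow> norm (A t x - A t y) \<le> L * norm (x - y)" for t x y
    using bound[of t "x - y"] lin linear_diff by metis
  have iA0: "integrable (MT T) (\<lambda>t. A t 0 + e t)" if "integrable (MT T) e" for e
    using that by (rule Bochner_Integration.integrable_cong[THEN iffD1, rotated 2]) (auto simp: A0)
  have "\<exists>z. ode_solution T A z \<and> z 0 = \<iota> \<xi>" for \<xi>
    using ode_solution_exists[OF T L meas Adiff, of "\<iota> \<xi>"] iA0[of "\<lambda>_. 0"] by auto
  then obtain h where h: "\<And>\<xi>. ode_solution T A (h \<xi>)" "\<And>\<xi>. h \<xi> 0 = \<iota> \<xi>" by metis
  obtain z0 where z0: "ode_solution T (\<lambda>t x. A t x + c t) z0" "z0 0 = 0"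
  proof (rule ode_solution_exists[OF T L, of "\<lambda>t x. A t x + c t" 0])
    show "(\<lambda>t. A t (x t) + c t) \<in> borel_measurable (MT T)" if "x \<in> borel_measurable (MT T)" for x
      using meas[OF that] borel_measurable_integrable[OF c] by simp
  qed (use Adiff iA0 c in auto)
  have lin_h: "h (\<xi> + r *\<^sub>R \<eta>) T = h \<xi> T + r *\<^sub>R h \<eta> T" for \<xi> \<eta> r
  proof (rule ode_solution_unique[OF h(1) _ L Adiff])
    show "ode_solution T A (\<lambda>t. h \<xi> t + r *\<^sub>R h \<eta> t)"
      by (rule ode_solution_combine[OF h(1) h(1)])
        (simp add: linear_add[OF lin] linear_scale[OF lin])
    show "h (\<xi> + r *\<^sub>R \<eta>) 0 = h \<xi> 0 + r *\<^sub>R h \<eta> 0 \<or> h (\<xi> + r *\<^sub>R \<eta>) T = h \<xi> T + r *\<^sub>R h \<eta> T"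
      by (simp add: h linear_add[OF lins(1)] linear_scale[OF lins(1)])
  qed (use T in auto)
  define N where "N \<xi> = l (h \<xi> T)" for \<xi>
  have h0: "h 0 T = 0" using lin_h[of 0 "-1" 0] by simp
  have "linear N"
  proof (rule linearI)
    show "N (\<xi> + \<eta>) = N \<xi> + N \<eta>" for \<xi> \<eta>
      using lin_h[of \<xi> 1 \<eta>] by (simp add: N_def linear_add[OF lins(2)])
    show "N (r *\<^sub>R \<eta>) = r *\<^sub>R N \<eta>" for r \<eta>
      using lin_h[of 0 r \<eta>] by (simp add: N_def h0 linear_scale[OF lins(2)])
  qed
  moreover have "inj N"
    using \<open>linear N\<close> inj[OF h(1) h(2)] by (auto simp: linear_injective_0 N_def)
  ultimately have "surj N" by (rule linear_injective_imp_surjective) simp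
  then obtain \<xi> where \<xi>: "N \<xi> = d - l (z0 T)" by (metis surj_def)
  show ?thesis
  proof (rule that)
    show "ode_solution T (\<lambda>t x. A t x + c t) (\<lambda>t. z0 t + 1 *\<^sub>R h \<xi> t)"
      by (rule ode_solution_combine[OF z0(1) h(1)]) (simp add: linear_add[OF lin])
    show "z0 0 + 1 *\<^sub>R h \<xi> 0 = \<iota> \<xi>" by (simp add: z0 h)
    show "l (z0 T + 1 *\<^sub>R h \<xi> T) = d"
      using \<xi> by (simp add: N_def linear_add[OF lins(2)])
  qed
qed

lemma integral_by_parts_MT:
  fixes f g :: "real \<Rightarrow> 'a::euclidean_space"
  assumes f: "integrable (MT T) f" and g: "integrable (MT T) g"
  shows "(LINT s|MT T. f s) \<bullet> (LINT s|MT T. g s)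
    = (LINT s|MT T. f s \<bullet> (LINT r|MT s. g r)) + (LINT s|MT T. (LINT r|MT s. f r) \<bullet> g s)"
proof -
  interpret M: finite_measure "MT T" by (rule finite_measure_lebesgue_on)
  interpret P: pair_sigma_finite "MT T" "MT T" ..
  note [measurable] = borel_measurable_integrable[OF f] borel_measurable_integrable[OF g]
  have meas_le [measurable]: "(\<lambda>r. if r \<le> s then 1 else 0 :: real) \<in> borel_measurable (MT T)" for s :: real
  proof -
    have "(\<lambda>r. if r \<le> s then 1 else 0 :: real) \<in> borel_measurable borel" by measurable
    from measurable_compose[OF continuous_measurable_MT[OF continuous_on_id] this] show ?thesis
      by simp
  qed
  let ?p = "\<lambda>s r. f s \<bullet> g r"
  let ?lo = "\<lambda>s r. (if r \<le> s then 1 else 0) * (f s \<bullet> g r)"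
  let ?up = "\<lambda>s r. (if s \<le> r then 1 else 0) * (f s \<bullet> g r)"
  have id: "(\<lambda>x. x) \<in> borel_measurable (MT T)"
    by (rule continuous_measurable_MT) (intro continuous_intros)
  have [measurable]: "(\<lambda>z. fst z) \<in> borel_measurable (MT T \<Otimes>\<^sub>M MT T)"
    "(\<lambda>z. snd z) \<in> borel_measurable (MT T \<Otimes>\<^sub>M MT T)"
    using measurable_compose[OF measurable_fst id] measurable_compose[OF measurable_snd id] by auto
  have [measurable]: "(\<lambda>z. if snd z \<le> fst z then 1 else 0 :: real) \<in> borel_measurable (MT T \<Otimes>\<^sub>M MT T)"
    "(\<lambda>z. if fst z \<le> snd z then 1 else 0 :: real) \<in> borel_measurable (MT T \<Otimes>\<^sub>M MT T)"
    by measurable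
  have nrm: "integrable (MT T \<Otimes>\<^sub>M MT T) (\<lambda>z. norm (f (fst z)) * norm (g (snd z)))"
  proof (rule P.Fubini_integrable)
    show "integrable (MT T) (\<lambda>x. LINT y|MT T. norm (norm (f (fst (x, y))) * norm (g (snd (x, y)))))"
      using integrable_norm[OF f] by (simp add: norm_mult)
    show "AE x in MT T. integrable (MT T) (\<lambda>y. norm (f (fst (x, y))) * norm (g (snd (x, y))))"
      using integrable_norm[OF g] by simp
  qed measurable
  have p: "integrable (MT T \<Otimes>\<^sub>M MT T) (case_prod ?p)"
    by (rule Bochner_Integration.integrable_bound[OF nrm])
      (auto simp: case_prod_beta abs_mult intro: Cauchy_Schwarz_ineq2)
  have lo: "integrable (MT T \<Otimes>\<^sub>M MT T) (case_prod ?lo)"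
    by (rule Bochner_Integration.integrable_bound[OF p])
      (auto simp: case_prod_beta indicator_def)
  have up: "integrable (MT T \<Otimes>\<^sub>M MT T) (case_prod ?up)"
    by (rule Bochner_Integration.integrable_bound[OF p])
      (auto simp: case_prod_beta indicator_def)
  have ind: "(LINT r|MT T. (if r \<le> s then 1 else 0) *\<^sub>R h r) = (LINT r|MT s. h r)"
    if "s \<in> {0..T}" for s and h :: "real \<Rightarrow> 'a"
    unfolding integral_MT_indicator[OF that]
    by (rule Bochner_Integration.integral_cong) (auto simp: indicator_def)
  have 1: "(LINT r|MT T. ?lo s r) = f s \<bullet> (LINT r|MT s. g r)" if s: "s \<in> {0..T}" for s
  proof -
    have *: "integrable (MT T) (\<lambda>r. (if r \<le> s then 1 else 0) *\<^sub>R g r)"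
      by (rule Bochner_Integration.integrable_bound[OF g]) (auto simp: indicator_def)
    from integral_inner_right[OF this, of "f s"] show ?thesis
      by (simp add: ind[OF s])
  qed
  have 2: "(LINT s|MT T. ?up s r) = (LINT s|MT r. f s) \<bullet> g r" if r: "r \<in> {0..T}" for r
  proof -
    have *: "integrable (MT T) (\<lambda>s. (if s \<le> r then 1 else 0) *\<^sub>R f s)"
      by (rule Bochner_Integration.integrable_bound[OF f]) (auto simp: indicator_def)
    from integral_inner_left[OF this, of "g r"] show ?thesis
      by (simp add: ind[OF r])
  qed
  have "(LINT s|MT T. f s) \<bullet> (LINT s|MT T. g s) = (LINT s|MT T. LINT r|MT T. ?p s r)"
    using f g by simp
  \<comment> \<open>The square is cut along the diagonal so that Fubini can swap the order on one
    triangle. Both triangles contain the diagonal, but its sections are single points and hence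
    null.\<close>
  also have "\<dots> = (LINT s|MT T. LINT r|MT T. ?lo s r + ?up s r)"
  proof (rule Bochner_Integration.integral_cong[OF refl], rule integral_cong_AE)
    fix s :: real
    have "AE r in lebesgue. r \<noteq> s"
      by (rule AE_I'[of "{s}"]) auto
    then have "AE r in MT T. r \<noteq> s"
      by (auto simp: AE_restrict_space_iff)
    then show "AE r in MT T. ?p s r = ?lo s r + ?up s r"
      by eventually_elim (auto simp: indicator_def)
    have g: "g \<in> borel_measurable (MT T)" by measurable
    have c: "(\<lambda>r. f s \<bullet> g r) \<in> borel_measurable (MT T)"
      by (rule borel_measurable_inner[OF borel_measurable_const g])
    have "(\<lambda>r. if s \<le> r then 1 else 0 :: real) \<in> borel_measurable borel" by measurable
    from measurable_compose[OF continuous_measurable_MT[OF continuous_on_id] this]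
    have ge: "(\<lambda>r. if s \<le> r then 1 else 0 :: real) \<in> borel_measurable (MT T)" by simp
    show "?p s \<in> borel_measurable (MT T)" by (rule c)
    show "(\<lambda>r. ?lo s r + ?up s r) \<in> borel_measurable (MT T)"
      by (intro borel_measurable_add borel_measurable_times meas_le ge c)
  qed
  also have "\<dots> = (LINT s|MT T. (LINT r|MT T. ?lo s r) + (LINT r|MT T. ?up s r))"
    using P.AE_integrable_fst'[OF lo] P.AE_integrable_fst'[OF up]
    by (intro integral_cong_AE) auto
  also have "\<dots> = (LINT s|MT T. LINT r|MT T. ?lo s r) + (LINT s|MT T. LINT r|MT T. ?up s r)"
    using P.integrable_fst'[OF lo] P.integrable_fst'[OF up] by simp
  also have "(LINT s|MT T. LINT r|MT T. ?up s r) = (LINT r|MT T. LINT s|MT T. ?up s r)"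
    using P.Fubini_integral[OF up] by simp
  also have "\<dots> = (LINT r|MT T. (LINT s|MT r. f s) \<bullet> g r)"
    by (rule Bochner_Integration.integral_cong) (use 2 in auto)
  also have "(LINT s|MT T. LINT r|MT T. ?lo s r) = (LINT s|MT T. f s \<bullet> (LINT r|MT s. g r))"
    by (rule Bochner_Integration.integral_cong) (use 1 in auto)
  finally show ?thesis .
qed

text \<open>The product rule for solutions that are merely absolutely continuous. Applied to a state
  and an adjoint it expresses first and second variations as integrals against the control.\<close>

lemma ode_solution_by_parts:
  assumes x: "ode_solution T F x" and p: "ode_solution T G p" and "0 \<le> T"
  shows "integrable (MT T) (\<lambda>s. F s (x s) \<bullet> p s + x s \<bullet> G s (p s))"
    and "x T \<bullet> p T - x 0 \<bullet> p 0 = (LINT s|MT T. F s (x s) \<bullet> p s + x s \<bullet> G s (p s))"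
proof -
  note i = ode_solution_integrable[OF x] ode_solution_integrable[OF p]
  have prod: "integrable (MT T) (\<lambda>s. h s \<bullet> y s)"
    if h: "integrable (MT T) h" and y: "continuous_on {0..T} y" for h y :: "real \<Rightarrow> 'a"
  proof -
    obtain B where B: "\<And>s. s \<in> {0..T} \<Longrightarrow> norm (y s) \<le> B"
      using compact_imp_bounded[OF compact_continuous_image[OF y]] unfolding bounded_iff by blast
    show ?thesis
    proof (rule Bochner_Integration.integrable_bound)
      show "integrable (MT T) (\<lambda>s. B * norm (h s))" using h by simp
      show "(\<lambda>s. h s \<bullet> y s) \<in> borel_measurable (MT T)"
        using borel_measurable_integrable[OF h] continuous_measurable_MT[OF y] by measurable
      show "AE s in MT T. norm (h s \<bullet> y s) \<le> norm (B * norm (h s))"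
      proof (rule AE_MT_I)
        fix s assume "s \<in> {0..T}"
        then have "\<bar>h s \<bullet> y s\<bar> \<le> norm (h s) * B"
          by (intro order_trans[OF Cauchy_Schwarz_ineq2] mult_left_mono B) auto
        then show "norm (h s \<bullet> y s) \<le> norm (B * norm (h s))" by (simp add: mult.commute)
      qed
    qed
  qed
  have Fp: "integrable (MT T) (\<lambda>s. F s (x s) \<bullet> p s)"
    by (rule prod[OF i(1) ode_solution_continuous[OF p]])
  have xG: "integrable (MT T) (\<lambda>s. x s \<bullet> G s (p s))"
    using prod[OF i(2) ode_solution_continuous[OF x]] by (simp add: inner_commute)
  show "integrable (MT T) (\<lambda>s. F s (x s) \<bullet> p s + x s \<bullet> G s (p s))"
    using Fp xG by simp
  let ?f = "\<lambda>s. F s (x s)" and ?g = "\<lambda>s. G s (p s)"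
  have xs: "(LINT r|MT s. ?f r) = x s - x 0" "(LINT r|MT s. ?g r) = p s - p 0" if "s \<in> {0..T}" for s
    using ode_solution_eq[OF x that] ode_solution_eq[OF p that] by (simp_all add: algebra_simps)
  have "(x T - x 0) \<bullet> (p T - p 0) = (LINT s|MT T. ?f s \<bullet> (LINT r|MT s. ?g r))
      + (LINT s|MT T. (LINT r|MT s. ?f r) \<bullet> ?g s)"
    using integral_by_parts_MT[OF i] xs[of T] assms(3) by simp
  also have "(LINT s|MT T. ?f s \<bullet> (LINT r|MT s. ?g r)) = (LINT s|MT T. ?f s \<bullet> p s - ?f s \<bullet> p 0)"
    by (rule Bochner_Integration.integral_cong) (auto simp: xs inner_diff_right)
  also have "\<dots> = (LINT s|MT T. ?f s \<bullet> p s) - (x T - x 0) \<bullet> p 0"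
    using Fp i xs[of T] assms(3) by simp
  also have "(LINT s|MT T. (LINT r|MT s. ?f r) \<bullet> ?g s) = (LINT s|MT T. x s \<bullet> ?g s - x 0 \<bullet> ?g s)"
    by (rule Bochner_Integration.integral_cong) (auto simp: xs inner_diff_left)
  also have "\<dots> = (LINT s|MT T. x s \<bullet> ?g s) - x 0 \<bullet> (p T - p 0)"
    using xG i xs[of T] assms(3) by simp
  finally show "x T \<bullet> p T - x 0 \<bullet> p 0 = (LINT s|MT T. F s (x s) \<bullet> p s + x s \<bullet> G s (p s))"
    using Fp xG by (simp add: inner_diff_left inner_diff_right algebra_simps)
qed

lemma ode_solution_bounded_linear:
  assumes z: "ode_solution T F z" and h: "bounded_linear h"
    and H: "\<And>t. t \<in> {0..T} \<Longrightarrow> H t (h (z t)) = h (F t (z t))"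
  shows "ode_solution T H (\<lambda>t. h (z t))"
  unfolding ode_solution_def
proof (intro conjI ballI)
  note i = ode_solution_integrable[OF z]
  show "integrable (MT T) (\<lambda>t. H t (h (z t)))"
    using integrable_bounded_linear[OF h i]
    by (rule Bochner_Integration.integrable_cong[THEN iffD1, rotated 2]) (auto simp: H)
  fix t assume t: "t \<in> {0..T}"
  have "(LINT s|MT t. H s (h (z s))) = (LINT s|MT t. h (F s (z s)))"
    using t by (intro Bochner_Integration.integral_cong) (auto simp: H)
  also have "\<dots> = h (LINT s|MT t. F s (z s))"
    using t by (intro integral_bounded_linear[OF h] integrable_MT_sub[OF i]) auto
  finally show "h (z t) = h (z 0) + (LINT s|MT t. H s (h (z s)))"
    using ode_solution_eq[OF z t] bounded_linear.linear[OF h] by (simp add: linear_add)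
qed

declare transpose_matrix_vector [simp del]

section \<open>Lebesgue spaces\<close>

lemma L2_measurable: "v \<in> L2 T \<Longrightarrow> v \<in> borel_measurable (MT T)"
  and L2_square_integrable: "v \<in> L2 T \<Longrightarrow> integrable (MT T) (\<lambda>t. (norm (v t))\<^sup>2)"
  by (simp_all add: L2_def)

lemma norm_L2_sq: "(norm_L2 T v)\<^sup>2 = (LINT t|MT T. (norm (v t))\<^sup>2)"
  by (simp add: norm_L2_def)

lemma L2_norm_mult_integrable:
  assumes "v \<in> L2 T" "w \<in> L2 T"
  shows "integrable (MT T) (\<lambda>t. norm (v t) * norm (w t))"
proof (rule Bochner_Integration.integrable_bound)
  note [measurable] = assms[THEN L2_measurable]
  show "integrable (MT T) (\<lambda>t. (norm (v t))\<^sup>2 + (norm (w t))\<^sup>2)"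
    using assms by (simp add: L2_square_integrable)
  show "(\<lambda>t. norm (v t) * norm (w t)) \<in> borel_measurable (MT T)" by measurable
  show "AE t in MT T. norm (norm (v t) * norm (w t)) \<le> norm ((norm (v t))\<^sup>2 + (norm (w t))\<^sup>2)"
  proof (rule AE_I2)
    fix t
    show "norm (norm (v t) * norm (w t)) \<le> norm ((norm (v t))\<^sup>2 + (norm (w t))\<^sup>2)"
      using sum_squares_bound[of "norm (v t)" "norm (w t)"]
      by (simp add: mult.assoc del: mult_nonneg_nonneg) (smt (verit) mult_nonneg_nonneg norm_ge_zero)
  qed
qed

lemma L2_inner_integrable:
  assumes "v \<in> L2 T" "w \<in> L2 T"
  shows "integrable (MT T) (\<lambda>t. v t \<bullet> w t)"
proof (rule Bochner_Integration.integrable_bound[OF L2_norm_mult_integrable[OF assms]])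
  note [measurable] = assms[THEN L2_measurable]
  show "(\<lambda>t. v t \<bullet> w t) \<in> borel_measurable (MT T)" by measurable
qed (simp add: Cauchy_Schwarz_ineq2)

lemma L2_I_bound:
  assumes "v \<in> borel_measurable (MT T)" "w \<in> L2 T" "AE t in MT T. norm (v t) \<le> C * norm (w t)"
  shows "v \<in> L2 T"
  unfolding L2_def
proof (safe intro!: assms(1))
  show "integrable (MT T) (\<lambda>t. (norm (v t))\<^sup>2)"
  proof (rule Bochner_Integration.integrable_bound)
    show "integrable (MT T) (\<lambda>t. C\<^sup>2 * (norm (w t))\<^sup>2)"
      using assms by (simp add: L2_square_integrable)
    show "AE t in MT T. norm ((norm (v t))\<^sup>2) \<le> norm (C\<^sup>2 * (norm (w t))\<^sup>2)"
      using assms(3) by eventually_elim (simp add: power_mono flip: power_mult_distrib)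
    show "(\<lambda>t. (norm (v t))\<^sup>2) \<in> borel_measurable (MT T)" using assms(1) by measurable
  qed
qed

lemma L2_bounded:
  assumes "v \<in> borel_measurable (MT T)" "AE t in MT T. norm (v t) \<le> C"
  shows "v \<in> L2 T"
proof (rule L2_I_bound[OF assms(1), of "\<lambda>_. 1 :: real" C])
  show "(\<lambda>_. 1 :: real) \<in> L2 T" by (simp add: L2_def)
qed (use assms(2) in simp)

lemma L2_add: 
  assumes "v \<in> L2 T" "w \<in> L2 T" shows "(\<lambda>t. v t + w t) \<in> L2 T"
  unfolding L2_def
proof safe
  note [measurable] = assms[THEN L2_measurable]
  show "(\<lambda>t. v t + w t) \<in> borel_measurable (MT T)" by measurable
  have "integrable (MT T) (\<lambda>t. (norm (v t))\<^sup>2 + 2 * (v t \<bullet> w t) + (norm (w t))\<^sup>2)"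
    using assms by (simp add: L2_square_integrable L2_inner_integrable)
  then show "integrable (MT T) (\<lambda>t. (norm (v t + w t))\<^sup>2)"
    by (simp add: power2_norm_eq_inner inner_add_left inner_add_right inner_commute algebra_simps)
qed

lemma L2_scale: "v \<in> L2 T \<Longrightarrow> (\<lambda>t. c *\<^sub>R v t) \<in> L2 T"
  by (rule L2_I_bound[of _ _ v "\<bar>c\<bar>"]) (auto dest: L2_measurable)

lemma L2_diff: "v \<in> L2 T \<Longrightarrow> w \<in> L2 T \<Longrightarrow> (\<lambda>t. v t - w t) \<in> L2 T"
  using L2_add[OF _ L2_scale[of w T "-1"], of v] by simp

lemma L2_norm_integrable: "v \<in> L2 T \<Longrightarrow> integrable (MT T) (\<lambda>t. norm (v t))"
  using L2_norm_mult_integrable[of v T "\<lambda>_. 1 :: real"] by (simp add: L2_def)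

lemma L2_integrable: "v \<in> L2 T \<Longrightarrow> integrable (MT T) v"
  by (rule integrable_norm_cancel) (auto intro: L2_norm_integrable L2_measurable)

lemma L2_continuous: "continuous_on {0..T} y \<Longrightarrow> y \<in> L2 T"
proof -
  assume y: "continuous_on {0..T} y"
  obtain B where B: "\<And>s. s \<in> {0..T} \<Longrightarrow> norm (y s) \<le> B"
    using compact_imp_bounded[OF compact_continuous_image[OF y]] unfolding bounded_iff by blast
  show ?thesis
    by (rule L2_bounded[OF continuous_measurable_MT[OF y] AE_MT_I]) (rule B)
qed

lemma norm_L1_nonneg [simp]: "0 \<le> norm_L1 T v"
  by (simp add: norm_L1_def)

text \<open>Cauchy-Schwarz against the constant 1, read off from the nonnegative variance of |v|
  about its mean \<open>?a\<close>.\<close>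

lemma norm_L1_sq_le:
  assumes "v \<in> L2 T" "0 < T"
  shows "(norm_L1 T v)\<^sup>2 \<le> T * (norm_L2 T v)\<^sup>2"
proof -
  let ?a = "norm_L1 T v / T"
  note i = L2_square_integrable[OF assms(1)] L2_norm_integrable[OF assms(1)]
  have "0 \<le> (LINT t|MT T. (norm (v t) - ?a)\<^sup>2)" by (rule integral_nonneg_AE) simp
  also have "\<dots> = (LINT t|MT T. (norm (v t))\<^sup>2 - 2 * ?a * norm (v t) + ?a\<^sup>2)"
    by (simp add: power2_diff algebra_simps)
  also have "\<dots> = (norm_L2 T v)\<^sup>2 - 2 * ?a * norm_L1 T v + T * ?a\<^sup>2"
    using i assms by (simp add: norm_L2_sq norm_L1_def)
  also have "\<dots> = (norm_L2 T v)\<^sup>2 - (norm_L1 T v)\<^sup>2 / T"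
    using assms(2) by (simp add: power2_eq_square field_simps)
  finally show ?thesis using assms(2) by (simp add: field_simps)
qed

lemma norm_L1_le:
  assumes "AE t in MT T. norm (v t) \<le> C" "v \<in> borel_measurable (MT T)" "0 \<le> T"
  shows "norm_L1 T v \<le> T * C"
proof -
  have "integrable (MT T) v" by (rule integrable_bounded_MT[OF assms(2,1)])
  then have "norm_L1 T v \<le> (LINT t|MT T. C)"
    unfolding norm_L1_def using assms(1) by (intro integral_mono_AE) auto
  then show ?thesis using assms(3) by simp
qed

lemma norm_L1_triangle:
  assumes "v \<in> L2 T" "w \<in> L2 T"
  shows "norm_L1 T (\<lambda>t. v t + w t) \<le> norm_L1 T v + norm_L1 T w"
proof -
  have "norm_L1 T (\<lambda>t. v t + w t) \<le> (LINT t|MT T. norm (v t) + norm (w t))"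
    unfolding norm_L1_def using assms L2_add[OF assms]
    by (intro integral_mono) (auto simp: L2_norm_integrable norm_triangle_ineq)
  then show ?thesis using assms by (simp add: norm_L1_def L2_norm_integrable)
qed

text \<open>Positive length of the interval rules out the value -\<infinity> of the essential
  supremum, so \<open>real_of_ereal\<close> in \<open>norm_Linf\<close> loses nothing.\<close>

lemma Linf_AE: 
  assumes "v \<in> Linf T" "0 < T"
  shows "AE t in MT T. norm (v t) \<le> norm_Linf T v" and "0 \<le> norm_Linf T v"
proof -
  let ?e = "esssup (MT T) (\<lambda>t. ereal (norm (v t)))"
  have [measurable]: "v \<in> borel_measurable (MT T)" and fin: "?e < \<infinity>"
    using assms by (auto simp: Linf_def)
  have ae: "AE t in MT T. ereal (norm (v t)) \<le> ?e" by (rule esssup_AE)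
  have "0 \<le> ?e"
    by (rule AE_MT_const[OF assms(2)])
      (use ae in \<open>eventually_elim, metis ereal_less_eq(5) norm_ge_zero order_trans\<close>)
  with fin have e: "?e = ereal (norm_Linf T v)" "0 \<le> norm_Linf T v"
    unfolding norm_Linf_def by (cases ?e; simp)+
  then show "0 \<le> norm_Linf T v" by simp
  show "AE t in MT T. norm (v t) \<le> norm_Linf T v"
    using ae unfolding e by simp
qed

lemma Linf_I:
  assumes "v \<in> borel_measurable (MT T)" "AE t in MT T. norm (v t) \<le> C" "0 < T"
  shows "v \<in> Linf T" and "norm_Linf T v \<le> C"
proof -
  note [measurable] = assms(1)
  let ?e = "esssup (MT T) (\<lambda>t. ereal (norm (v t)))"
  have le: "?e \<le> ereal C"
    by (rule esssup_I) (use assms(2) in auto)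
  also have "\<dots> < \<infinity>" by simp
  finally show v: "v \<in> Linf T" using assms(1) by (simp add: Linf_def)
  have ae: "AE t in MT T. ereal (norm (v t)) \<le> ?e" by (rule esssup_AE)
  have "0 \<le> ?e"
    by (rule AE_MT_const[OF assms(3)])
      (use ae in \<open>eventually_elim, metis ereal_less_eq(5) norm_ge_zero order_trans\<close>)
  with le show "norm_Linf T v \<le> C"
    unfolding norm_Linf_def by (cases ?e) auto
qed

lemma Linf_measurable: "v \<in> Linf T \<Longrightarrow> v \<in> borel_measurable (MT T)"
  by (simp add: Linf_def)

lemma Linf_L2: "v \<in> Linf T \<Longrightarrow> 0 < T \<Longrightarrow> v \<in> L2 T"
  by (rule L2_bounded[OF Linf_measurable Linf_AE(1)])

lemma Linf_add:
  assumes "v \<in> Linf T" "w \<in> Linf T" "0 < T"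
  shows "(\<lambda>t. v t + c *\<^sub>R w t) \<in> Linf T"
proof (rule Linf_I(1))
  note [measurable] = assms(1,2)[THEN Linf_measurable]
  show "(\<lambda>t. v t + c *\<^sub>R w t) \<in> borel_measurable (MT T)" by measurable
  show "AE t in MT T. norm (v t + c *\<^sub>R w t) \<le> norm_Linf T v + \<bar>c\<bar> * norm_Linf T w"
    using Linf_AE(1)[OF assms(1,3)] Linf_AE(1)[OF assms(2,3)]
  proof eventually_elim
    case (elim t)
    have "norm (v t + c *\<^sub>R w t) \<le> norm (v t) + \<bar>c\<bar> * norm (w t)"
      using norm_triangle_ineq[of "v t" "c *\<^sub>R w t"] by simp
    then show ?case using mult_left_mono[OF elim(2), of "\<bar>c\<bar>"] elim(1) by linarith
  qed
qed fact

lemma Linf_diff: "v \<in> Linf T \<Longrightarrow> w \<in> Linf T \<Longrightarrow> 0 < T \<Longrightarrow> (\<lambda>t. v t - w t) \<in> Linf T"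
  using Linf_add[of v T w "-1"] by simp

lemma L2_join:
  assumes "y \<in> L2 T" "v \<in> L2 T" shows "(\<lambda>t. join (y t) (v t)) \<in> L2 T"
  unfolding L2_def
proof safe
  note [measurable] = assms[THEN L2_measurable]
  show "(\<lambda>t. join (y t) (v t)) \<in> borel_measurable (MT T)" by measurable
  show "integrable (MT T) (\<lambda>t. (norm (join (y t) (v t)))\<^sup>2)"
    using assms by (simp add: norm_join_sq L2_square_integrable)
qed

lemma L2_matrix_vector:
  fixes A :: "real \<Rightarrow> real^'k^'l"
  assumes [measurable]: "A \<in> borel_measurable (MT T)" and w: "w \<in> L2 T"
    and A: "\<And>t. t \<in> {0..T} \<Longrightarrow> norm (A t) \<le> C"
  shows "(\<lambda>t. A t *v w t) \<in> L2 T"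
proof (rule L2_I_bound[OF _ w, of _ C])
  note [measurable] = L2_measurable[OF w]
  show "(\<lambda>t. A t *v w t) \<in> borel_measurable (MT T)" by measurable
  show "AE t in MT T. norm (A t *v w t) \<le> C * norm (w t)"
    by (intro AE_MT_I order_trans[OF norm_matrix_vector_le] mult_right_mono A) auto
qed

section \<open>Linear-quadratic problems\<close>

text \<open>The data frozen along one control: \<open>D\<close> stands for the Jacobian of the
  dynamics in (x,u), \<open>Q\<close> for the Hessian of the Hamiltonian, \<open>G\<close> for the
  terminal Hessian. \<open>K\<close> is kept apart from \<open>L\<close> because \<open>Q\<close>
  involves the adjoint, whose bound grows with the L1 norm of the control.\<close>

locale lq_problem =
  fixes T L K :: real
    and D :: "real \<Rightarrow> real^('n::finite + 'm::finite)^'n"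
    and Q :: "real \<Rightarrow> real^('n + 'm)^('n + 'm)"
    and G :: "real^'n^'n"
  assumes T_pos: "0 < T" and L_nonneg: "0 \<le> L" and K_nonneg: "0 \<le> K"
    and D_meas [measurable]: "D \<in> borel_measurable (MT T)"
    and Q_meas [measurable]: "Q \<in> borel_measurable (MT T)"
    and D_bound: "\<And>t. t \<in> {0..T} \<Longrightarrow> norm (D t) \<le> L"
    and Q_bound: "\<And>t. t \<in> {0..T} \<Longrightarrow> norm (Q t) \<le> K"
    and G_bound: "norm G \<le> L"
    and Q_sym: "\<And>t. t \<in> {0..T} \<Longrightarrow> transpose (Q t) = Q t"
    and G_sym: "transpose G = G"
begin

text \<open>A relation instead of a chosen solution: sums and differences of solutions are again
  solutions, whatever their values outside {0..T}.\<close>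

definition lin_state :: "(real \<Rightarrow> real^'m) \<Rightarrow> (real \<Rightarrow> real^'n) \<Rightarrow> bool" where
  "lin_state v y \<longleftrightarrow> ode_solution T (\<lambda>t y. D t *v join y (v t)) y \<and> y 0 = 0"

definition lin_adjoint ::
  "(real \<Rightarrow> real^'m) \<Rightarrow> (real \<Rightarrow> real^'n) \<Rightarrow> (real \<Rightarrow> real^'n) \<Rightarrow> bool" where
  "lin_adjoint v y \<psi> \<longleftrightarrow>
     ode_solution T (\<lambda>t \<psi>. - xpart (transpose (D t) *v \<psi> + Q t *v join (y t) (v t))) \<psi>
     \<and> \<psi> T = G *v y T"

definition second_var ::
  "(real \<Rightarrow> real^'m) \<Rightarrow> (real \<Rightarrow> real^'n) \<Rightarrow> (real \<Rightarrow> real^'n) \<Rightarrow> real \<Rightarrow> real^'m" where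
  "second_var v y \<psi> t = upart (transpose (D t) *v \<psi> t + Q t *v join (y t) (v t))"

text \<open>The polar form of the second variation; on the diagonal it is the left-hand side of the
  coercivity condition.\<close>

definition bil ::
  "(real \<Rightarrow> real^'m) \<Rightarrow> (real \<Rightarrow> real^'n) \<Rightarrow> (real \<Rightarrow> real^'m) \<Rightarrow> (real \<Rightarrow> real^'n) \<Rightarrow> real" where
  "bil v y w z =
     (LINT t|MT T. join (y t) (v t) \<bullet> (Q t *v join (z t) (w t))) + y T \<bullet> (G *v z T)"

definition coercive :: "real \<Rightarrow> bool" where
  "coercive a \<longleftrightarrow> (\<forall>v y. v \<in> L2 T \<longrightarrow> lin_state v y \<longrightarrow> a * (norm_L2 T v)\<^sup>2 \<le> bil v y v y)"

lemma norm_D_vec: "t \<in> {0..T} \<Longrightarrow> norm (D t *v z) \<le> L * norm z"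
  by (rule order_trans[OF norm_matrix_vector_le mult_right_mono[OF D_bound]]) auto

lemma norm_Q_vec: "t \<in> {0..T} \<Longrightarrow> norm (Q t *v z) \<le> K * norm z"
  by (rule order_trans[OF norm_matrix_vector_le mult_right_mono[OF Q_bound]]) auto

lemma norm_DT_vec: "t \<in> {0..T} \<Longrightarrow> norm (transpose (D t) *v p) \<le> L * norm p"
  by (rule order_trans[OF norm_transpose_vector_le mult_right_mono[OF D_bound]]) auto

lemma norm_G_vec: "norm (G *v z) \<le> L * norm z"
  by (rule order_trans[OF norm_matrix_vector_le mult_right_mono[OF G_bound]]) auto

lemma lin_state_continuous: "lin_state v y \<Longrightarrow> continuous_on {0..T} y"
  and lin_adjoint_continuous: "lin_adjoint v y \<psi> \<Longrightarrow> continuous_on {0..T} \<psi>"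
  by (auto simp: lin_state_def lin_adjoint_def intro: ode_solution_continuous)

lemma lin_state_lipschitz:
  assumes "t \<in> {0..T}"
  shows "norm (D t *v join x (v t) - D t *v join y (v t)) \<le> L * norm (x - y)"
proof -
  have "join x (v t) - join y (v t) = join (x - y) 0"
    by (simp flip: join_diff)
  then have "norm (D t *v join x (v t) - D t *v join y (v t)) = norm (D t *v join (x - y) 0)"
    by (simp flip: matrix_vector_mult_diff_distrib)
  also have "\<dots> \<le> L * (norm (x - y) + norm (0::real^'m))"
    by (rule order_trans[OF norm_D_vec[OF assms] mult_left_mono[OF norm_join_le L_nonneg]])
  finally show ?thesis by simp
qed

lemma lin_state_exists:
  assumes v: "v \<in> L2 T" shows "\<exists>y. lin_state v y"
proof -
  note [measurable] = L2_measurable[OF v]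
  obtain y where "ode_solution T (\<lambda>t y. D t *v join y (v t)) y" "y 0 = 0"
  proof (rule ode_solution_exists[OF T_pos L_nonneg, of "\<lambda>t y. D t *v join y (v t)" 0])
    show "(\<lambda>t. D t *v join (x t) (v t)) \<in> borel_measurable (MT T)"
      if [measurable]: "x \<in> borel_measurable (MT T)" for x by measurable
    show "integrable (MT T) (\<lambda>t. D t *v join 0 (v t))"
      by (intro L2_integrable L2_matrix_vector L2_join v L2_continuous continuous_intros D_meas)
        (rule D_bound)
  qed (use lin_state_lipschitz in auto)
  then show ?thesis unfolding lin_state_def by blast
qed

lemma lin_state_unique: "lin_state v y \<Longrightarrow> lin_state v z \<Longrightarrow> t \<in> {0..T} \<Longrightarrow> y t = z t"
  unfolding lin_state_def
  using ode_solution_unique[of T "\<lambda>t y. D t *v join y (v t)" y z L t]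
    L_nonneg lin_state_lipschitz[where v = v] by auto

lemma lin_state_combine:
  assumes "lin_state v y" "lin_state w z"
  shows "lin_state (\<lambda>t. v t + c *\<^sub>R w t) (\<lambda>t. y t + c *\<^sub>R z t)"
  unfolding lin_state_def
proof
  show "ode_solution T (\<lambda>t y. D t *v join y (v t + c *\<^sub>R w t)) (\<lambda>t. y t + c *\<^sub>R z t)"
    using assms unfolding lin_state_def
    by (intro ode_solution_combine)
      (auto simp: join_add join_scaleR matrix_vector_right_distrib matrix_vector_mult_scaleR)
qed (use assms in \<open>simp add: lin_state_def\<close>)

lemma lin_state_diff:
  "lin_state v y \<Longrightarrow> lin_state w z \<Longrightarrow> lin_state (\<lambda>t. v t - w t) (\<lambda>t. y t - z t)"
  using lin_state_combine[of v y w z "-1"] by simp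

lemma lin_state_bound:
  assumes v: "v \<in> L2 T" and y: "lin_state v y" and t: "t \<in> {0..T}"
  shows "norm (y t) \<le> L * exp (L * T) * norm_L1 T v"
proof -
  have "norm (y t) \<le> exp (L * T) * (norm (y 0) + (LINT s|MT T. L * norm (v s)))"
  proof (rule ode_bound_forward[OF _ L_nonneg _ _ _ _ t])
    show "ode_solution T (\<lambda>t y. D t *v join y (v t)) y" using y by (simp add: lin_state_def)
    show "AE s in MT T. norm (D s *v join (y s) (v s)) \<le> L * norm (y s) + L * norm (v s)"
    proof (rule AE_MT_I)
      fix s assume "s \<in> {0..T}"
      then have "norm (D s *v join (y s) (v s)) \<le> L * (norm (y s) + norm (v s))"
        by (rule order_trans[OF norm_D_vec mult_left_mono[OF norm_join_le L_nonneg]])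
      then show "norm (D s *v join (y s) (v s)) \<le> L * norm (y s) + L * norm (v s)"
        by (simp add: distrib_left)
    qed
  qed (use v T_pos L_nonneg in \<open>auto intro: L2_norm_integrable\<close>)
  then show ?thesis
    using y by (simp add: lin_state_def norm_L1_def mult_ac)
qed

lemma Q_join_L2:
  assumes "v \<in> L2 T" "continuous_on {0..T} y"
  shows "(\<lambda>t. Q t *v join (y t) (v t)) \<in> L2 T"
  by (intro L2_matrix_vector L2_join assms L2_continuous Q_meas) (rule Q_bound)

text \<open>A terminal value problem is a boundary value problem with identity boundary maps; the
  backward Gronwall bound excludes homogeneous solutions that vanish at T.\<close>

lemma lin_adjoint_exists:
  assumes v: "v \<in> L2 T" and y: "lin_state v y"
  shows "\<exists>\<psi>. lin_adjoint v y \<psi>"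
proof -
  let ?c = "\<lambda>t. - xpart (Q t *v join (y t) (v t))"
  have lin: "linear (\<lambda>\<psi>. - xpart (transpose (D t) *v \<psi>))" for t
    by (intro linearI) (simp_all add: matrix_vector_right_distrib matrix_vector_mult_scaleR)
  have bnd: "norm (- xpart (transpose (D t) *v x)) \<le> L * norm x" if "t \<in> {0..T}" for t x
    using order_trans[OF norm_xpart_le norm_DT_vec[OF that]] by simp
  have meas: "(\<lambda>t. - xpart (transpose (D t) *v x t)) \<in> borel_measurable (MT T)"
    if [measurable]: "x \<in> borel_measurable (MT T)" for x by measurable
  have c: "integrable (MT T) ?c"
  proof (rule L2_integrable[OF L2_I_bound[where C = 1]])
    show Q: "(\<lambda>t. Q t *v join (y t) (v t)) \<in> L2 T"
      by (intro Q_join_L2 v lin_state_continuous[OF y])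
    show "?c \<in> borel_measurable (MT T)" using L2_measurable[OF Q] by measurable
  qed (simp add: norm_xpart_le)
  have id: "linear (\<lambda>x. x :: real^'n)" by (simp add: linear_iff)
  obtain \<psi> \<xi> where "ode_solution T (\<lambda>t x. - xpart (transpose (D t) *v x) + ?c t) \<psi>" "\<psi> T = G *v y T"
  proof (rule linear_boundary_value_problem[OF T_pos L_nonneg lin bnd meas c id id, where d = "G *v y T"])
    fix z \<xi> assume z: "ode_solution T (\<lambda>t x. - xpart (transpose (D t) *v x)) z" "z 0 = \<xi>" "z T = 0"
    have "norm (z 0) \<le> exp (L * T) * (norm (z T) + (LINT s|MT T. 0))"
      by (rule ode_bound_backward[OF z(1) L_nonneg]) (use T_pos bnd in \<open>auto intro!: AE_MT_I\<close>)
    then show "\<xi> = 0" using z by simp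
  qed auto
  then show ?thesis
    unfolding lin_adjoint_def by (auto simp: algebra_simps)
qed

lemma lin_adjoint_bound:
  assumes v: "v \<in> L2 T" and y: "lin_state v y" and \<psi>: "lin_adjoint v y \<psi>"
    and Y: "\<And>t. t \<in> {0..T} \<Longrightarrow> norm (y t) \<le> Y" and t: "t \<in> {0..T}"
  shows "norm (\<psi> t) \<le> exp (L * T) * (L * Y + K * (T * Y + norm_L1 T v))"
proof -
  have Y0: "0 \<le> Y" using Y[OF t] norm_ge_zero order_trans by blast
  have "norm (\<psi> t) \<le> exp (L * T) * (norm (\<psi> T) + (LINT s|MT T. K * Y + K * norm (v s)))"
  proof (rule ode_bound_backward[OF _ L_nonneg _ _ _ _ t])
    show "ode_solution T (\<lambda>t \<psi>. - xpart (transpose (D t) *v \<psi> + Q t *v join (y t) (v t))) \<psi>"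
      using \<psi> by (simp add: lin_adjoint_def)
    show "AE s in MT T. norm (- xpart (transpose (D s) *v \<psi> s + Q s *v join (y s) (v s)))
        \<le> L * norm (\<psi> s) + (K * Y + K * norm (v s))"
    proof (rule AE_MT_I)
      fix s assume s: "s \<in> {0..T}"
      have "norm (xpart (transpose (D s) *v \<psi> s + Q s *v join (y s) (v s)))
          \<le> norm (transpose (D s) *v \<psi> s) + norm (Q s *v join (y s) (v s))"
        by (rule order_trans[OF norm_xpart_le norm_triangle_ineq])
      also have "\<dots> \<le> L * norm (\<psi> s) + K * (norm (y s) + norm (v s))"
        by (intro add_mono norm_DT_vec s
            order_trans[OF norm_Q_vec[OF s] mult_left_mono[OF norm_join_le K_nonneg]])
      also have "\<dots> \<le> L * norm (\<psi> s) + K * (Y + norm (v s))"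
        using Y[OF s] K_nonneg by (intro add_left_mono mult_left_mono) auto
      finally show "norm (- xpart (transpose (D s) *v \<psi> s + Q s *v join (y s) (v s)))
          \<le> L * norm (\<psi> s) + (K * Y + K * norm (v s))"
        unfolding norm_minus_cancel by (simp only: distrib_left)
    qed
    show "integrable (MT T) (\<lambda>s. K * Y + K * norm (v s))"
      by (intro Bochner_Integration.integrable_add integrable_mult_right L2_norm_integrable v) simp
  qed (use T_pos K_nonneg Y0 in auto)
  also have "(LINT s|MT T. K * Y + K * norm (v s)) = K * (T * Y + norm_L1 T v)"
    using T_pos L2_norm_integrable[OF v] by (simp add: norm_L1_def algebra_simps)
  also have "norm (\<psi> T) \<le> L * Y"
    using \<psi> order_trans[OF norm_G_vec mult_left_mono[OF Y[of T] L_nonneg]] T_pos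
    by (simp add: lin_adjoint_def)
  finally show ?thesis by simp
qed

lemma second_var_L2:
  assumes "v \<in> L2 T" "lin_state v y" "lin_adjoint v y \<psi>"
  shows "second_var v y \<psi> \<in> L2 T"
proof -
  have "(\<lambda>t. transpose (D t) *v \<psi> t) \<in> L2 T"
  proof (rule L2_I_bound[of _ _ \<psi> L])
    show "\<psi> \<in> L2 T" by (rule L2_continuous[OF lin_adjoint_continuous[OF assms(3)]])
    note [measurable] = L2_measurable[OF this]
    show "(\<lambda>t. transpose (D t) *v \<psi> t) \<in> borel_measurable (MT T)" by measurable
  qed (auto intro!: AE_MT_I norm_DT_vec simp: atLeastAtMost_iff[symmetric] simp del: atLeastAtMost_iff)
  from L2_add[OF this Q_join_L2[OF assms(1) lin_state_continuous[OF assms(2)]]]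
  have w: "(\<lambda>t. transpose (D t) *v \<psi> t + Q t *v join (y t) (v t)) \<in> L2 T" .
  have "(\<lambda>t. upart (transpose (D t) *v \<psi> t + Q t *v join (y t) (v t))) \<in> L2 T"
    by (rule L2_I_bound[OF measurable_compose[OF L2_measurable[OF w] borel_measurable_parts(2)] w, of 1])
      (simp only: norm_upart_le mult_1 eventually_True)
  then show ?thesis by (simp only: second_var_def[abs_def])
qed

text \<open>Product rule for \<open>z\<close> and \<open>\<psi>\<close>: the adjoint equation
  cancels the terms in which the Jacobian acts on the state, and the terminal condition supplies the
  \<open>G\<close> term. So \<open>second_var\<close> is the Riesz representative of the second
  variation.\<close>

lemma bil_second_var:
  assumes v: "v \<in> L2 T" and y: "lin_state v y" and \<psi>: "lin_adjoint v y \<psi>"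
    and h: "h \<in> L2 T" and z: "lin_state h z"
  shows "bil h z v y = (LINT t|MT T. second_var v y \<psi> t \<bullet> h t)"
proof -
  let ?q = "\<lambda>t. Q t *v join (y t) (v t)"
  have sz: "ode_solution T (\<lambda>t z. D t *v join z (h t)) z" "z 0 = 0"
    and s\<psi>: "ode_solution T (\<lambda>t \<psi>. - xpart (transpose (D t) *v \<psi> + ?q t)) \<psi>" "\<psi> T = G *v y T"
    using z \<psi> by (auto simp: lin_state_def lin_adjoint_def)
  have q: "integrable (MT T) (\<lambda>t. join (z t) (h t) \<bullet> ?q t)"
    by (intro L2_inner_integrable L2_join L2_continuous h Q_join_L2 v lin_state_continuous[OF y]
        lin_state_continuous[OF z])
  have A: "integrable (MT T) (\<lambda>t. second_var v y \<psi> t \<bullet> h t)"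
    by (rule L2_inner_integrable[OF second_var_L2[OF v y \<psi>] h])
  have eq: "(D t *v join (z t) (h t)) \<bullet> \<psi> t + z t \<bullet> (- xpart (transpose (D t) *v \<psi> t + ?q t))
      = second_var v y \<psi> t \<bullet> h t - join (z t) (h t) \<bullet> ?q t" for t
  proof -
    have "(D t *v join (z t) (h t)) \<bullet> \<psi> t = join (z t) (h t) \<bullet> (transpose (D t) *v \<psi> t)"
      by (metis inner_matrix_transpose inner_commute)
    then show ?thesis
      by (simp add: inner_join second_var_def inner_add_right inner_add_left inner_commute
          algebra_simps)
  qed
  have "z T \<bullet> \<psi> T = (LINT t|MT T. second_var v y \<psi> t \<bullet> h t - join (z t) (h t) \<bullet> ?q t)"
    using ode_solution_by_parts(2)[OF sz(1) s\<psi>(1)] T_pos sz(2) unfolding eq by simp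
  also have "\<dots> = (LINT t|MT T. second_var v y \<psi> t \<bullet> h t) - (LINT t|MT T. join (z t) (h t) \<bullet> ?q t)"
    using A q by simp
  finally show ?thesis by (simp add: bil_def s\<psi>(2))
qed

lemma Q_swap: "t \<in> {0..T} \<Longrightarrow> a \<bullet> (Q t *v b) = b \<bullet> (Q t *v a)"
  by (metis Q_sym inner_matrix_transpose inner_commute)

lemma bil_add:
  assumes v: "v \<in> L2 T" "lin_state v y" and h: "h \<in> L2 T" "lin_state h z"
  shows "bil (\<lambda>t. v t + h t) (\<lambda>t. y t + z t) (\<lambda>t. v t + h t) (\<lambda>t. y t + z t)
     = bil v y v y + 2 * bil h z v y + bil h z h z"
proof -
  have i: "integrable (MT T) (\<lambda>t. join (y' t) (v' t) \<bullet> (Q t *v join (z' t) (h' t)))"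
    if "v' \<in> L2 T" "h' \<in> L2 T" "lin_state v' y'" "lin_state h' z'" for v' h' y' z'
    by (intro L2_inner_integrable L2_join L2_continuous that Q_join_L2
        lin_state_continuous[OF that(3)] lin_state_continuous[OF that(4)])
  have "(LINT t|MT T. join (y t + z t) (v t + h t) \<bullet> (Q t *v join (y t + z t) (v t + h t)))
     = (LINT t|MT T. join (y t) (v t) \<bullet> (Q t *v join (y t) (v t))
         + 2 * (join (z t) (h t) \<bullet> (Q t *v join (y t) (v t)))
         + join (z t) (h t) \<bullet> (Q t *v join (z t) (h t)))"
    by (rule Bochner_Integration.integral_cong)
      (simp_all add: join_add matrix_vector_right_distrib inner_add_left inner_add_right
        Q_swap[of _ "join (y _) (v _)" "join (z _) (h _)"])
  also have "\<dots> = (LINT t|MT T. join (y t) (v t) \<bullet> (Q t *v join (y t) (v t)))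
         + 2 * (LINT t|MT T. join (z t) (h t) \<bullet> (Q t *v join (y t) (v t)))
         + (LINT t|MT T. join (z t) (h t) \<bullet> (Q t *v join (z t) (h t)))"
    using i[OF v(1) v(1) v(2) v(2)] i[OF h(1) v(1) h(2) v(2)] i[OF h(1) h(1) h(2) h(2)] by simp
  moreover have "y T \<bullet> (G *v z T) = z T \<bullet> (G *v y T)"
    by (metis G_sym inner_matrix_transpose inner_commute)
  ultimately show ?thesis
    by (simp add: bil_def matrix_vector_right_distrib inner_add_left inner_add_right)
qed

definition lq_cost ::
  "(real \<Rightarrow> real^'m) \<Rightarrow> (real \<Rightarrow> real^'m) \<Rightarrow> (real \<Rightarrow> real^'n) \<Rightarrow> real" where
  "lq_cost c v y = 1 / 2 * (LINT t|MT T. 2 * (c t \<bullet> v t) + join (y t) (v t) \<bullet> (Q t *v join (y t) (v t)))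
     + 1 / 2 * (y T \<bullet> (G *v y T))"

lemma lq_cost_eq:
  assumes "c \<in> L2 T" "v \<in> L2 T" "lin_state v y"
  shows "lq_cost c v y = (LINT t|MT T. c t \<bullet> v t) + bil v y v y / 2"
proof -
  have "integrable (MT T) (\<lambda>t. join (y t) (v t) \<bullet> (Q t *v join (y t) (v t)))"
    by (rule L2_inner_integrable[OF L2_join[OF L2_continuous assms(2)] Q_join_L2[OF assms(2)]])
      (intro lin_state_continuous[OF assms(3)])+
  then show ?thesis
    using L2_inner_integrable[OF assms(1,2)] by (simp add: lq_cost_def bil_def field_simps)
qed

text \<open>At a critical point the linear part of the increment cancels against the mixed term and
  an exact identity with quadratic remainder is left. Coercivity of the remainder yields both
  minimality and uniqueness of the Newton direction.\<close>

lemma lq_cost_expansion: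
  assumes c: "c \<in> L2 T" and v: "v \<in> L2 T" "lin_state v y" "lin_adjoint v y \<psi>"
    and crit: "AE t in MT T. second_var v y \<psi> t = - c t"
    and w: "w \<in> L2 T" "lin_state w z"
  shows "lq_cost c w z = lq_cost c v y
    + bil (\<lambda>t. w t - v t) (\<lambda>t. z t - y t) (\<lambda>t. w t - v t) (\<lambda>t. z t - y t) / 2"
proof -
  let ?h = "\<lambda>t. w t - v t" and ?z = "\<lambda>t. z t - y t"
  have h: "?h \<in> L2 T" "lin_state ?h ?z"
    using L2_diff[OF w(1) v(1)] lin_state_diff[OF w(2) v(2)] by auto
  have "bil ?h ?z v y = (LINT t|MT T. second_var v y \<psi> t \<bullet> ?h t)"
    by (rule bil_second_var[OF v h])
  also have "\<dots> = (LINT t|MT T. - (c t \<bullet> ?h t))"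
  proof (rule integral_cong_AE)
    show "(\<lambda>t. second_var v y \<psi> t \<bullet> ?h t) \<in> borel_measurable (MT T)"
      using L2_inner_integrable[OF second_var_L2[OF v] h(1)] by (rule borel_measurable_integrable)
    show "(\<lambda>t. - (c t \<bullet> ?h t)) \<in> borel_measurable (MT T)"
      using borel_measurable_integrable[OF L2_inner_integrable[OF c h(1)]] by simp
    show "AE t in MT T. second_var v y \<psi> t \<bullet> ?h t = - (c t \<bullet> ?h t)"
      using crit by eventually_elim simp
  qed
  also have "\<dots> = (LINT t|MT T. c t \<bullet> v t) - (LINT t|MT T. c t \<bullet> w t)"
    using L2_inner_integrable[OF c v(1)] L2_inner_integrable[OF c w(1)]
    by (simp add: inner_diff_right)
  finally show ?thesis
    using bil_add[OF v(1,2) h] lq_cost_eq[OF c v(1,2)] lq_cost_eq[OF c w]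
    by (simp add: field_simps)
qed

end

section \<open>Pointwise coercivity of the control block and solvability of the stationarity
  system\<close>

context lq_problem
begin

text \<open>Every term that contains the state carries \<open>Y\<close>. For a control on a small
  set \<open>Y\<close> can be taken proportional to its L1 norm, so these terms are of higher order
  in the measure of the set.\<close>

lemma bil_le_control_part:
  assumes v: "v \<in> L2 T" and y: "lin_state v y"
    and Y: "\<And>t. t \<in> {0..T} \<Longrightarrow> norm (y t) \<le> Y"
  shows "bil v y v y \<le> (LINT t|MT T. join 0 (v t) \<bullet> (Q t *v join 0 (v t)))
    + K * (2 * Y * norm_L1 T v + T * Y\<^sup>2) + L * Y\<^sup>2"
proof -
  have Y0: "0 \<le> Y" using Y[of 0] T_pos norm_ge_zero[of "y 0"] by (simp del: norm_ge_zero)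
  have zero: "(\<lambda>_. 0 :: real^'n) \<in> L2 T" by (intro L2_continuous continuous_intros)
  have i0: "integrable (MT T) (\<lambda>t. join 0 (v t) \<bullet> (Q t *v join 0 (v t)))"
    by (intro L2_inner_integrable L2_join zero v Q_join_L2 continuous_intros)
  have i1: "integrable (MT T) (\<lambda>t. join (y t) (v t) \<bullet> (Q t *v join (y t) (v t)))"
    by (rule L2_inner_integrable[OF L2_join[OF L2_continuous v] Q_join_L2[OF v]])
      (intro lin_state_continuous[OF y])+
  have i2: "integrable (MT T) (\<lambda>t. K * (2 * Y * norm (v t) + Y\<^sup>2))"
    by (intro integrable_mult_right Bochner_Integration.integrable_add L2_norm_integrable v) simp
  have "(LINT t|MT T. join (y t) (v t) \<bullet> (Q t *v join (y t) (v t)))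
    \<le> (LINT t|MT T. join 0 (v t) \<bullet> (Q t *v join 0 (v t)) + K * (2 * Y * norm (v t) + Y\<^sup>2))"
  proof (rule integral_mono[OF i1 Bochner_Integration.integrable_add[OF i0 i2]])
    fix t assume "t \<in> space (MT T)"
    then have t: "t \<in> {0..T}" by simp
    have Qb: "p \<bullet> (Q t *v q) \<le> K * (norm p * norm q)" for p q
      using order_trans[OF norm_cauchy_schwarz mult_left_mono[OF norm_Q_vec[OF t] norm_ge_zero]]
      by (simp add: mult_ac)
    have ny: "norm (join (y t) (0::real^'m)) \<le> Y" "norm (join (0::real^'n) (v t)) \<le> norm (v t)"
      using norm_join_le[of "y t" "0::real^'m"] norm_join_le[of "0::real^'n" "v t"] Y[OF t] by auto
    have split: "join (y t) (v t) = join (y t) 0 + join 0 (v t)"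
      by (simp flip: join_add)
    have "join (y t) (v t) \<bullet> (Q t *v join (y t) (v t))
      = join 0 (v t) \<bullet> (Q t *v join 0 (v t)) + (join 0 (v t) \<bullet> (Q t *v join (y t) 0)
        + join (y t) 0 \<bullet> (Q t *v join 0 (v t)) + join (y t) 0 \<bullet> (Q t *v join (y t) 0))"
      unfolding split by (simp add: matrix_vector_right_distrib inner_add_left inner_add_right)
    also have "join 0 (v t) \<bullet> (Q t *v join (y t) 0)
        + join (y t) 0 \<bullet> (Q t *v join 0 (v t)) + join (y t) 0 \<bullet> (Q t *v join (y t) 0)
        \<le> K * (norm (v t) * Y) + K * (Y * norm (v t)) + K * (Y * Y)"
      using ny Y0 K_nonneg by (intro add_mono order_trans[OF Qb] mult_left_mono mult_mono) auto
    also have "\<dots> = K * (2 * Y * norm (v t) + Y\<^sup>2)"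
      by (simp add: power2_eq_square algebra_simps)
    finally show "join (y t) (v t) \<bullet> (Q t *v join (y t) (v t))
      \<le> join 0 (v t) \<bullet> (Q t *v join 0 (v t)) + K * (2 * Y * norm (v t) + Y\<^sup>2)" by simp
  qed
  also have "\<dots> = (LINT t|MT T. join 0 (v t) \<bullet> (Q t *v join 0 (v t)))
      + K * (2 * Y * norm_L1 T v + T * Y\<^sup>2)"
    using i0 i2 L2_norm_integrable[OF v] T_pos by (simp add: norm_L1_def algebra_simps)
  finally have "(LINT t|MT T. join (y t) (v t) \<bullet> (Q t *v join (y t) (v t)))
    \<le> (LINT t|MT T. join 0 (v t) \<bullet> (Q t *v join 0 (v t))) + K * (2 * Y * norm_L1 T v + T * Y\<^sup>2)" .
  moreover have "y T \<bullet> (G *v y T) \<le> L * Y\<^sup>2"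
  proof -
    have "y T \<bullet> (G *v y T) \<le> norm (y T) * (L * norm (y T))"
      by (intro order_trans[OF norm_cauchy_schwarz] mult_left_mono norm_G_vec) auto
    also have "\<dots> \<le> Y * (L * Y)"
      using Y[of T] T_pos L_nonneg Y0 by (intro mult_mono) auto
    finally show ?thesis by (simp add: power2_eq_square mult_ac)
  qed
  ultimately show ?thesis by (simp add: bil_def)
qed

text \<open>Testing with \<open>\<xi>\<close> times the indicator of \<open>E\<close>, the state is of the order of the measure of \<open>E\<close>, so
  on small sets only the control block of \<open>Q\<close> matters.\<close>

lemma coercive_small_set:
  assumes co: "coercive a" and E: "E \<in> sets (MT T)" and \<xi>: "\<xi> \<noteq> 0" and "0 < \<epsilon>"
    and le: "\<And>t. t \<in> E \<Longrightarrow> join 0 \<xi> \<bullet> (Q t *v join 0 \<xi>) \<le> (a - \<epsilon>) * (norm \<xi>)\<^sup>2"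
    and small: "measure (MT T) E * (K * (2 * (L * exp (L * T)) + T * (L * exp (L * T))\<^sup>2)
      + L * (L * exp (L * T))\<^sup>2) < \<epsilon>"
  shows "measure (MT T) E = 0"
proof -
  let ?l = "L * exp (L * T)"
  let ?C = "K * (2 * ?l + T * ?l\<^sup>2) + L * ?l\<^sup>2"
  let ?\<mu> = "measure (MT T) E"
  let ?v = "\<lambda>t. indicator E t *\<^sub>R \<xi>"
  interpret M: finite_measure "MT T" by (rule finite_measure_lebesgue_on)
  have ES: "E \<inter> {0..T} = E" using sets.sets_into_space[OF E] by auto
  have v: "?v \<in> L2 T"
  proof (rule L2_bounded)
    show "AE t in MT T. norm (?v t) \<le> norm \<xi>" by (rule AE_I2) (simp add: indicator_def)
  qed (use E in measurable)
  have iE: "integrable (MT T) (indicat_real E)"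
    by (rule integrable_real_indicator[OF E]) (simp add: M.emeasure_eq_measure)
  have n1: "norm_L1 T ?v = ?\<mu> * norm \<xi>"
    using iE ES by (simp add: norm_L1_def)
  have "(LINT t|MT T. (norm (?v t))\<^sup>2) = (LINT t|MT T. indicator E t * (norm \<xi>)\<^sup>2)"
    by (rule Bochner_Integration.integral_cong) (auto simp: indicator_def)
  then have n2: "(norm_L2 T ?v)\<^sup>2 = ?\<mu> * (norm \<xi>)\<^sup>2"
    using iE ES by (simp add: norm_L2_sq)
  obtain y where y: "lin_state ?v y" using lin_state_exists[OF v] by blast
  have Y: "norm (y t) \<le> ?l * (?\<mu> * norm \<xi>)" if "t \<in> {0..T}" for t
    using lin_state_bound[OF v y that] n1 by simp
  have "(LINT t|MT T. join 0 (?v t) \<bullet> (Q t *v join 0 (?v t)))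
      \<le> (LINT t|MT T. indicator E t * ((a - \<epsilon>) * (norm \<xi>)\<^sup>2))"
  proof (rule integral_mono)
    show "integrable (MT T) (\<lambda>t. join 0 (?v t) \<bullet> (Q t *v join 0 (?v t)))"
      by (intro L2_inner_integrable L2_join L2_continuous v Q_join_L2 continuous_intros)
    fix t
    have "join 0 (?v t) = indicator E t *\<^sub>R join 0 \<xi>"
      by (simp flip: join_scaleR)
    then show "join 0 (?v t) \<bullet> (Q t *v join 0 (?v t)) \<le> indicator E t * ((a - \<epsilon>) * (norm \<xi>)\<^sup>2)"
      using le[of t] by (simp add: indicator_def)
  qed (use iE in simp)
  also have "\<dots> = ?\<mu> * ((a - \<epsilon>) * (norm \<xi>)\<^sup>2)" using iE ES by simp
  finally have *: "a * (?\<mu> * (norm \<xi>)\<^sup>2) \<le> ?\<mu> * ((a - \<epsilon>) * (norm \<xi>)\<^sup>2)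
     + K * (2 * (?l * (?\<mu> * norm \<xi>)) * (?\<mu> * norm \<xi>) + T * (?l * (?\<mu> * norm \<xi>))\<^sup>2)
     + L * (?l * (?\<mu> * norm \<xi>))\<^sup>2"
    using bil_le_control_part[OF v y Y] co[unfolded coercive_def, rule_format, OF v y] n1 n2 by simp
  \<comment> \<open>The gap \<epsilon> enters at first order in \<open>?\<mu>\<close> and the state
    terms at second order; \<open>small\<close> makes the two incompatible unless
    \<open>?\<mu>\<close> is zero.\<close>
  have "?\<mu> * (norm \<xi>)\<^sup>2 * \<epsilon> \<le> ?\<mu> * (norm \<xi>)\<^sup>2 * (?\<mu> * ?C)"
    using * by (simp add: power_mult_distrib power2_eq_square algebra_simps)
  then have "?\<mu> * (norm \<xi>)\<^sup>2 * (\<epsilon> - ?\<mu> * ?C) \<le> 0"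
    by (simp add: right_diff_distrib)
  with small \<xi> show ?thesis
    by (smt (verit) measure_nonneg mult_pos_pos zero_less_norm_iff zero_less_power)
qed

text \<open>The set where the bound fails is cut by a grid so fine that
  \<open>coercive_small_set\<close> applies to each piece; countably many null pieces cover
  it.\<close>

lemma coercive_AE_control_part_at:
  assumes co: "coercive a" and \<epsilon>: "0 < \<epsilon>"
  shows "AE t in MT T. (a - \<epsilon>) * (norm \<xi>)\<^sup>2 \<le> join 0 \<xi> \<bullet> (Q t *v join 0 \<xi>)"
proof (cases "\<xi> = 0")
  case False
  let ?l = "L * exp (L * T)"
  let ?C = "K * (2 * ?l + T * ?l\<^sup>2) + L * ?l\<^sup>2"
  have C: "0 \<le> ?C" using L_nonneg K_nonneg T_pos by simp
  interpret M: finite_measure "MT T" by (rule finite_measure_lebesgue_on)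
  define P where "P = {t \<in> space (MT T). join 0 \<xi> \<bullet> (Q t *v join 0 \<xi>) < (a - \<epsilon>) * (norm \<xi>)\<^sup>2}"
  have P: "P \<in> sets (MT T)"
    unfolding P_def by measurable
  \<comment> \<open>Grid cells of length T/N then satisfy T/N * ?C < \<epsilon>, the threshold of
    \<open>coercive_small_set\<close>.\<close>
  obtain N :: nat where N: "T * ?C / \<epsilon> < real N" using reals_Archimedean2 by blast
  then have N0: "0 < real N" using C T_pos \<epsilon> by (smt (verit) divide_nonneg_pos mult_nonneg_nonneg)
  define I where "I k = {real k * (T / N)..real (Suc k) * (T / N)} \<inter> {0..T}" for k
  have I: "I k \<in> sets (MT T)" for k
    by (auto simp: I_def sets_restrict_space)
  have null: "AE t in MT T. t \<notin> P \<inter> I k" for k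
  proof -
    have "measure (MT T) (I k) = measure lborel (I k)"
      by (simp add: measure_restrict_space I_def)
    also have "\<dots> \<le> measure lborel {real k * (T / N)..real (Suc k) * (T / N)}"
      by (rule measure_mono_fmeasurable)
        (auto simp: I_def emeasure_lborel_Icc_eq intro!: fmeasurableI)
    also have "\<dots> = T / N"
    proof -
      have "real k * (T / N) \<le> real (Suc k) * (T / N)"
        using T_pos N0 by (intro mult_right_mono) auto
      then show ?thesis by (simp add: measure_lborel_Icc distrib_right add_divide_distrib)
    qed
    finally have "measure (MT T) (P \<inter> I k) \<le> T / N"
      using M.finite_measure_mono[of "P \<inter> I k" "I k"] I by simp
    then have "measure (MT T) (P \<inter> I k) * ?C \<le> T / N * ?C"
      using C by (rule mult_right_mono)
    also have "\<dots> < \<epsilon>" using N N0 \<epsilon> by (simp add: field_simps)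
    finally have "measure (MT T) (P \<inter> I k) = 0"
      using P I False \<epsilon> by (intro coercive_small_set[OF co, where \<xi> = \<xi>]) (auto simp: P_def)
    then show ?thesis
      using P I by (intro AE_not_in) (simp add: null_setsI M.emeasure_eq_measure)
  qed
  have "AE t in MT T. \<forall>k. t \<notin> P \<inter> I k"
    unfolding AE_all_countable using null by blast
  then have "AE t in MT T. t \<notin> P"
  proof (rule AE_mp, intro AE_MT_I impI notI)
    fix t assume t: "t \<in> {0..T}" and no: "\<forall>k. t \<notin> P \<inter> I k" and "t \<in> P"
    define k where "k = nat \<lfloor>t * N / T\<rfloor>"
    have "real k \<le> t * N / T" "t * N / T \<le> real (Suc k)"
      using t T_pos N0 real_of_int_floor_add_one_ge[of "t * N / T"]
      by (auto simp: k_def of_nat_nat add.commute)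
    then have "t \<in> I k"
      using t T_pos N0 by (auto simp: I_def field_simps)
    with no \<open>t \<in> P\<close> show False by blast
  qed
  then show ?thesis
    by (rule AE_mp) (intro AE_I2 impI, auto simp: P_def not_less)
qed simp

text \<open>One null set has to serve all \<xi>. Countably many \<xi> from a dense set and the gaps
  1/(n+1) cost only one null set, and continuity of the quadratic form reaches the remaining
  \<xi>.\<close>

lemma coercive_AE_control_part:
  assumes co: "coercive a"
  shows "AE t in MT T. \<forall>\<xi>. a * (norm \<xi>)\<^sup>2 \<le> join 0 \<xi> \<bullet> (Q t *v join 0 \<xi>)"
proof -
  obtain S :: "(real^'m) set" where S: "countable S" "\<And>X. open X \<Longrightarrow> X \<noteq> {} \<Longrightarrow> \<exists>d\<in>S. d \<in> X"
    using countable_dense_exists by blast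
  have "AE t in MT T. \<forall>n. (a - 1 / real (Suc n)) * (norm \<xi>)\<^sup>2 \<le> join 0 \<xi> \<bullet> (Q t *v join 0 \<xi>)" for \<xi>
    unfolding AE_all_countable by (intro allI coercive_AE_control_part_at co) simp
  then have "AE t in MT T. \<forall>\<xi>\<in>S. \<forall>n. (a - 1 / real (Suc n)) * (norm \<xi>)\<^sup>2 \<le> join 0 \<xi> \<bullet> (Q t *v join 0 \<xi>)"
    using S(1) by (simp add: AE_ball_countable)
  then show ?thesis
  proof eventually_elim
    case (elim t)
    have le: "a * (norm \<xi>)\<^sup>2 \<le> join 0 \<xi> \<bullet> (Q t *v join 0 \<xi>)" if "\<xi> \<in> S" for \<xi>
    proof (rule LIMSEQ_le_const2)
      show "(\<lambda>n. (a - 1 / real (Suc n)) * (norm \<xi>)\<^sup>2) \<longlonglongrightarrow> a * (norm \<xi>)\<^sup>2"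
        using tendsto_mult[OF tendsto_diff[OF tendsto_const LIMSEQ_inverse_real_of_nat]
            tendsto_const, of a "(norm \<xi>)\<^sup>2"]
        by (simp add: inverse_eq_divide)
    qed (use elim that in blast)
    define \<phi> where "\<phi> \<xi> = join 0 \<xi> \<bullet> (Q t *v join 0 \<xi>) - a * (norm \<xi>)\<^sup>2" for \<xi>
    have j: "continuous_on UNIV (\<lambda>\<xi>::real^'m. join (0::real^'n) \<xi>)"
      using linear_continuous_on[OF bounded_linear_compose[OF bounded_linear_parts(3)
            bounded_linear_Pair[OF bounded_linear_zero bounded_linear_ident]]]
      by simp
    have "continuous_on UNIV \<phi>"
      unfolding \<phi>_def
      by (intro continuous_intros j continuous_on_compose2[OF
            linear_continuous_on[OF matrix_vector_mul_bounded_linear]]) auto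
    then have "open {\<xi>. \<phi> \<xi> < 0}"
      by (simp add: open_Collect_less)
    then have "{\<xi>. \<phi> \<xi> < 0} = {}"
      using S(2) le by (fastforce simp: \<phi>_def)
    then show ?case by (auto simp: \<phi>_def not_less)
  qed
qed

text \<open>Pairing with \<open>v\<close> itself makes the quadratic form vanish, so coercivity
  kills \<open>v\<close>; state and adjoint then vanish by their L1 bounds. The claim on
  \<open>\<psi>\<close> is what excludes nontrivial solutions of the coupled boundary value
  problem.\<close>

lemma second_var_zero:
  assumes co: "coercive a" "0 < a" and v: "v \<in> L2 T" and y: "lin_state v y"
    and \<psi>: "lin_adjoint v y \<psi>" and crit: "AE t in MT T. second_var v y \<psi> t = 0"
  shows "AE t in MT T. v t = 0" and "t \<in> {0..T} \<Longrightarrow> \<psi> t = 0"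
proof -
  have "bil v y v y = (LINT t|MT T. second_var v y \<psi> t \<bullet> v t)"
    by (rule bil_second_var[OF v y \<psi> v y])
  also have "\<dots> = (LINT t|MT T. 0)"
    using crit borel_measurable_integrable[OF L2_inner_integrable[OF second_var_L2[OF v y \<psi>] v]]
    by (intro integral_cong_AE) auto
  finally have "a * (norm_L2 T v)\<^sup>2 \<le> 0"
    using co(1)[unfolded coercive_def, rule_format, OF v y] by simp
  then have n2: "(norm_L2 T v)\<^sup>2 = 0" using co(2) by (simp add: mult_le_0_iff)
  then have "AE t in MT T. (norm (v t))\<^sup>2 = 0"
    unfolding norm_L2_sq
    by (subst (asm) integral_nonneg_eq_0_iff_AE) (auto simp: L2_square_integrable[OF v])
  then show v0: "AE t in MT T. v t = 0" by simp
  have n1: "norm_L1 T v = 0"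
    using norm_L1_sq_le[OF v T_pos] n2 by simp
  show "\<psi> t = 0" if "t \<in> {0..T}"
    using lin_adjoint_bound[OF v y \<psi> _ that, of 0] lin_state_bound[OF v y] n1 by simp
qed

text \<open>Eliminating the control by the invertible block \<open>R\<close> turns stationarity into a linear two-point
  boundary value problem for state and adjoint; coercivity excludes nontrivial homogeneous
  solutions.\<close>

lemma stationary_point_exists:
  assumes co: "coercive a" and a: "0 < a"
    and c [measurable]: "c \<in> borel_measurable (MT T)" and cC: "AE t in MT T. norm (c t) \<le> C"
  obtains v y \<psi> B where "v \<in> borel_measurable (MT T)" "AE t in MT T. norm (v t) \<le> B"
    "lin_state v y" "lin_adjoint v y \<psi>" "AE t in MT T. second_var v y \<psi> t = - c t"
proof -
  define good where "good t \<longleftrightarrow> (\<forall>\<xi>. a * (norm \<xi>)\<^sup>2 \<le> join 0 \<xi> \<bullet> (Q t *v join 0 \<xi>))" for t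
  define block :: "real \<Rightarrow> real^'m^'m" where "block t = (\<chi> i j. Q t $ Inr i $ Inr j)" for t
  \<comment> \<open>At exceptional times a multiple of the identity replaces the block, so that
    \<open>R t\<close> is invertible for every t and the coupled system is defined and bounded on
    all of {0..T}.\<close>
  define R where "R t = (if good t then block t else mat a)" for t
  have block: "block t *v \<xi> = upart (Q t *v join 0 \<xi>)" for t \<xi>
    by (simp add: block_def upart_def vec_eq_iff matrix_vector_mult_def join_def sum.Plus
        UNIV_Plus_UNIV[symmetric] del: UNIV_Plus_UNIV)
  have good: "AE t in MT T. good t"
    unfolding good_def by (rule coercive_AE_control_part[OF co])
  have [measurable]: "block \<in> borel_measurable (MT T)"
    unfolding block_def by (intro borel_measurable_vec_lambda) measurable
  have R_meas [measurable]: "R \<in> borel_measurable (MT T)"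
    by (rule borel_measurable_AE_MT[of block])
      (measurable, use good in \<open>eventually_elim, simp add: R_def\<close>)
  have R_pos: "a * (norm \<xi>)\<^sup>2 \<le> \<xi> \<bullet> (R t *v \<xi>)" for t \<xi>
  proof (cases "good t")
    case True
    then show ?thesis by (simp add: R_def block good_def inner_join)
  next
    case False
    have "mat a *v \<xi> = a *\<^sub>R \<xi>"
      by (simp add: vec_eq_iff matrix_vector_mult_def mat_def if_distrib[of "\<lambda>x. x * _"] sum.delta' cong: if_cong)
    then show ?thesis using False by (simp add: R_def power2_norm_eq_inner)
  qed
  have R_inj: "\<xi> = 0" if "R t *v \<xi> = 0" for t \<xi>
    using R_pos[of \<xi> t] that a by (simp add: mult_le_0_iff)
  have inv: "invertible (R t)" for t
    unfolding invertible_left_inverse matrix_left_invertible_ker using R_inj by blast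
  then obtain P where P: "\<And>t. R t ** P t = mat 1"
    unfolding invertible_def by metis
  define \<rho> where "\<rho> t q = P t *v q" for t q
  have R\<rho>: "R t *v \<rho> t q = q" for t q
    by (simp add: \<rho>_def matrix_vector_mul_assoc P)
  have \<rho>_bound: "norm (\<rho> t q) \<le> norm q / a" for t q
  proof (cases "\<rho> t q = 0")
    case False
    have "a * (norm (\<rho> t q))\<^sup>2 \<le> norm (\<rho> t q) * norm q"
      using R_pos[of "\<rho> t q" t] norm_cauchy_schwarz[of "\<rho> t q" q] by (simp add: R\<rho>)
    then show ?thesis using False a by (simp add: power2_eq_square field_simps)
  qed (use a in simp)
  \<comment> \<open>The inverse \<open>P\<close> is chosen pointwise, so its measurability is not
    evident. Cramer's rule writes the solution as a quotient of determinants with measurable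
    entries.\<close>
  have \<rho>_meas: "(\<lambda>t. \<rho> t (q t)) \<in> borel_measurable (MT T)"
    if [measurable]: "q \<in> borel_measurable (MT T)" for q
  proof -
    have "\<rho> t (q t) = (\<chi> k. det (\<chi> i j. if j = k then q t $ i else R t $ i $ j) / det (R t))" for t
      using cramer[of "R t" "\<rho> t (q t)" "q t"] inv[of t] R\<rho> by (simp add: invertible_det_nz)
    moreover have "(\<lambda>t. det (A t)) \<in> borel_measurable (MT T)"
      if "\<And>i j. (\<lambda>t. A t $ i $ j) \<in> borel_measurable (MT T)" for A :: "real \<Rightarrow> real^'m^'m"
      unfolding det_def by (intro borel_measurable_sum borel_measurable_times borel_measurable_prod
          borel_measurable_const that)
    then have "(\<lambda>t. \<chi> k. det (\<chi> i j. if j = k then q t $ i else R t $ i $ j) / det (R t))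
        \<in> borel_measurable (MT T)"
      by (intro borel_measurable_vec_lambda borel_measurable_divide) (simp_all add: if_distrib)
    ultimately show ?thesis by simp
  qed
  have \<rho>_lin: "\<rho> t (p + q) = \<rho> t p + \<rho> t q" "\<rho> t (r *\<^sub>R q) = r *\<^sub>R \<rho> t q" for t p q r
    by (simp_all add: \<rho>_def matrix_vector_right_distrib matrix_vector_mult_scaleR)
  \<comment> \<open>\<open>X\<close> is the part of the second variation that does not contain the
    control. Solving R v = - X - c gives v = V + w with \<open>V\<close> linear in the pair of state
    and adjoint and \<open>w\<close> determined by \<open>c\<close>; \<open>d\<close> is the source
    that \<open>w\<close> induces.\<close>
  define X where "X t z = upart (transpose (D t) *v snd z + Q t *v join (fst z) 0)" for t and z :: "(real^'n) \<times> (real^'n)"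
  define V where "V t z = - \<rho> t (X t z)" for t z
  define A where "A t z = (D t *v join (fst z) (V t z),
      - xpart (transpose (D t) *v snd z + Q t *v join (fst z) (V t z)))" for t z
  define w where "w t = - \<rho> t (c t)" for t
  define d where "d t = (D t *v join 0 (w t), - xpart (Q t *v join 0 (w t)))" for t
  have j0: "join (x + x') 0 = join x 0 + join x' (0::real^'m)" "join (r *\<^sub>R x) 0 = r *\<^sub>R join x (0::real^'m)"
    for x x' :: "real^'n" and r
    by (simp_all flip: join_add join_scaleR)
  have X_lin: "X t (z + z') = X t z + X t z'" "X t (r *\<^sub>R z) = r *\<^sub>R X t z" for t z z' r
    by (simp_all add: X_def j0 matrix_vector_right_distrib matrix_vector_mult_scaleR algebra_simps)
  have V_lin: "V t (z + z') = V t z + V t z'" "V t (r *\<^sub>R z) = r *\<^sub>R V t z" for t z z' r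
    by (simp_all add: V_def X_lin \<rho>_lin)
  have A_lin: "linear (A t)" for t
    by (rule linearI)
      (simp_all add: A_def V_lin join_add join_scaleR matrix_vector_right_distrib
        matrix_vector_mult_scaleR algebra_simps)
  have X_bound: "norm (X t z) \<le> (L + K) * norm z" if t: "t \<in> {0..T}" for t z
  proof -
    have "norm (X t z) \<le> norm (transpose (D t) *v snd z) + norm (Q t *v join (fst z) 0)"
      unfolding X_def by (rule order_trans[OF norm_upart_le norm_triangle_ineq])
    also have "\<dots> \<le> L * norm (snd z) + K * norm (join (fst z) (0::real^'m))"
      by (intro add_mono norm_DT_vec norm_Q_vec t)
    also have "\<dots> \<le> L * norm z + K * norm z"
      using norm_join_le[of "fst z" "0::real^'m"] norm_fst_le[of "fst z" "snd z"] norm_snd_le[of "snd z" "fst z"]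
      by (intro add_mono mult_left_mono L_nonneg K_nonneg) auto
    finally show ?thesis by (simp add: distrib_right)
  qed
  define \<beta> where "\<beta> = (L + K) / a"
  have \<beta>0: "0 \<le> \<beta>" using L_nonneg K_nonneg a by (simp add: \<beta>_def)
  have V_bound: "norm (V t z) \<le> \<beta> * norm z" if t: "t \<in> {0..T}" for t z
    using order_trans[OF \<rho>_bound divide_right_mono[OF X_bound[OF t]]] a
    by (simp add: V_def \<beta>_def)
  define \<Lambda> where "\<Lambda> = L * (1 + \<beta>) + (L + K * (1 + \<beta>))"
  have \<Lambda>0: "0 \<le> \<Lambda>" using L_nonneg K_nonneg \<beta>0 by (simp add: \<Lambda>_def)
  have A_bound: "norm (A t z) \<le> \<Lambda> * norm z" if t: "t \<in> {0..T}" for t z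
  proof -
    have j: "norm (join (fst z) (V t z)) \<le> (1 + \<beta>) * norm z"
      using norm_join_le[of "fst z" "V t z"] V_bound[OF t, of z] norm_fst_le[of "fst z" "snd z"]
      by (simp add: distrib_right)
    have "norm (A t z) \<le> norm (D t *v join (fst z) (V t z))
        + norm (transpose (D t) *v snd z + Q t *v join (fst z) (V t z))"
      unfolding A_def
      by (rule order_trans[OF norm_Pair_le]) (use norm_xpart_le in \<open>simp del: parts_add\<close>)
    also have "\<dots> \<le> L * norm (join (fst z) (V t z)) + (L * norm (snd z) + K * norm (join (fst z) (V t z)))"
      by (intro add_mono norm_D_vec norm_triangle_le norm_DT_vec norm_Q_vec t)
    also have "\<dots> \<le> L * ((1 + \<beta>) * norm z) + (L * norm z + K * ((1 + \<beta>) * norm z))"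
      using j norm_snd_le[of "snd z" "fst z"] by (intro add_mono mult_left_mono L_nonneg K_nonneg) auto
    finally show ?thesis by (simp add: \<Lambda>_def algebra_simps)
  qed
  have fst_snd: "(\<lambda>t. fst (z t)) \<in> borel_measurable (MT T)" "(\<lambda>t. snd (z t)) \<in> borel_measurable (MT T)"
    if "z \<in> borel_measurable (MT T)" for z :: "real \<Rightarrow> (real^'n) \<times> (real^'n)"
    by (auto intro!: measurable_compose[OF that] borel_measurable_continuous_onI continuous_intros)
  have V_meas: "(\<lambda>t. V t (z t)) \<in> borel_measurable (MT T)"
    if "z \<in> borel_measurable (MT T)" for z
  proof -
    note [measurable] = fst_snd[OF that]
    show ?thesis
      unfolding V_def X_def by (intro borel_measurable_uminus \<rho>_meas) measurable
  qed
  have A_meas: "(\<lambda>t. A t (z t)) \<in> borel_measurable (MT T)"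
    if "z \<in> borel_measurable (MT T)" for z
  proof -
    note [measurable] = V_meas[OF that] fst_snd[OF that]
    show ?thesis unfolding A_def by measurable
  qed
  have w_meas [measurable]: "w \<in> borel_measurable (MT T)"
    unfolding w_def[abs_def] by (intro borel_measurable_uminus \<rho>_meas c)
  have w_bound: "AE t in MT T. norm (w t) \<le> C / a"
    using cC
  proof eventually_elim
    case (elim t)
    then show ?case
      using order_trans[OF \<rho>_bound divide_right_mono[OF elim]] a by (simp add: w_def)
  qed
  have w_L2: "w \<in> L2 T" by (rule L2_bounded[OF w_meas w_bound])
  have d: "integrable (MT T) d"
  proof (rule integrable_bounded_MT)
    show "d \<in> borel_measurable (MT T)" unfolding d_def[abs_def] by measurable
    show "AE t in MT T. norm (d t) \<le> (L + K) * (C / a)"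
      using w_bound AE_space
    proof eventually_elim
      case (elim t)
      then have t: "t \<in> {0..T}" by simp
      have "norm (d t) \<le> norm (D t *v join 0 (w t)) + norm (Q t *v join 0 (w t))"
        unfolding d_def by (rule order_trans[OF norm_Pair_le]) (simp add: norm_xpart_le)
      also have "\<dots> \<le> L * norm (join (0::real^'n) (w t)) + K * norm (join (0::real^'n) (w t))"
        by (intro add_mono norm_D_vec norm_Q_vec t)
      also have "\<dots> \<le> L * (C / a) + K * (C / a)"
        using elim(1) norm_join_le[of "0::real^'n" "w t"]
        by (intro add_mono mult_left_mono L_nonneg K_nonneg) auto
      finally show ?case by (simp add: distrib_right add_divide_distrib)
    qed
  qed
  have bl: "bounded_linear (fst :: (real^'n) \<times> (real^'n) \<Rightarrow> real^'n)"
    "bounded_linear (snd :: (real^'n) \<times> (real^'n) \<Rightarrow> real^'n)"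
    by (simp_all add: bounded_linear_fst bounded_linear_snd)
  \<comment> \<open>\<open>s\<close> scales the inhomogeneity: s = 0 is the homogeneous system, used
    for injectivity of the shooting map, and s = 1 the actual one.\<close>
  have sys: "lin_state (\<lambda>t. V t (z t) + s *\<^sub>R w t) (\<lambda>t. fst (z t))"
      "lin_adjoint (\<lambda>t. V t (z t) + s *\<^sub>R w t) (\<lambda>t. fst (z t)) (\<lambda>t. snd (z t))"
    if z: "ode_solution T (\<lambda>t x. A t x + s *\<^sub>R d t) z" "fst (z 0) = 0" "snd (z T) - G *v fst (z T) = 0"
    for z s
  proof -
    have j: "join x (v + s *\<^sub>R v') = join x v + s *\<^sub>R join 0 v'" for x :: "real^'n" and v v' :: "real^'m"
      using join_add[of x "s *\<^sub>R 0" v "s *\<^sub>R v'"] unfolding join_scaleR by simp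
    show "lin_state (\<lambda>t. V t (z t) + s *\<^sub>R w t) (\<lambda>t. fst (z t))"
      unfolding lin_state_def
      by (intro conjI ode_solution_bounded_linear[OF z(1) bl(1)])
        (simp_all add: z(2) A_def d_def j matrix_vector_right_distrib matrix_vector_mult_scaleR)
    show "lin_adjoint (\<lambda>t. V t (z t) + s *\<^sub>R w t) (\<lambda>t. fst (z t)) (\<lambda>t. snd (z t))"
      unfolding lin_adjoint_def
      by (intro conjI ode_solution_bounded_linear[OF z(1) bl(2)])
        (use z(3) in \<open>simp_all add: A_def d_def j matrix_vector_right_distrib matrix_vector_mult_scaleR\<close>)
  qed
  have stat: "AE t in MT T. second_var (\<lambda>t. V t (z t) + s *\<^sub>R w t) (\<lambda>t. fst (z t)) (\<lambda>t. snd (z t)) t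
      = - (s *\<^sub>R c t)" for z s
    using good
  proof eventually_elim
    case (elim t)
    let ?v = "V t (z t) + s *\<^sub>R w t"
    have "join (fst (z t)) ?v = join (fst (z t)) 0 + join 0 ?v"
      by (simp flip: join_add)
    then have "second_var (\<lambda>t. V t (z t) + s *\<^sub>R w t) (\<lambda>t. fst (z t)) (\<lambda>t. snd (z t)) t
        = X t (z t) + upart (Q t *v join 0 ?v)"
      by (simp add: second_var_def X_def matrix_vector_right_distrib)
    also have "upart (Q t *v join 0 ?v) = R t *v ?v"
      using elim by (simp add: R_def block)
    also have "\<dots> = - X t (z t) - s *\<^sub>R c t"
      by (simp add: V_def w_def matrix_vector_mult_diff_distrib matrix_vector_mult_scaleR
          linear_neg[OF matrix_vector_mul_linear] R\<rho>)
    finally show ?case by simp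
  qed
  have v_L2: "(\<lambda>t. V t (z t) + s *\<^sub>R w t) \<in> L2 T" if z: "continuous_on {0..T} z" for z s
  proof (rule L2_add[OF _ L2_scale[OF w_L2]])
    show "(\<lambda>t. V t (z t)) \<in> L2 T"
      by (rule L2_I_bound[OF V_meas L2_continuous[OF z] AE_MT_I])
        (auto intro: V_bound continuous_measurable_MT[OF z] simp del: atLeastAtMost_iff)
  qed
  have lins: "linear (\<lambda>\<xi>. (0 :: real^'n, \<xi> :: real^'n))"
    "linear (\<lambda>z :: (real^'n) \<times> (real^'n). snd z - G *v fst z)"
    by (auto intro!: linearI simp: matrix_vector_right_distrib matrix_vector_mult_scaleR algebra_simps)
  obtain z \<xi> where z: "ode_solution T (\<lambda>t x. A t x + d t) z" "z 0 = (0, \<xi>)" "snd (z T) - G *v fst (z T) = 0"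
  proof (rule linear_boundary_value_problem[OF T_pos \<Lambda>0 A_lin A_bound A_meas d lins, of 0])
    fix z \<xi> assume z: "ode_solution T A z" "z 0 = (0, \<xi>)" "snd (z T) - G *v fst (z T) = 0"
    then have z': "ode_solution T (\<lambda>t x. A t x + 0 *\<^sub>R d t) z" "fst (z 0) = 0"
      by simp_all
    have "snd (z 0) = 0"
      by (rule second_var_zero(2)[OF co a v_L2[OF ode_solution_continuous[OF z(1)]]
            sys[OF z'(1,2) z(3)]])
        (use stat[of z 0] T_pos in simp_all)
    then show "\<xi> = 0" using z by simp
  qed auto
  have z': "ode_solution T (\<lambda>t x. A t x + 1 *\<^sub>R d t) z" "fst (z 0) = 0"
    using z by simp_all
  note zc = ode_solution_continuous[OF z(1)]
  obtain Z where Z: "\<And>t. t \<in> {0..T} \<Longrightarrow> norm (z t) \<le> Z"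
    using compact_imp_bounded[OF compact_continuous_image[OF zc]] unfolding bounded_iff by blast
  show ?thesis
  proof (rule that)
    show "(\<lambda>t. V t (z t) + 1 *\<^sub>R w t) \<in> borel_measurable (MT T)"
      by (rule L2_measurable[OF v_L2[OF zc]])
    show "AE t in MT T. norm (V t (z t) + 1 *\<^sub>R w t) \<le> \<beta> * Z + C / a"
      using w_bound AE_space
    proof eventually_elim
      case (elim t)
      then have t: "t \<in> {0..T}" by simp
      show ?case
        using V_bound[OF t, of "z t"] mult_left_mono[OF Z[OF t] \<beta>0] elim(1)
        by (intro norm_triangle_le) simp
    qed
    show "AE t in MT T. second_var (\<lambda>t. V t (z t) + 1 *\<^sub>R w t) (\<lambda>t. fst (z t)) (\<lambda>t. snd (z t)) t = - c t"
      using stat[of z 1] by simp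
  qed (rule sys[OF z' z(3)])+
qed

end

lemma mult_left_cancel_le_nonneg: "0 \<le> n \<Longrightarrow> n * (a * n) \<le> n * B \<Longrightarrow> 0 \<le> B \<Longrightarrow> a * n \<le> B"
  for n a B :: real
  by (cases "n = 0") (auto simp: mult_le_cancel_left)

section \<open>From coercivity in L2 to a supremum bound for the inverse\<close>

context lq_problem
begin

text \<open>Pairing with \<open>v\<close> gives a ||v||_2^2 \<le> w ||v||_1 and hence ||v||_1 \<le>
  T w / a. This controls state and adjoint uniformly in time, and then the formula for
  \<open>second_var\<close> is solved for v(t) by means of the control block, which is at least
  \<open>a\<close>.\<close>

lemma inverse_bound:
  assumes co: "coercive a" and a: "0 < a" and v: "v \<in> L2 T" and y: "lin_state v y"
    and \<psi>: "lin_adjoint v y \<psi>" and w: "AE t in MT T. norm (second_var v y \<psi> t) \<le> w"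
  defines "l \<equiv> L * exp (L * T)"
  shows "AE t in MT T. norm (v t)
    \<le> w / a + (L * (exp (L * T) * (L * l + K * (T * l + 1))) + K * l) * (T * w / a) / a"
proof -
  let ?N = "norm_L1 T v" and ?c = "exp (L * T) * (L * l + K * (T * l + 1))"
  have w0: "0 \<le> w"
    by (rule AE_MT_const[OF T_pos], use w in eventually_elim) (meson norm_ge_zero order_trans)
  have l0: "0 \<le> l" using L_nonneg by (simp add: l_def)
  have c0: "0 \<le> ?c" using L_nonneg K_nonneg T_pos l0 by simp
  have "a * (norm_L2 T v)\<^sup>2 \<le> bil v y v y"
    using co[unfolded coercive_def, rule_format, OF v y] .
  also have "bil v y v y = (LINT t|MT T. second_var v y \<psi> t \<bullet> v t)"
    by (rule bil_second_var[OF v y \<psi> v y])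
  also have "\<dots> \<le> (LINT t|MT T. w * norm (v t))"
  proof (rule integral_mono_AE)
    show "integrable (MT T) (\<lambda>t. second_var v y \<psi> t \<bullet> v t)"
      by (rule L2_inner_integrable[OF second_var_L2[OF v y \<psi>] v])
    show "AE t in MT T. second_var v y \<psi> t \<bullet> v t \<le> w * norm (v t)"
      using w
      by eventually_elim (rule order_trans[OF norm_cauchy_schwarz mult_right_mono], auto)
  qed (use L2_norm_integrable[OF v] in simp)
  finally have "a * (norm_L2 T v)\<^sup>2 \<le> w * ?N" by (simp add: norm_L1_def)
  then have "?N\<^sup>2 \<le> T * (w * ?N / a)"
    using norm_L1_sq_le[OF v T_pos] a T_pos
    by (smt (verit) mult_left_mono mult.commute pos_le_divide_eq)
  then have N: "?N \<le> T * w / a"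
  proof (cases "?N = 0")
    case False
    then have "0 < ?N" by (simp add: order_less_le)
    moreover have "?N * ?N \<le> (T * w / a) * ?N"
      using \<open>?N\<^sup>2 \<le> _\<close> by (simp add: power2_eq_square mult_ac)
    ultimately show ?thesis by (rule mult_right_le_imp_le[rotated])
  qed (use w0 a T_pos in simp)
  have Y: "norm (y t) \<le> l * ?N" if "t \<in> {0..T}" for t
    using lin_state_bound[OF v y that] by (simp add: l_def)
  have \<Psi>: "norm (\<psi> t) \<le> ?c * ?N" if "t \<in> {0..T}" for t
    using lin_adjoint_bound[OF v y \<psi> Y that] by (simp add: algebra_simps)
  show ?thesis
    using w coercive_AE_control_part[OF co] AE_space
  proof eventually_elim
    case (elim t)
    then have t: "t \<in> {0..T}" by simp
    have "second_var v y \<psi> t = upart (transpose (D t) *v \<psi> t) + upart (Q t *v join (y t) 0)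
        + upart (Q t *v join 0 (v t))"
      using join_add[of "y t" 0 0 "v t"] by (simp add: second_var_def matrix_vector_right_distrib)
    then have "v t \<bullet> upart (Q t *v join 0 (v t))
        = v t \<bullet> (second_var v y \<psi> t - upart (transpose (D t) *v \<psi> t) - upart (Q t *v join (y t) 0))"
      by simp
    also have "\<dots> \<le> norm (v t) * (w + L * (?c * ?N) + K * (l * ?N))"
    proof (intro order_trans[OF norm_cauchy_schwarz] mult_left_mono)
      have "norm (upart (transpose (D t) *v \<psi> t)) \<le> L * (?c * ?N)"
        by (rule order_trans[OF norm_upart_le order_trans[OF norm_DT_vec[OF t]
              mult_left_mono[OF \<Psi>[OF t] L_nonneg]]])
      moreover have "norm (upart (Q t *v join (y t) 0)) \<le> K * (l * ?N)"
        using norm_join_le[of "y t" "0::real^'m"] Y[OF t]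
        by (intro order_trans[OF norm_upart_le order_trans[OF norm_Q_vec[OF t]
              mult_left_mono[OF _ K_nonneg]]]) simp
      ultimately show "norm (second_var v y \<psi> t - upart (transpose (D t) *v \<psi> t)
          - upart (Q t *v join (y t) 0)) \<le> w + L * (?c * ?N) + K * (l * ?N)"
        using elim(1) by (intro norm_triangle_le_diff add_mono)
    qed simp
    finally have "a * (norm (v t))\<^sup>2 \<le> norm (v t) * (w + L * (?c * ?N) + K * (l * ?N))"
      using elim(2) by (simp add: inner_join) (smt (verit, ccfv_threshold))
    then have "norm (v t) * (a * norm (v t)) \<le> norm (v t) * (w + (L * ?c + K * l) * ?N)"
      by (simp add: power2_eq_square algebra_simps)
    moreover have "0 \<le> w + (L * ?c + K * l) * ?N"
      using w0 L_nonneg c0 K_nonneg l0 T_pos by (intro add_nonneg_nonneg mult_nonneg_nonneg) auto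
    ultimately have "a * norm (v t) \<le> w + (L * ?c + K * l) * ?N"
      by (rule mult_left_cancel_le_nonneg[OF norm_ge_zero])
    also have "\<dots> \<le> w + (L * ?c + K * l) * (T * w / a)"
      using N L_nonneg c0 K_nonneg l0 by (intro add_left_mono mult_left_mono) auto
    finally have "norm (v t) \<le> (w + (L * ?c + K * l) * (T * w / a)) / a"
      using a by (simp add: pos_le_divide_eq mult.commute)
    then show ?case by (simp only: add_divide_distrib)
  qed
qed

end

section \<open>The constants of the a priori estimates\<close>

locale constants =
  fixes T L :: real and x0 :: "real^'n"
  assumes T_pos: "0 < T" and L_pos: "0 < L"
begin

abbreviation "l \<equiv> L * exp (L * T)"
abbreviation "c1 \<equiv> C_1 T L x0"
abbreviation "cx \<equiv> C_x T L x0"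
abbreviation "cp \<equiv> C_p T L x0"
abbreviation "cy \<equiv> C_y T L x0"
abbreviation "kp \<equiv> K_p T L x0"
abbreviation "kpsi \<equiv> K_psi T L x0"
abbreviation "cpsi \<equiv> C_psi T L x0"
abbreviation "c2 \<equiv> C_2 T L x0"
abbreviation "c3 \<equiv> C_3 T L x0"
abbreviation "ch \<equiv> C_h T L x0"

lemma l_pos: "0 < l" using L_pos by simp

lemma l_le_cx: "l \<le> cx" by (simp add: C_x_def)

lemma cx_pos: "0 < cx" using l_pos l_le_cx by linarith

lemma kp_pos: "0 < kp"
  using L_pos T_pos cx_pos by (simp add: K_p_def)

lemma kp_le_cp: "kp \<le> cp" by (simp add: C_p_def)

lemma cp_pos: "0 < cp" using kp_pos kp_le_cp by linarith

lemma c1_ge: "cx \<le> c1" "cp \<le> c1" "L * (cp + cx + cp * cx) \<le> c1" "L * (1 + cp) \<le> c1"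
  by (auto simp: C_1_def C_H_def)

lemma l_le_c1: "l \<le> c1" using l_le_cx c1_ge by linarith

lemma c1_pos: "0 < c1" using l_pos l_le_c1 by linarith

text \<open>The factors show the origin of \<open>C_y\<close>: \<open>l\<close> combines the factor
  exp (L T) of Gronwall with the Lipschitz constant of the Jacobian, c1 T + 1 bounds the increment
  of (x,u), and l T + 1 comes from integrating l N + |v|.\<close>

lemma cy_eq: "cy = l * (c1 * T + 1) * (l * T + 1)"
  by (simp add: C_y_def algebra_simps)

lemma l_le_cy: "l \<le> cy"
proof -
  have "1 \<le> (c1 * T + 1) * (l * T + 1)"
    using c1_pos l_pos T_pos mult_mono[of 1 "c1 * T + 1" 1 "l * T + 1"] by simp
  then have "l * 1 \<le> l * ((c1 * T + 1) * (l * T + 1))"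
    using l_pos by (intro mult_left_mono) auto
  then show ?thesis by (simp add: cy_eq mult.assoc)
qed

lemma cy_pos: "0 < cy" using l_pos l_le_cy by linarith

lemma kpsi_ge: "exp (L * T) * (L * l + c1 * (l * T + 1)) \<le> kpsi"
  unfolding K_psi_def using l_le_cy L_pos T_pos c1_pos
  by (intro mult_left_mono add_mono mult_right_mono) auto

lemma kpsi_pos: "0 < kpsi"
  unfolding K_psi_def using cy_pos L_pos T_pos c1_pos by (simp add: add_pos_pos)

lemma c2_ge: "cy \<le> c2" "cpsi \<le> c2" "kpsi \<le> c2" "l \<le> c2"
  using l_le_cy by (auto simp: C_2_def C_psi_def)

lemma c2_pos: "0 < c2" using cy_pos c2_ge by linarith

lemma cpsi_ge: "exp (L * T) * (L * cy * (c1 * T + 1) + L * kpsi * T * (c1 * T + 1)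
    + c1 * (cy * T\<^sup>2 + 2 * cy * T + T + 1)) \<le> cpsi"
  by (simp add: C_psi_def)

text \<open>Collects what multiplies the L1 norm of the direction, while c1 (T + 1) multiplies its
  pointwise value. Bounding the L1 norm by T times the supremum merges the two into
  \<open>c3\<close>.\<close>

abbreviation "m3 \<equiv> c2 * (L * (c1 * T + 2) + c1 * (T + 2))"

lemma c3_eq: "c3 = T * m3 + c1 * (T + 1)"
  by (simp add: C_3_def algebra_simps)

lemma m3_pos: "0 < m3"
  using c2_pos L_pos c1_pos T_pos by (simp add: add_pos_pos)

lemma c3_pos: "0 < c3"
  unfolding c3_eq using m3_pos c1_pos T_pos by (simp add: add_pos_pos)

text \<open>Both the Lipschitz estimate for the second derivative and the Taylor estimate for the gradient
  are instances: \<open>y\<close> and \<open>\<psi>\<close> are differences of states and adjoints, \<open>v\<close> is the direction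
  (in the second case the increment of the control), \<open>W\<close> is \<open>1\<close> plus the norm of a control in
  \<open>L\<^sup>1\<close>, and \<open>e\<close> bounds the increment in \<open>L\<^sup>\<infinity>\<close>.\<close>

lemma perturbation_estimate:
  assumes y: "ode_solution T F y" "y 0 = 0" and \<psi>: "ode_solution T P \<psi>"
    and e: "0 \<le> e" and W: "1 \<le> W" and h: "0 \<le> h" "h \<le> c1 * (T + 1) * W * e"
    and v: "v \<in> L2 T" and N: "N = norm_L1 T v"
    and Fy: "AE s in MT T. norm (F s (y s)) \<le> L * norm (y s) + L * (c1 * T + 1) * e * (l * N + norm (v s))"
    and P\<psi>: "AE s in MT T. norm (P s (\<psi> s)) \<le> L * norm (\<psi> s) + c1 * W * norm (y s)
      + (L * (c1 * T + 1) * e * (kpsi * W * N) + h * (l * N + norm (v s)))"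
    and \<psi>T: "norm (\<psi> T) \<le> L * norm (y T) + L * (c1 * T * e) * (l * N)"
    and t: "t \<in> {0..T}"
  shows "norm (y t) \<le> cy * e * N"
    and "L * norm (\<psi> t) + c1 * W * norm (y t)
      + (L * (c1 * T + 1) * e * (kpsi * W * N) + h * (l * N + norm (v t)))
      \<le> W * e * (m3 * N) + h * norm (v t)"
proof -
  note pos = T_pos L_pos l_pos c1_pos cy_pos kpsi_pos c2_pos
  have N0: "0 \<le> N" by (simp add: N)
  have iv: "integrable (MT T) (\<lambda>s. norm (v s))" by (rule L2_norm_integrable[OF v])
  have iN: "(LINT s|MT T. l * N + norm (v s)) = (l * T + 1) * N"
    using iv T_pos by (simp add: N norm_L1_def algebra_simps)
  have Y: "norm (y t) \<le> cy * e * N" if t: "t \<in> {0..T}" for t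
  proof -
    have "norm (y t) \<le> exp (L * T) * (norm (y 0) + (LINT s|MT T. L * (c1 * T + 1) * e * (l * N + norm (v s))))"
      using pos e N0
      by (intro ode_bound_forward[OF y(1) _ _ Fy _ _ t] integrable_mult_right
          Bochner_Integration.integrable_add iv AE_I2 mult_nonneg_nonneg add_nonneg_nonneg) auto
    also have "\<dots> = cy * e * N"
      by (simp only: integral_mult_right_zero iN y(2) cy_eq norm_zero add_0) (simp add: algebra_simps)
    finally show ?thesis .
  qed
  show yt: "norm (y t) \<le> cy * e * N" by (rule Y[OF t])
  let ?A = "L * (c1 * T + 1) * e * (kpsi * W * N)"
  \<comment> \<open>The uniform bound for \<open>y\<close> is inserted before the backward estimate,
    so that its source no longer contains \<open>y\<close>.\<close>
  let ?r = "\<lambda>s. c1 * W * (cy * e * N) + (?A + h * (l * N + norm (v s)))"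
  have A0: "0 \<le> ?A" using pos e N0 W by simp
  have "norm (\<psi> t) \<le> exp (L * T) * (norm (\<psi> T) + (LINT s|MT T. ?r s))"
  proof (rule ode_bound_backward[OF \<psi> _ _ _ _ _ t])
    show "AE s in MT T. norm (P s (\<psi> s)) \<le> L * norm (\<psi> s) + ?r s"
      using P\<psi> AE_space
    proof eventually_elim
      case (elim s)
      then have "c1 * W * norm (y s) \<le> c1 * W * (cy * e * N)"
        using pos W by (intro mult_left_mono Y) auto
      then show ?case using elim(1) by linarith
    qed
    show "integrable (MT T) ?r"
      by (intro Bochner_Integration.integrable_add integrable_mult_right iv) simp_all
    show "AE s in MT T. 0 \<le> ?r s"
      using pos e N0 W h A0 by (intro AE_I2 add_nonneg_nonneg mult_nonneg_nonneg) auto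
  qed (use pos in auto)
  also have "(LINT s|MT T. ?r s) = T * (c1 * W * (cy * e * N)) + T * ?A + h * ((l * T + 1) * N)"
  proof -
    have "(LINT s|MT T. ?r s) = (LINT s|MT T. c1 * W * (cy * e * N) + ?A) + (LINT s|MT T. h * (l * N + norm (v s)))"
      using iv by (subst Bochner_Integration.integral_add[symmetric])
        (auto simp: add.assoc intro!: Bochner_Integration.integrable_add integrable_mult_right)
    also have "(LINT s|MT T. h * (l * N + norm (v s))) = h * ((l * T + 1) * N)"
      by (simp only: integral_mult_right_zero iN)
    finally show ?thesis using T_pos by (simp add: algebra_simps)
  qed
  \<comment> \<open>The terminal terms lack the factor \<open>W\<close> and are enlarged using W
    \<ge> 1, and \<open>h\<close> is replaced by its bound. Everything is then a multiple of W e N;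
    with exp (L T) the coefficient is the second entry of the maximum in
    \<open>C_psi\<close>.\<close>
  also have "norm (\<psi> T) + (T * (c1 * W * (cy * e * N)) + T * ?A + h * ((l * T + 1) * N))
    \<le> (L * (cy * e * N) + L * (c1 * T * e) * (cy * N)) * W + (T * (c1 * W * (cy * e * N)) + T * ?A
        + (c1 * (T + 1) * W * e) * ((cy * T + 1) * N))"
  proof (intro add_mono order_refl)
    have "norm (\<psi> T) \<le> L * (cy * e * N) + L * (c1 * T * e) * (l * N)"
      using \<psi>T Y[of T] pos by (smt (verit) atLeastAtMost_iff mult_left_mono)
    also have "\<dots> \<le> L * (cy * e * N) + L * (c1 * T * e) * (cy * N)"
      using pos e N0 l_le_cy by (intro add_left_mono mult_left_mono mult_right_mono) auto
    also have "\<dots> \<le> (L * (cy * e * N) + L * (c1 * T * e) * (cy * N)) * W"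
    proof -
      have "0 \<le> L * (cy * e * N) + L * (c1 * T * e) * (cy * N)" using pos e N0 by simp
      from mult_left_mono[OF W this] show ?thesis by simp
    qed
    finally show "norm (\<psi> T) \<le> (L * (cy * e * N) + L * (c1 * T * e) * (cy * N)) * W" .
    show "h * ((l * T + 1) * N) \<le> (c1 * (T + 1) * W * e) * ((cy * T + 1) * N)"
      using pos e N0 W h l_le_cy by (intro mult_mono mult_right_mono add_mono) auto
  qed
  also have "(L * (cy * e * N) + L * (c1 * T * e) * (cy * N)) * W + (T * (c1 * W * (cy * e * N)) + T * ?A
        + (c1 * (T + 1) * W * e) * ((cy * T + 1) * N))
    = (L * cy * (c1 * T + 1) + L * kpsi * T * (c1 * T + 1)
       + c1 * (cy * T\<^sup>2 + 2 * cy * T + T + 1)) * (W * e * N)"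
    by (simp add: algebra_simps power2_eq_square)
  finally have "norm (\<psi> t) \<le> exp (L * T) * (L * cy * (c1 * T + 1) + L * kpsi * T * (c1 * T + 1)
       + c1 * (cy * T\<^sup>2 + 2 * cy * T + T + 1)) * (W * e * N)"
    by (simp add: mult.assoc)
  also have "\<dots> \<le> c2 * (W * e * N)"
    using cpsi_ge c2_ge W e N0 by (intro mult_right_mono) auto
  finally have \<psi>t: "norm (\<psi> t) \<le> c2 * (W * e * N)" by simp
  \<comment> \<open>All constants are absorbed into \<open>c2\<close>, and the coefficients add up
    to \<open>m3\<close>. Only h |v(t)| stays apart, so that a smaller \<open>h\<close> improves the
    total constant.\<close>
  have "L * norm (\<psi> t) + c1 * W * norm (y t) + (?A + h * (l * N + norm (v t)))
     \<le> L * (c2 * (W * e * N)) + c1 * W * (c2 * e * N) + (L * (c1 * T + 1) * e * (c2 * W * N)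
        + ((c1 * (T + 1) * W * e) * (c2 * N) + h * norm (v t)))"
  proof (intro add_mono mult_left_mono \<psi>t)
    show "norm (y t) \<le> c2 * e * N"
      using yt c2_ge(1) e N0 by (meson mult_right_mono order_trans)
    have "h * (l * N) \<le> (c1 * (T + 1) * W * e) * (c2 * N)"
      using h c2_ge N0 pos W e by (intro mult_mono mult_right_mono) auto
    then show "h * (l * N + norm (v t)) \<le> (c1 * (T + 1) * W * e) * (c2 * N) + h * norm (v t)"
      by (simp add: distrib_left)
    show "kpsi * W * N \<le> c2 * W * N"
      using c2_ge W N0 by (intro mult_right_mono) auto
  qed (use pos e W in auto)
  also have "\<dots> = W * e * (m3 * N) + h * norm (v t)"
    by (simp add: algebra_simps)
  finally show "L * norm (\<psi> t) + c1 * W * norm (y t) + (?A + h * (l * N + norm (v t)))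
      \<le> W * e * (m3 * N) + h * norm (v t)" .
qed

end

section \<open>Control problems\<close>

lemma on_join_join [simp]: "on_join \<phi> (join x u) = \<phi> x u"
  by (simp add: on_join_def)

lemma norm_sum_scaleR_le:
  fixes p :: "real^'n" and B :: "'a::real_normed_vector^'n"
  shows "norm (\<Sum>i\<in>UNIV. p $ i *\<^sub>R B $ i) \<le> norm p * norm B"
proof -
  have "norm (\<Sum>i\<in>UNIV. p $ i *\<^sub>R B $ i) \<le> (\<Sum>i\<in>UNIV. \<bar>p $ i\<bar> * \<bar>norm (B $ i)\<bar>)"
    by (rule order_trans[OF norm_sum]) simp
  also have "\<dots> \<le> L2_set (($) p) UNIV * L2_set (\<lambda>i. norm (B $ i)) UNIV"
    by (rule L2_set_mult_ineq)
  also have "L2_set (($) p) UNIV = norm p"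
    by (simp add: norm_vec_def L2_set_def)
  finally show ?thesis by (simp add: norm_vec_def[of B])
qed

lemma has_derivative_vec_lambda:
  fixes F :: "'i::finite \<Rightarrow> 'a::real_normed_vector \<Rightarrow> 'b::euclidean_space"
  assumes "\<And>i. (F i has_derivative F' i) (at z)"
  shows "((\<lambda>z. \<chi> i. F i z) has_derivative (\<lambda>h. \<chi> i. F' i h)) (at z)"
proof (subst has_derivative_componentwise_within, rule ballI)
  fix e :: "'b^'i" assume "e \<in> Basis"
  then obtain i d where e: "e = axis i d" by (auto simp: Basis_vec_def)
  show "((\<lambda>x. (\<chi> i. F i x) \<bullet> e) has_derivative (\<lambda>h. (\<chi> i. F' i h) \<bullet> e)) (at z)"
    using has_derivative_inner_left[OF assms[of i], of d] by (simp add: e inner_axis)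
qed

lemma sum_scaleR_matrix_vector:
  fixes p :: "real^'n" and B :: "real^'k^'l^'n"
  shows "(\<Sum>i\<in>UNIV. p $ i *\<^sub>R B $ i) *v h = (\<Sum>i\<in>UNIV. p $ i *\<^sub>R (B $ i *v h))"
proof -
  have "(\<Sum>j\<in>UNIV. (\<Sum>i\<in>UNIV. p $ i * B $ i $ k $ j) * h $ j)
      = (\<Sum>i\<in>UNIV. p $ i * (\<Sum>j\<in>UNIV. B $ i $ k $ j * h $ j))" for k
    by (simp add: sum_distrib_right sum_distrib_left mult.assoc) (rule sum.swap)
  then show ?thesis
    by (simp add: vec_eq_iff matrix_vector_mult_def)
qed

locale control_problem = constants T L x0
  for T L :: real and x0 :: "real^'n::finite" +
  fixes b :: "real \<Rightarrow> real^'n \<Rightarrow> real^'m::finite \<Rightarrow> real^'n"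
    and f :: "real \<Rightarrow> real^'n \<Rightarrow> real^'m \<Rightarrow> real"
    and g :: "real^'n \<Rightarrow> real"
  assumes standing: "standing_assumptions T L b f g"
begin

text \<open>Assembled from gradients of components, so that the results on gradients apply row by
  row.\<close>

definition jac :: "real \<Rightarrow> real^('n + 'm) \<Rightarrow> real^('n + 'm)^'n" where
  "jac t z = (\<chi> i. grad (\<lambda>z. on_join (b t) z $ i) z)"

definition grad_ham :: "real \<Rightarrow> real^'n \<Rightarrow> real^('n + 'm) \<Rightarrow> real^('n + 'm)" where
  "grad_ham t p z = grad (on_join (hamiltonian b f p t)) z"

definition hess_ham :: "real \<Rightarrow> real^'n \<Rightarrow> real^('n + 'm) \<Rightarrow> real^('n + 'm)^('n + 'm)" where
  "hess_ham t p z = hess (on_join (hamiltonian b f p t)) z"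

section \<open>Derivatives of the dynamics and of the Hamiltonian in the joined variable\<close>

lemma on_join_hamiltonian: "on_join (hamiltonian b f p t) = (\<lambda>z. on_join (b t) z \<bullet> p + on_join (f t) z)"
  by (simp add: fun_eq_iff on_join_def hamiltonian_def)

lemma twice_diff:
  assumes "t \<in> {0..T}"
  shows "twice_differentiable (on_join (b t))" "twice_differentiable (on_join (f t))"
  using standing assms by (auto simp: standing_assumptions_def)

lemma twice_diff_g: "twice_differentiable g"
  using standing by (simp add: standing_assumptions_def)

lemma twice_diff_ham: "t \<in> {0..T} \<Longrightarrow> twice_differentiable (on_join (hamiltonian b f p t))"
  unfolding on_join_hamiltonian by (intro twice_differentiable_inner_add twice_diff)

lemma twice_diff_b: "t \<in> {0..T} \<Longrightarrow> twice_differentiable (\<lambda>z. on_join (b t) z $ i)"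
  using twice_differentiable_inner_add[OF twice_diff(1) twice_differentiable_const, of t "axis i 1" 0]
  by (simp add: inner_axis)

lemma jac_derivative:
  assumes t: "t \<in> {0..T}"
  shows "(on_join (b t) has_derivative (\<lambda>h. jac t z *v h)) (at z)"
proof -
  have "((\<lambda>z. \<chi> i. on_join (b t) z $ i) has_derivative (\<lambda>h. \<chi> i. h \<bullet> grad (\<lambda>z. on_join (b t) z $ i) z)) (at z)"
    by (rule has_derivative_vec_lambda) (rule has_derivative_grad[OF twice_diff_b[OF t]])
  then show ?thesis
    by (simp add: jac_def matrix_vector_mult_def inner_vec_def mult.commute)
qed

lemma join_deriv:
  fixes x :: "real^'n" and u :: "real^'m"
  shows "((\<lambda>x :: real^'n. join x u) has_derivative (\<lambda>h. join h 0)) F"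
    and "((\<lambda>u :: real^'m. join x u) has_derivative (\<lambda>h. join 0 h)) F'"
proof -
  have lin: "bounded_linear (\<lambda>h :: real^'n. join h (0 :: real^'m))" "bounded_linear (\<lambda>h :: real^'m. join (0 :: real^'n) h)"
    unfolding linear_conv_bounded_linear[symmetric]
    by (auto intro!: linearI simp: join_def vec_eq_iff split: sum.split)
  have eq: "(\<lambda>x. join x u) = (\<lambda>x. join 0 u + join x 0)" "(\<lambda>u. join x u) = (\<lambda>u. join x 0 + join 0 u)" for x :: "real^'n" and u :: "real^'m"
    by (simp_all add: fun_eq_iff flip: join_add)
  have "((\<lambda>x. join 0 u + join x 0) has_derivative (\<lambda>h. 0 + join h 0)) F"
    by (rule has_derivative_add[OF has_derivative_const bounded_linear_imp_has_derivative[OF lin(1)]])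
  moreover have "((\<lambda>u. join x 0 + join 0 u) has_derivative (\<lambda>h. 0 + join 0 h)) F'"
    by (rule has_derivative_add[OF has_derivative_const bounded_linear_imp_has_derivative[OF lin(2)]])
  ultimately show "((\<lambda>x :: real^'n. join x u) has_derivative (\<lambda>h. join h 0)) F"
    "((\<lambda>u :: real^'m. join x u) has_derivative (\<lambda>h. join 0 h)) F'"
    unfolding eq[symmetric] by simp_all
qed

lemma jac_parts:
  assumes t: "t \<in> {0..T}"
  shows "jac_x b t x u *v y = jac t (join x u) *v join y 0"
    and "jac_u b t x u *v v = jac t (join x u) *v join 0 v"
proof -
  have "((\<lambda>x'. on_join (b t) (join x' u)) has_derivative (\<lambda>h. jac t (join x u) *v join h 0)) (at x)"
    "((\<lambda>u'. on_join (b t) (join x u')) has_derivative (\<lambda>h. jac t (join x u) *v join 0 h)) (at u)"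
    by (rule has_derivative_compose[OF join_deriv(1) jac_derivative[OF t]]
        has_derivative_compose[OF join_deriv(2) jac_derivative[OF t]])+
  then have d: "((\<lambda>x'. b t x' u) has_derivative (\<lambda>h. jac t (join x u) *v join h 0)) (at x)"
    "((\<lambda>u'. b t x u') has_derivative (\<lambda>h. jac t (join x u) *v join 0 h)) (at u)"
    by simp_all
  have "((\<lambda>x'. b t x' u) has_derivative (\<lambda>h. jac_x b t x u *v h)) (at x)"
    "((\<lambda>u'. b t x u') has_derivative (\<lambda>h. jac_u b t x u *v h)) (at u)"
    using d unfolding jac_x_def jac_u_def by (auto simp: jacobian_works[symmetric] differentiable_def)
  from has_derivative_unique[OF this(1) d(1)] has_derivative_unique[OF this(2) d(2)]
  show "jac_x b t x u *v y = jac t (join x u) *v join y 0"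
    "jac_u b t x u *v v = jac t (join x u) *v join 0 v" by metis+
qed

lemma jac_join:
  assumes "t \<in> {0..T}"
  shows "jac_x b t x u *v y + jac_u b t x u *v v = jac t (join x u) *v join y v"
  using join_add[of y 0 0 v] by (simp add: jac_parts[OF assms] flip: matrix_vector_right_distrib)

lemma jac_x_transpose:
  assumes "t \<in> {0..T}"
  shows "transpose (jac_x b t x u) *v p = xpart (transpose (jac t (join x u)) *v p)"
proof -
  have "(transpose (jac_x b t x u) *v p) \<bullet> y = xpart (transpose (jac t (join x u)) *v p) \<bullet> y" for y
    using inner_parts[of "transpose (jac t (join x u)) *v p" "join y 0"]
    by (simp add: inner_matrix_transpose jac_parts[OF assms])
  then show ?thesis using vector_eq_rdot by blast
qed

lemma grad_parts:
  fixes \<phi> :: "real \<Rightarrow> real^'n \<Rightarrow> real^'m \<Rightarrow> real"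
  assumes "twice_differentiable (on_join (\<phi> t))"
  shows "grad_x \<phi> t x u = xpart (grad (on_join (\<phi> t)) (join x u))"
    and "grad_u \<phi> t x u = upart (grad (on_join (\<phi> t)) (join x u))"
proof -
  have "((\<lambda>x'. on_join (\<phi> t) (join x' u)) has_derivative (\<lambda>h. join h 0 \<bullet> grad (on_join (\<phi> t)) (join x u))) (at x)"
    "((\<lambda>u'. on_join (\<phi> t) (join x u')) has_derivative (\<lambda>h. join 0 h \<bullet> grad (on_join (\<phi> t)) (join x u))) (at u)"
    by (rule has_derivative_compose[OF join_deriv(1) has_derivative_grad[OF assms]]
        has_derivative_compose[OF join_deriv(2) has_derivative_grad[OF assms]])+
  then show "grad_x \<phi> t x u = xpart (grad (on_join (\<phi> t)) (join x u))"
    "grad_u \<phi> t x u = upart (grad (on_join (\<phi> t)) (join x u))"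
    unfolding grad_x_def grad_u_def by (auto intro!: grad_eqI simp: inner_join)
qed

lemma grad_ham_eq:
  assumes t: "t \<in> {0..T}"
  shows "grad_ham t p z = transpose (jac t z) *v p + grad (on_join (f t)) z"
  unfolding grad_ham_def
proof (rule grad_eqI)
  have "((\<lambda>z. on_join (b t) z \<bullet> p + on_join (f t) z) has_derivative
      (\<lambda>h. (jac t z *v h) \<bullet> p + h \<bullet> grad (on_join (f t)) z)) (at z)"
    by (intro has_derivative_add has_derivative_inner_left jac_derivative[OF t]
        has_derivative_grad[OF twice_diff(2)[OF t]])
  then show "(on_join (hamiltonian b f p t) has_derivative
      (\<lambda>h. h \<bullet> (transpose (jac t z) *v p + grad (on_join (f t)) z))) (at z)"
    unfolding on_join_hamiltonian
    by (simp add: inner_add_right inner_commute[of _ "transpose (jac t z) *v p"]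
        inner_matrix_transpose inner_commute[of _ p])
qed

lemma grad_x_adjoint:
  assumes t: "t \<in> {0..T}"
  shows "- (transpose (jac_x b t x u) *v p) - grad_x f t x u = - xpart (grad_ham t p (join x u))"
  by (simp add: jac_x_transpose[OF t] grad_parts[where \<phi> = f, OF twice_diff(2)[OF t]] grad_ham_eq[OF t])

lemma grad_u_hamiltonian:
  "t \<in> {0..T} \<Longrightarrow> grad_u (hamiltonian b f p) t x u = upart (grad_ham t p (join x u))"
  by (simp add: grad_parts[where \<phi> = "hamiltonian b f p", OF twice_diff_ham] grad_ham_def)

lemma hess_xu_hamiltonian: "hess_xu (hamiltonian b f p) t x u = hess_ham t p (join x u)"
  by (simp add: hess_xu_def hess_ham_def)

text \<open>The standing assumptions concern the third-order array of the dynamics, not the Hessian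
  of the Hamiltonian. This combination transfers bounds and Lipschitz constants by Cauchy-Schwarz in
  the index of \<open>p\<close>.\<close>

lemma hess_ham_eq:
  assumes t: "t \<in> {0..T}"
  shows "hess_ham t p (join x u) = (\<Sum>i\<in>UNIV. p $ i *\<^sub>R hess_xu_vec b t x u $ i) + hess_xu f t x u"
  unfolding hess_ham_def
proof (rule hess_eqI)
  have grad: "grad (on_join (hamiltonian b f p t))
      = (\<lambda>z. (\<Sum>i\<in>UNIV. p $ i *\<^sub>R grad (\<lambda>z. on_join (b t) z $ i) z) + grad (on_join (f t)) z)"
  proof
    fix z
    have "transpose (jac t z) *v p = (\<Sum>i\<in>UNIV. p $ i *\<^sub>R grad (\<lambda>z. on_join (b t) z $ i) z)"
      by (simp add: jac_def vec_eq_iff matrix_vector_mult_def transpose_def mult.commute)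
    then show "grad (on_join (hamiltonian b f p t)) z
        = (\<Sum>i\<in>UNIV. p $ i *\<^sub>R grad (\<lambda>z. on_join (b t) z $ i) z) + grad (on_join (f t)) z"
      using grad_ham_eq[OF t, of p z] by (simp add: grad_ham_def)
  qed
  have hv: "hess_xu_vec b t x u $ i = hess (\<lambda>z. on_join (b t) z $ i) (join x u)" for i
    by (simp add: hess_xu_vec_def hess_xu_def on_join_def[abs_def])
  have mv: "((\<Sum>i\<in>UNIV. p $ i *\<^sub>R hess_xu_vec b t x u $ i) + hess_xu f t x u) *v h
      = (\<Sum>i\<in>UNIV. p $ i *\<^sub>R (hess (\<lambda>z. on_join (b t) z $ i) (join x u) *v h)) + hess (on_join (f t)) (join x u) *v h" for h
    by (simp only: matrix_vector_mult_add_rdistrib sum_scaleR_matrix_vector) (simp only: hv hess_xu_def)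
  show "(grad (on_join (hamiltonian b f p t)) has_derivative
     (*v) ((\<Sum>i\<in>UNIV. p $ i *\<^sub>R hess_xu_vec b t x u $ i) + hess_xu f t x u)) (at (join x u))"
    unfolding grad mv
    by (intro has_derivative_add has_derivative_sum has_derivative_scaleR_right
        has_derivative_hess twice_diff_b twice_diff(2) t)
qed

lemma standing_bounds:
  assumes "t \<in> {0..T}"
  shows "norm (b t x u) \<le> L * (norm x + norm u + 1)"
    and "norm (jac_x b t x u) + norm (jac_u b t x u) \<le> L"
    and "norm (hess_xu_vec b t x u) \<le> L"
    and "norm (grad_x f t x u) + norm (grad_u f t x u) \<le> L * (norm x + norm u + 1)"
    and "norm (hess_xu f t x u) \<le> L"
    and "\<bar>f t x u\<bar> \<le> L * ((norm x)\<^sup>2 + (norm u)\<^sup>2 + 1)"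
    and "norm (hess_xu_vec b t x u - hess_xu_vec b t x' u') \<le> L * (norm (x - x') + norm (u - u'))"
    and "norm (hess_xu f t x u - hess_xu f t x' u') \<le> L * (norm (x - x') + norm (u - u'))"
  using standing assms by (auto simp: standing_assumptions_def)

lemma g_bounds:
  shows "norm (grad g x) \<le> L * (norm x + 1)" and "norm (hess g x) \<le> L"
    and "norm (hess g x - hess g x') \<le> L * norm (x - x')"
  using standing by (auto simp: standing_assumptions_def)

text \<open>Squared Frobenius norms add over the two blocks, so the assumed bound on the sum of the
  block norms is also one for the full Jacobian.\<close>

lemma norm_jac:
  assumes t: "t \<in> {0..T}" shows "norm (jac t z) \<le> L"
proof -
  let ?x = "xpart z" and ?u = "upart z"
  have comp: "jac t z $ i $ Inl j = jac_x b t ?x ?u $ i $ j" "jac t z $ i $ Inr k = jac_u b t ?x ?u $ i $ k"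
    for i j :: 'n and k :: 'm
  proof -
    have ax: "join (axis j 1) (0::real^'m) = axis (Inl j) 1" "join (0::real^'n) (axis k 1) = axis (Inr k) 1"
      by (auto simp: join_def axis_def vec_eq_iff split: sum.split)
    show "jac t z $ i $ Inl j = jac_x b t ?x ?u $ i $ j" "jac t z $ i $ Inr k = jac_u b t ?x ?u $ i $ k"
      using jac_parts(1)[OF t, of ?x ?u "axis j 1"] jac_parts(2)[OF t, of ?x ?u "axis k 1"]
      unfolding ax join_parts
      by (auto simp only: matrix_vector_mult_basis column_def vec_eq_iff vec_lambda_beta)
  qed
  have row: "(norm (jac t z $ i))\<^sup>2 = (norm (jac_x b t ?x ?u $ i))\<^sup>2 + (norm (jac_u b t ?x ?u $ i))\<^sup>2" for i
    by (simp add: norm_vec_def L2_set_def sum_nonneg UNIV_Plus_UNIV[symmetric] sum.Plus comp del: UNIV_Plus_UNIV)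
  have sq: "(norm A)\<^sup>2 = (\<Sum>i\<in>UNIV. (norm (A $ i))\<^sup>2)" for A :: "real^'k^'n"
    by (simp add: norm_vec_def[of A] L2_set_def sum_nonneg)
  have "(norm (jac t z))\<^sup>2 = (norm (jac_x b t ?x ?u))\<^sup>2 + (norm (jac_u b t ?x ?u))\<^sup>2"
    unfolding sq by (simp add: row sum.distrib)
  also have "\<dots> \<le> (norm (jac_x b t ?x ?u) + norm (jac_u b t ?x ?u))\<^sup>2"
    by (simp add: power2_sum)
  finally have "norm (jac t z) \<le> norm (jac_x b t ?x ?u) + norm (jac_u b t ?x ?u)"
    by (rule power2_le_imp_le) simp
  also have "\<dots> \<le> L" by (rule standing_bounds[OF t])
  finally show ?thesis .
qed

lemma jac_lipschitz:
  assumes t: "t \<in> {0..T}" shows "norm (jac t z - jac t z') \<le> L * norm (z - z')"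
proof (rule differentiable_bound[where S = UNIV])
  fix z
  let ?H = "\<lambda>h. \<chi> i. hess (\<lambda>z. on_join (b t) z $ i) z *v h"
  show "(jac t has_derivative ?H) (at z within UNIV)"
    unfolding jac_def[abs_def]
    by (rule has_derivative_vec_lambda) (rule has_derivative_hess[OF twice_diff_b[OF t]])
  show "onorm ?H \<le> L"
  proof (rule onorm_le)
    fix h
    have hv: "hess_xu_vec b t (xpart z) (upart z) $ i = hess (\<lambda>z. on_join (b t) z $ i) z" for i
      by (simp add: hess_xu_vec_def hess_xu_def on_join_def[abs_def])
    have "norm (?H h) \<le> L2_set (\<lambda>i. norm (hess_xu_vec b t (xpart z) (upart z) $ i) * norm h) UNIV"
      unfolding norm_vec_def[of "?H h"]
      by (rule L2_set_mono) (simp_all add: hv norm_matrix_vector_le)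
    also have "\<dots> = norm (hess_xu_vec b t (xpart z) (upart z)) * norm h"
      by (simp add: norm_vec_def[of "hess_xu_vec b t (xpart z) (upart z)"] L2_set_left_distrib)
    also have "\<dots> \<le> L * norm h"
      by (intro mult_right_mono standing_bounds t) simp
    finally show "norm (?H h) \<le> L * norm h" .
  qed
qed auto

lemma b_lipschitz:
  assumes t: "t \<in> {0..T}"
  shows "norm (b t x u - b t x' u') \<le> L * norm (join x u - join x' u')"
proof -
  have "norm (on_join (b t) (join x u) - on_join (b t) (join x' u')) \<le> L * norm (join x u - join x' u')"
  proof (rule differentiable_bound[where S = UNIV])
    show "(on_join (b t) has_derivative (\<lambda>h. jac t z *v h)) (at z within UNIV)" for z
      using jac_derivative[OF t] .
    show "onorm ((*v) (jac t z)) \<le> L" for z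
      by (rule onorm_le) (meson norm_jac[OF t] norm_matrix_vector_le mult_right_mono norm_ge_zero order_trans)
  qed auto
  then show ?thesis by simp
qed

lemma b_linearization:
  assumes t: "t \<in> {0..T}"
  shows "norm (b t x u - b t x' u' - jac t (join x u) *v (join x u - join x' u'))
    \<le> L * (norm (join x u - join x' u'))\<^sup>2"
proof -
  let ?z = "join x u" and ?z' = "join x' u'"
  have seg: "?z' + s *\<^sub>R (?z - ?z') \<in> closed_segment ?z' ?z" if "s \<in> {0..1}" for s
    using that unfolding closed_segment_def by (intro CollectI exI[of _ s]) (auto simp: algebra_simps)
  have D: "(on_join (b t) has_derivative (\<lambda>h. jac t \<xi> *v h)) (at \<xi> within closed_segment ?z' ?z)" for \<xi>
    using jac_derivative[OF t] has_derivative_at_withinI by blast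
  have O: "onorm ((*v) (jac t \<xi>) - (*v) (jac t ?z)) \<le> L * norm (?z - ?z')"
    if "\<xi> \<in> closed_segment ?z' ?z" for \<xi>
  proof (rule onorm_le)
    fix h
    have "norm (jac t \<xi> - jac t ?z) \<le> L * norm (?z - ?z')"
      using order_trans[OF jac_lipschitz[OF t] mult_left_mono[OF segment_bound(2)[OF that]]] L_pos by simp
    then have "norm ((jac t \<xi> - jac t ?z) *v h) \<le> L * norm (?z - ?z') * norm h"
      by (meson norm_matrix_vector_le mult_right_mono norm_ge_zero order_trans)
    then show "norm (((*v) (jac t \<xi>) - (*v) (jac t ?z)) h) \<le> L * norm (?z - ?z') * norm h"
      by (simp add: matrix_vector_mult_diff_rdistrib)
  qed
  show ?thesis
    using differentiable_bound_linearization[of ?z' ?z "closed_segment ?z' ?z" "on_join (b t)"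
        "\<lambda>\<xi> h. jac t \<xi> *v h" ?z "L * norm (?z - ?z')", OF seg D O]
    by (simp add: power2_eq_square mult_ac)
qed

lemma norm_grad_f:
  assumes t: "t \<in> {0..T}"
  shows "norm (grad (on_join (f t)) (join x u)) \<le> L * (norm x + norm u + 1)"
proof -
  have "norm (grad (on_join (f t)) (join x u)) \<le> norm (grad_x f t x u) + norm (grad_u f t x u)"
    using norm_join_le[of "grad_x f t x u" "grad_u f t x u"]
    by (simp add: grad_parts[where \<phi> = f, OF twice_diff(2)[OF t]])
  then show ?thesis using standing_bounds(4)[OF t, of x u] by linarith
qed

lemma norm_hess_ham:
  assumes t: "t \<in> {0..T}" shows "norm (hess_ham t p z) \<le> L * (1 + norm p)"
proof -
  have "norm (hess_ham t p (join (xpart z) (upart z))) \<le> norm p * L + L"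
    unfolding hess_ham_eq[OF t]
    by (intro norm_triangle_le add_mono order_trans[OF norm_sum_scaleR_le mult_left_mono]
        standing_bounds t) auto
  then show ?thesis by (simp add: algebra_simps)
qed

text \<open>The difference p - p' meets the bounded array at the first point, and the difference of
  arrays meets \<open>p'\<close>. In comparisons with a reference control only the adjoint of the
  reference then enters the constant.\<close>

lemma hess_ham_diff:
  assumes t: "t \<in> {0..T}"
  shows "norm (hess_ham t p (join x u) - hess_ham t p' (join x' u'))
    \<le> L * norm (p - p') + L * (1 + norm p') * (norm (x - x') + norm (u - u'))"
proof -
  let ?m = "norm (x - x') + norm (u - u')"
  have eq: "hess_ham t p (join x u) - hess_ham t p' (join x' u')
    = (\<Sum>i\<in>UNIV. (p - p') $ i *\<^sub>R hess_xu_vec b t x u $ i)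
      + ((\<Sum>i\<in>UNIV. p' $ i *\<^sub>R (hess_xu_vec b t x u - hess_xu_vec b t x' u') $ i)
      + (hess_xu f t x u - hess_xu f t x' u'))"
    unfolding hess_ham_eq[OF t]
    by (simp add: scaleR_diff_left scaleR_diff_right sum_subtractf algebra_simps)
  have "norm (hess_ham t p (join x u) - hess_ham t p' (join x' u'))
    \<le> norm (p - p') * L + (norm p' * (L * ?m) + L * ?m)"
    unfolding eq
    by (intro norm_triangle_le add_mono order_trans[OF norm_sum_scaleR_le mult_left_mono]
        standing_bounds t) auto
  then show ?thesis by (simp add: algebra_simps)
qed

lemma hess_ham_symmetric:
  assumes t: "t \<in> {0..T}" shows "transpose (hess_ham t p z) = hess_ham t p z"
  unfolding hess_ham_def
proof (rule hess_symmetric[OF twice_diff_ham[OF t]])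
  fix z z' :: "real^('n + 'm)"
  have "norm (hess_ham t p (join (xpart z) (upart z)) - hess_ham t p (join (xpart z') (upart z')))
    \<le> L * (1 + norm p) * (norm (xpart z - xpart z') + norm (upart z - upart z'))"
    using hess_ham_diff[OF t, of p "xpart z" "upart z" p "xpart z'" "upart z'"] by simp
  also have "\<dots> \<le> L * (1 + norm p) * (2 * norm (z - z'))"
    using norm_xpart_le[of "z - z'"] norm_upart_le[of "z - z'"] L_pos
    by (intro mult_left_mono) auto
  finally show "norm (hess (on_join (hamiltonian b f p t)) z - hess (on_join (hamiltonian b f p t)) z')
      \<le> (2 * (L * (1 + norm p))) * norm (z - z')"
    by (simp add: hess_ham_def algebra_simps)
qed

text \<open>Both gradients carry the same \<open>p\<close>; the Hessian varies only through (x,u),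
  so no difference of adjoints enters the remainder.\<close>

lemma grad_ham_linearization:
  assumes t: "t \<in> {0..T}"
  shows "norm (grad_ham t p (join x u) - grad_ham t p (join x' u')
      - hess_ham t p (join x u) *v (join x u - join x' u'))
    \<le> L * (1 + norm p) * (norm (x - x') + norm (u - u')) * norm (join x u - join x' u')"
  unfolding grad_ham_def hess_ham_def
proof (rule grad_linearization[OF twice_diff_ham[OF t]])
  fix \<xi> assume \<xi>: "\<xi> \<in> closed_segment (join x' u') (join x u)"
  then obtain s where s: "0 \<le> s" "s \<le> 1" "\<xi> = (1 - s) *\<^sub>R join x' u' + s *\<^sub>R join x u"
    by (auto simp: closed_segment_def)
  have d: "xpart \<xi> - x = (1 - s) *\<^sub>R (x' - x)" "upart \<xi> - u = (1 - s) *\<^sub>R (u' - u)"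
    by (simp_all add: s algebra_simps)
  have "norm (hess_ham t p (join (xpart \<xi>) (upart \<xi>)) - hess_ham t p (join x u))
    \<le> L * (1 + norm p) * (norm (xpart \<xi> - x) + norm (upart \<xi> - u))"
    using hess_ham_diff[OF t, of p "xpart \<xi>" "upart \<xi>" p x u] by simp
  also have "\<dots> \<le> L * (1 + norm p) * (norm (x - x') + norm (u - u'))"
    using s L_pos unfolding d
    by (intro mult_left_mono add_mono) (auto simp: norm_minus_commute intro: mult_left_le_one_le)
  finally show "norm (hess (on_join (hamiltonian b f p t)) \<xi> - hess (on_join (hamiltonian b f p t)) (join x u))
     \<le> L * (1 + norm p) * (norm (x - x') + norm (u - u'))"
    by (simp add: hess_ham_def)
qed

lemma grad_ham_lipschitz:
  "t \<in> {0..T} \<Longrightarrow> norm (grad_ham t p z - grad_ham t p z') \<le> L * (1 + norm p) * norm (z - z')"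
  unfolding grad_ham_def
  by (rule grad_lipschitz[OF twice_diff_ham]) (simp_all add: norm_hess_ham flip: hess_ham_def)

lemma hamiltonian_linearization:
  assumes "t \<in> {0..T}"
  shows "\<bar>hamiltonian b f p t x u - hamiltonian b f p t x' u'
      - (join x u - join x' u') \<bullet> grad_ham t p (join x' u')\<bar>
    \<le> L * (1 + norm p) * (norm (join x u - join x' u'))\<^sup>2"
  using linearization_bound[OF twice_diff_ham[OF assms], of p "L * (1 + norm p)" "join x u" "join x' u'"]
    norm_hess_ham[OF assms]
  by (simp add: grad_ham_def hess_ham_def)

lemma measurable_b_f:
  assumes x: "x \<in> borel_measurable (MT T)" and u: "u \<in> borel_measurable (MT T)"
  shows "(\<lambda>t. b t (x t) (u t)) \<in> borel_measurable (MT T)"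
    and "(\<lambda>t. f t (x t) (u t)) \<in> borel_measurable (MT T)"
proof -
  have m: "(\<lambda>(t, x, u). b t x u) \<in> borel_measurable (MT T \<Otimes>\<^sub>M borel)"
    "(\<lambda>(t, x, u). f t x u) \<in> borel_measurable (MT T \<Otimes>\<^sub>M borel)"
    using standing by (auto simp: standing_assumptions_def)
  have "(\<lambda>t. (t, x t, u t)) \<in> measurable (MT T) (MT T \<Otimes>\<^sub>M borel)"
    using x u by measurable
  from measurable_compose[OF this m(1)] measurable_compose[OF this m(2)]
  show "(\<lambda>t. b t (x t) (u t)) \<in> borel_measurable (MT T)"
    "(\<lambda>t. f t (x t) (u t)) \<in> borel_measurable (MT T)" by simp_all
qed

lemma measurable_jac:
  assumes z: "z \<in> borel_measurable (MT T)"
  shows "(\<lambda>t. jac t (z t)) \<in> borel_measurable (MT T)"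
  unfolding jac_def
proof (rule borel_measurable_vec_lambda)
  fix i
  show "(\<lambda>t. grad (\<lambda>z. on_join (b t) z $ i) (z t)) \<in> borel_measurable (MT T)"
  proof (rule borel_measurable_grad[OF _ has_derivative_grad[OF twice_diff_b] z])
    fix z :: "real \<Rightarrow> real^('n + 'm)" assume [measurable]: "z \<in> borel_measurable (MT T)"
    have "(\<lambda>t. b t (xpart (z t)) (upart (z t))) \<in> borel_measurable (MT T)"
      by (rule measurable_b_f) measurable
    from measurable_compose[OF this borel_measurable_vec_nth]
    show "(\<lambda>t. on_join (b t) (z t) $ i) \<in> borel_measurable (MT T)"
      by (simp add: on_join_def)
  qed simp
qed

lemma measurable_ham:
  assumes p: "p \<in> borel_measurable (MT T)" and z: "z \<in> borel_measurable (MT T)"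
  shows "(\<lambda>t. grad_ham t (p t) (z t)) \<in> borel_measurable (MT T)"
    and "(\<lambda>t. hess_ham t (p t) (z t)) \<in> borel_measurable (MT T)"
proof -
  have m: "(\<lambda>t. on_join (hamiltonian b f (p t) t) (z t)) \<in> borel_measurable (MT T)"
    if [measurable]: "z \<in> borel_measurable (MT T)" for z :: "real \<Rightarrow> real^('n + 'm)"
  proof -
    note [measurable] = p
    have "(\<lambda>t. b t (xpart (z t)) (upart (z t))) \<in> borel_measurable (MT T)"
      "(\<lambda>t. f t (xpart (z t)) (upart (z t))) \<in> borel_measurable (MT T)"
      by (rule measurable_b_f; measurable)+
    note [measurable] = this
    show ?thesis unfolding on_join_def hamiltonian_def by measurable
  qed
  show "(\<lambda>t. grad_ham t (p t) (z t)) \<in> borel_measurable (MT T)"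
    unfolding grad_ham_def
    by (rule borel_measurable_grad[OF m has_derivative_grad[OF twice_diff_ham] z]) simp_all
  show "(\<lambda>t. hess_ham t (p t) (z t)) \<in> borel_measurable (MT T)"
    unfolding hess_ham_def
    by (rule borel_measurable_hess[OF m twice_diff_ham z]) simp_all
qed

lemma g_symmetric: "transpose (hess g x) = hess g x"
  by (rule hess_symmetric[OF twice_diff_g g_bounds(3)])

lemma grad_g_lipschitz: "norm (grad g x - grad g x') \<le> L * norm (x - x')"
  by (rule grad_lipschitz[OF twice_diff_g g_bounds(2)])

lemma grad_g_linearization: "norm (grad g x - grad g x' - hess g x *v (x - x')) \<le> L * (norm (x - x'))\<^sup>2"
proof -
  have "norm (grad g x - grad g x' - hess g x *v (x - x')) \<le> L * norm (x - x') * norm (x - x')"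
    using order_trans[OF g_bounds(3) mult_left_mono[OF segment_bound(2)]] L_pos
    by (intro grad_linearization[OF twice_diff_g]) auto
  then show ?thesis by (simp add: power2_eq_square mult.assoc)
qed

lemma g_linearization: "\<bar>g x - g x' - (x - x') \<bullet> grad g x'\<bar> \<le> L * (norm (x - x'))\<^sup>2"
  by (rule linearization_bound[OF twice_diff_g g_bounds(2)])

end

text \<open>Restricting any solution to {0..T} makes it extensional, and Gronwall makes it the only
  candidate. The anchor \<open>s\<close> is 0 for states and T for adjoints.\<close>

lemma the_ode_solution:
  fixes F :: "real \<Rightarrow> 'a::euclidean_space \<Rightarrow> 'a"
  assumes x: "ode_solution T F x" "x s = a" and s: "s = 0 \<or> s = T" and T: "0 \<le> T" and L: "0 \<le> L"
    and lip: "\<And>t x y. t \<in> {0..T} \<Longrightarrow> norm (F t x - F t y) \<le> L * norm (x - y)"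
  shows "ode_solution T F (THE x. x \<in> extensional {0..T} \<and> ode_solution T F x \<and> x s = a)"
    and "(THE x. x \<in> extensional {0..T} \<and> ode_solution T F x \<and> x s = a) s = a"
proof -
  let ?P = "\<lambda>x. x \<in> extensional {0..T} \<and> ode_solution T F x \<and> x s = a"
  have "ode_solution T F (restrict x {0..T})"
    by (rule ode_solution_cong[OF x(1)]) (use T in auto)
  moreover have sT: "s \<in> {0..T}" using s T by (elim disjE) simp_all
  then have "restrict x {0..T} s = a" unfolding x(2)[symmetric] by (rule restrict_apply')
  ultimately have "?P (restrict x {0..T})" by (intro conjI restrict_extensional)
  moreover have "y = restrict x {0..T}" if "?P y" for y
  proof (rule extensionalityI[of _ "{0..T}"])
    let ?r = "restrict x {0..T}"
    have y: "ode_solution T F y" and "y s = a" and r: "ode_solution T F ?r" and "?r s = a"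
      using \<open>?P y\<close> \<open>?P ?r\<close> by blast+
    then have eq: "y 0 = ?r 0 \<or> y T = ?r T" using s by metis
    show "y t = ?r t" if "t \<in> {0..T}" for t
      by (rule ode_solution_unique[OF y r L _ eq that]) (rule lip)
  qed (use that in blast)+
  ultimately have "?P (THE x. ?P x)" by (rule theI)
  then show "ode_solution T F (THE x. ?P x)" "(THE x. ?P x) s = a" by blast+
qed

section \<open>States, adjoints and their dependence on the control\<close>

context control_problem
begin

abbreviation "X u \<equiv> state T b x0 u"
abbreviation "P u \<equiv> adjoint_state T b f g x0 u"
abbreviation "Z u t \<equiv> join (X u t) (u t)"
abbreviation "lqD u t \<equiv> jac t (Z u t)"
abbreviation "lqQ u t \<equiv> hess_ham t (P u t) (Z u t)"
abbreviation "lqG u \<equiv> hess g (X u T)"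
abbreviation "W u \<equiv> 1 + norm_L1 T u"

lemma b_lipschitz_x: "t \<in> {0..T} \<Longrightarrow> norm (b t x u - b t y u) \<le> L * norm (x - y)"
  using b_lipschitz[of t x u y u] norm_join_le[of "x - y" "0::real^'m"] L_pos
  by (smt (verit) diff_self join_diff mult_left_mono norm_zero)

lemma
  assumes u: "u \<in> L2 T"
  shows state_ode: "ode_solution T (\<lambda>t x. b t x (u t)) (X u)" and state_0: "X u 0 = x0"
proof -
  note [measurable] = L2_measurable[OF u]
  have i: "integrable (MT T) (\<lambda>t. L * (norm (u t) + 1))"
    by (intro integrable_mult_right Bochner_Integration.integrable_add L2_norm_integrable u) simp
  have "integrable (MT T) (\<lambda>t. b t 0 (u t))"
  proof (rule Bochner_Integration.integrable_bound[OF i])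
    show "(\<lambda>t. b t 0 (u t)) \<in> borel_measurable (MT T)" by (rule measurable_b_f) measurable
    show "AE t in MT T. norm (b t 0 (u t)) \<le> norm (L * (norm (u t) + 1))"
      using standing_bounds(1)[of _ 0] L_pos by (intro AE_MT_I) (simp add: abs_of_nonneg)
  qed
  then obtain x where x: "ode_solution T (\<lambda>t x. b t x (u t)) x" "x 0 = x0"
    using ode_solution_exists[OF T_pos less_imp_le[OF L_pos], of "\<lambda>t x. b t x (u t)" x0]
      measurable_b_f(1)[OF _ L2_measurable[OF u]] b_lipschitz_x by auto
  show "ode_solution T (\<lambda>t x. b t x (u t)) (X u)" "X u 0 = x0"
    unfolding state_def
    by (rule the_ode_solution[where x = x and L = L and T = T]; use x T_pos L_pos b_lipschitz_x in auto)+
qed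

lemma state_continuous: "u \<in> L2 T \<Longrightarrow> continuous_on {0..T} (X u)"
  by (rule ode_solution_continuous[OF state_ode])

lemma Z_measurable: "u \<in> L2 T \<Longrightarrow> Z u \<in> borel_measurable (MT T)"
  by (intro borel_measurable_join continuous_measurable_MT state_continuous L2_measurable)

text \<open>In Gronwall's bound the constant part is the first entry of the maximum in
  \<open>C_x\<close>, and the coefficient of the L1 norm is the second.\<close>

lemma norm_state:
  assumes u: "u \<in> L2 T" and t: "t \<in> {0..T}"
  shows "norm (X u t) \<le> cx * W u"
proof -
  have "norm (X u t) \<le> exp (L * T) * (norm (X u 0) + (LINT s|MT T. L * (norm (u s) + 1)))"
  proof (rule ode_bound_forward[OF state_ode[OF u] _ _ _ _ _ t])
    show "AE s in MT T. norm (b s (X u s) (u s)) \<le> L * norm (X u s) + L * (norm (u s) + 1)"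
    proof (rule AE_MT_I)
      fix s assume "s \<in> {0..T}"
      then show "norm (b s (X u s) (u s)) \<le> L * norm (X u s) + L * (norm (u s) + 1)"
        using standing_bounds(1)[of s "X u s" "u s"] by (simp add: algebra_simps)
    qed
    show "integrable (MT T) (\<lambda>t. L * (norm (u t) + 1))"
      by (intro integrable_mult_right Bochner_Integration.integrable_add L2_norm_integrable u) simp
  qed (use L_pos T_pos in auto)
  also have "\<dots> = exp (L * T) * (norm x0 + L * T) + l * norm_L1 T u"
    using T_pos L2_norm_integrable[OF u] by (simp add: state_0[OF u] norm_L1_def algebra_simps)
  also have "\<dots> \<le> cx * 1 + cx * norm_L1 T u"
    by (intro add_mono mult_right_mono l_le_cx) (simp_all add: C_x_def)
  finally show ?thesis by (simp add: algebra_simps)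
qed

lemma state_diff:
  assumes u: "u \<in> L2 T" and w: "w \<in> L2 T" and t: "t \<in> {0..T}"
  shows "norm (X u t - X w t) \<le> l * norm_L1 T (\<lambda>t. u t - w t)"
proof -
  note d = L2_diff[OF u w]
  have sol: "ode_solution T (\<lambda>t _. b t (X u t) (u t) - b t (X w t) (w t)) (\<lambda>t. X u t - X w t)"
    by (rule ode_solution_diff[OF state_ode[OF u] state_ode[OF w]]) simp
  have "norm (X u t - X w t) \<le> exp (L * T) * (norm (X u 0 - X w 0) + (LINT s|MT T. L * norm (u s - w s)))"
  proof (rule ode_bound_forward[OF sol _ _ _ _ _ t])
    show "AE s in MT T. norm (b s (X u s) (u s) - b s (X w s) (w s))
        \<le> L * norm (X u s - X w s) + L * norm (u s - w s)"
    proof (rule AE_MT_I)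
      fix s assume "s \<in> {0..T}"
      then have "norm (b s (X u s) (u s) - b s (X w s) (w s)) \<le> L * norm (join (X u s - X w s) (u s - w s))"
        unfolding join_diff by (rule b_lipschitz)
      also have "\<dots> \<le> L * (norm (X u s - X w s) + norm (u s - w s))"
        using L_pos by (intro mult_left_mono norm_join_le) simp
      finally show "norm (b s (X u s) (u s) - b s (X w s) (w s)) \<le> L * norm (X u s - X w s) + L * norm (u s - w s)"
        by (simp add: distrib_left)
    qed
  qed (use L_pos T_pos L2_norm_integrable[OF d] in auto)
  then show ?thesis
    by (simp add: state_0[OF u] state_0[OF w] norm_L1_def algebra_simps)
qed

lemma grad_ham_diff_adjoint:
  assumes t: "t \<in> {0..T}"
  shows "grad_ham t p z - grad_ham t q z = transpose (jac t z) *v (p - q)"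
  by (simp add: grad_ham_eq[OF t] matrix_vector_mult_diff_distrib)

lemma norm_jac_transpose: "t \<in> {0..T} \<Longrightarrow> norm (transpose (jac t z) *v p) \<le> L * norm p"
  by (rule order_trans[OF norm_transpose_vector_le mult_right_mono[OF norm_jac]]) auto

text \<open>The equation is affine in \<open>p\<close> with the value of \<open>grad_ham\<close> at
  p = 0 as source, so the boundary value lemma with identity boundary maps gives existence. The form
  with \<open>grad_ham\<close> is the one used by all later estimates.\<close>

lemma
  assumes u: "u \<in> L2 T"
  shows adjoint_ode: "ode_solution T (\<lambda>t p. - xpart (grad_ham t p (Z u t))) (P u)"
    and adjoint_T: "P u T = grad g (X u T)"
proof -
  let ?A = "\<lambda>t p. - xpart (transpose (lqD u t) *v p)"
  let ?c = "\<lambda>t. - xpart (grad (on_join (f t)) (Z u t))"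
  let ?F = "\<lambda>t p. - (transpose (jac_x b t (X u t) (u t)) *v p) - grad_x f t (X u t) (u t)"
  note [measurable] = measurable_jac[OF Z_measurable[OF u]]
  have F: "?F t p = - xpart (grad_ham t p (Z u t))" if "t \<in> {0..T}" for t p
    by (rule grad_x_adjoint[OF that])
  have lin: "linear (?A t)" for t
    by (intro linearI) (simp_all add: matrix_vector_right_distrib matrix_vector_mult_scaleR)
  have bnd: "norm (?A t p) \<le> L * norm p" if "t \<in> {0..T}" for t p
    using order_trans[OF norm_xpart_le norm_jac_transpose[OF that]] by simp
  have meas: "(\<lambda>t. ?A t (p t)) \<in> borel_measurable (MT T)"
    if [measurable]: "p \<in> borel_measurable (MT T)" for p by measurable
  have L0: "0 \<le> L" using L_pos by simp
  have "(\<lambda>t. grad_ham t 0 (Z u t)) \<in> borel_measurable (MT T)"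
    by (rule measurable_ham(1)[OF _ Z_measurable[OF u]]) simp
  then have gm: "(\<lambda>t. - xpart (grad_ham t 0 (Z u t))) \<in> borel_measurable (MT T)" by measurable
  have c: "integrable (MT T) (\<lambda>t. - xpart (grad_ham t 0 (Z u t)))"
  proof (rule Bochner_Integration.integrable_bound[OF _ gm])
    show "integrable (MT T) (\<lambda>t. L * (cx * W u + norm (u t) + 1))"
      by (intro integrable_mult_right Bochner_Integration.integrable_add L2_norm_integrable u) simp_all
    show "AE t in MT T. norm (- xpart (grad_ham t 0 (Z u t))) \<le> norm (L * (cx * W u + norm (u t) + 1))"
    proof (rule AE_MT_I)
      fix t assume t: "t \<in> {0..T}"
      have "norm (- xpart (grad_ham t 0 (Z u t))) \<le> L * (norm (X u t) + norm (u t) + 1)"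
        using order_trans[OF norm_xpart_le norm_grad_f[OF t]] by (simp add: grad_ham_eq[OF t])
      also have "\<dots> \<le> L * (cx * W u + norm (u t) + 1)"
        using norm_state[OF u t] L_pos by (intro mult_left_mono add_mono) auto
      finally show "norm (- xpart (grad_ham t 0 (Z u t))) \<le> norm (L * (cx * W u + norm (u t) + 1))"
        by simp
    qed
  qed
  have id: "linear (\<lambda>x. x :: real^'n)" by (simp add: linear_iff)
  obtain p \<xi> where p: "ode_solution T (\<lambda>t p. ?A t p + - xpart (grad_ham t 0 (Z u t))) p" "p T = grad g (X u T)"
  proof (rule linear_boundary_value_problem[OF T_pos L0 lin bnd meas c id id, where d = "grad g (X u T)"])
    fix z \<xi> assume z: "ode_solution T ?A z" "z 0 = \<xi>" "z T = 0"
    have "norm (z 0) \<le> exp (L * T) * (norm (z T) + (LINT s|MT T. 0))"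
      by (rule ode_bound_backward[OF z(1) L0]) (use T_pos bnd in \<open>auto intro!: AE_MT_I\<close>)
    then show "\<xi> = 0" using z by simp
  qed auto
  have pF: "ode_solution T ?F p"
    by (rule ode_solution_cong[OF p(1)]) (use T_pos in \<open>simp_all add: F grad_ham_eq\<close>)
  have lip: "norm (?F t q - ?F t q') \<le> L * norm (q - q')" if "t \<in> {0..T}" for t q q'
    using order_trans[OF norm_xpart_le norm_jac_transpose[OF that]]
    unfolding F[OF that]
    by (simp add: norm_minus_commute grad_ham_diff_adjoint[OF that] flip: parts_diff)
  have P: "P u = (THE p. p \<in> extensional {0..T} \<and> ode_solution T ?F p \<and> p T = grad g (X u T))"
    by (simp only: adjoint_state_def Let_def)
  have "ode_solution T ?F (P u)" "P u T = grad g (X u T)"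
    unfolding P
    by (rule the_ode_solution[where x = p and L = L and T = T]; use pF p(2) T_pos L0 lip in auto)+
  then show "ode_solution T (\<lambda>t p. - xpart (grad_ham t p (Z u t))) (P u)" "P u T = grad g (X u T)"
    using ode_solution_cong[of T ?F "P u" "\<lambda>t p. - xpart (grad_ham t p (Z u t))" "P u"] F T_pos by auto
qed

lemma adjoint_continuous: "u \<in> L2 T \<Longrightarrow> continuous_on {0..T} (P u)"
  by (rule ode_solution_continuous[OF adjoint_ode])

lemma norm_adjoint:
  assumes u: "u \<in> L2 T" and t: "t \<in> {0..T}"
  shows "norm (P u t) \<le> kp * W u"
proof -
  let ?r = "\<lambda>s. L * (cx * W u + norm (u s) + 1)"
  have i: "integrable (MT T) ?r"
    by (intro integrable_mult_right Bochner_Integration.integrable_add L2_norm_integrable u) simp_all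
  have "norm (P u t) \<le> exp (L * T) * (norm (P u T) + (LINT s|MT T. ?r s))"
  proof (rule ode_bound_backward[OF adjoint_ode[OF u] _ _ _ i _ t])
    show "AE s in MT T. norm (- xpart (grad_ham s (P u s) (Z u s))) \<le> L * norm (P u s) + ?r s"
    proof (rule AE_MT_I)
      fix s assume s: "s \<in> {0..T}"
      have "norm (grad_ham s (P u s) (Z u s)) \<le> L * norm (P u s) + L * (norm (X u s) + norm (u s) + 1)"
        unfolding grad_ham_eq[OF s]
        by (intro norm_triangle_le add_mono norm_jac_transpose norm_grad_f s)
      also have "\<dots> \<le> L * norm (P u s) + ?r s"
        using norm_state[OF u s] L_pos by (intro add_left_mono mult_left_mono add_mono) auto
      finally show "norm (- xpart (grad_ham s (P u s) (Z u s))) \<le> L * norm (P u s) + ?r s"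
        using order_trans[OF norm_xpart_le] by (simp del: parts_minus)
    qed
    show "AE s in MT T. 0 \<le> ?r s"
      using L_pos cx_pos by (intro AE_I2 mult_nonneg_nonneg add_nonneg_nonneg) auto
  qed (use L_pos T_pos in auto)
  also have "(LINT s|MT T. ?r s) = L * (T * (cx * W u) + norm_L1 T u + T)"
    using T_pos L2_norm_integrable[OF u] by (simp add: norm_L1_def algebra_simps)
  also have "norm (P u T) \<le> L * (cx * W u + 1)"
    using g_bounds(1)[of "X u T"] norm_state[OF u, of T] L_pos T_pos
    by (smt (verit) adjoint_T[OF u] atLeastAtMost_iff mult_left_mono)
  \<comment> \<open>The product form in \<open>K_p\<close> exceeds this sum by exactly L T times the
    L1 norm of \<open>u\<close>.\<close>
  also have "L * (cx * W u + 1) + L * (T * (cx * W u) + norm_L1 T u + T)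
     \<le> L * ((1 + cx) * (T + 1) * W u)"
  proof -
    have "L * ((1 + cx) * (T + 1) * W u)
        = L * (cx * W u + 1) + L * (T * (cx * W u) + norm_L1 T u + T) + L * (T * norm_L1 T u)"
      by (simp add: algebra_simps)
    moreover have "0 \<le> L * (T * norm_L1 T u)" using L_pos T_pos by simp
    ultimately show ?thesis by linarith
  qed
  finally show ?thesis
    by (simp add: K_p_def mult_ac)
qed

text \<open>The difference of right-hand sides is split so that the Jacobian along \<open>u\<close>,
  bounded by L, acts on the difference of adjoints, while Lipschitz continuity is used at the
  adjoint of \<open>w\<close>. Thus only \<open>W w\<close> occurs.\<close>

lemma adjoint_diff:
  assumes u: "u \<in> L2 T" and w: "w \<in> L2 T" and t: "t \<in> {0..T}"
  defines "N \<equiv> norm_L1 T (\<lambda>t. u t - w t)"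
  shows "norm (P u t - P w t) \<le> exp (L * T) * (L * (l * N) + L * (1 + kp) * W w * ((l * T + 1) * N))"
proof -
  note d = L2_diff[OF u w]
  have N0: "0 \<le> N" by (simp add: N_def)
  let ?r = "\<lambda>s. L * (1 + kp) * W w * (l * N + norm (u s - w s))"
  have i: "integrable (MT T) ?r"
    by (intro integrable_mult_right Bochner_Integration.integrable_add L2_norm_integrable d) simp_all
  have sol: "ode_solution T (\<lambda>t _. - xpart (grad_ham t (P u t) (Z u t)) - (- xpart (grad_ham t (P w t) (Z w t))))
      (\<lambda>t. P u t - P w t)"
    by (rule ode_solution_diff[OF adjoint_ode[OF u] adjoint_ode[OF w]]) simp
  have "norm (P u t - P w t) \<le> exp (L * T) * (norm (P u T - P w T) + (LINT s|MT T. ?r s))"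
  proof (rule ode_bound_backward[OF sol _ _ _ i _ t])
    show "AE s in MT T. norm (- xpart (grad_ham s (P u s) (Z u s)) - (- xpart (grad_ham s (P w s) (Z w s))))
        \<le> L * norm (P u s - P w s) + ?r s"
    proof (rule AE_MT_I)
      fix s assume s: "s \<in> {0..T}"
      have eq: "grad_ham s (P u s) (Z u s) - grad_ham s (P w s) (Z w s)
        = transpose (lqD u s) *v (P u s - P w s) + (grad_ham s (P w s) (Z u s) - grad_ham s (P w s) (Z w s))"
        by (simp flip: grad_ham_diff_adjoint[OF s])
      have "norm (grad_ham s (P u s) (Z u s) - grad_ham s (P w s) (Z w s))
        \<le> L * norm (P u s - P w s) + L * (1 + norm (P w s)) * norm (Z u s - Z w s)"
        unfolding eq by (intro norm_triangle_le add_mono norm_jac_transpose grad_ham_lipschitz s)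
      also have "\<dots> \<le> L * norm (P u s - P w s) + ?r s"
      proof (rule add_left_mono, rule mult_mono)
        have "1 * 1 + norm (P w s) \<le> 1 * W w + kp * W w"
          by (intro add_mono norm_adjoint[OF w s]) simp
        then have "L * (1 + norm (P w s)) \<le> L * ((1 + kp) * W w)"
          using L_pos by (intro mult_left_mono) (auto simp: distrib_right)
        then show "L * (1 + norm (P w s)) \<le> L * (1 + kp) * W w" by (simp add: mult.assoc)
        show "norm (Z u s - Z w s) \<le> l * N + norm (u s - w s)"
          using norm_join_le[of "X u s - X w s" "u s - w s"] state_diff[OF u w s]
          by (simp add: N_def join_diff)
      qed (use L_pos kp_pos in auto)
      finally have "norm (grad_ham s (P u s) (Z u s) - grad_ham s (P w s) (Z w s)) \<le> L * norm (P u s - P w s) + ?r s" .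
      then show "norm (- xpart (grad_ham s (P u s) (Z u s)) - (- xpart (grad_ham s (P w s) (Z w s))))
          \<le> L * norm (P u s - P w s) + ?r s"
        using order_trans[OF norm_xpart_le, of "grad_ham s (P u s) (Z u s) - grad_ham s (P w s) (Z w s)"]
        by (simp add: norm_minus_commute)
    qed
    show "AE s in MT T. 0 \<le> ?r s"
      using L_pos kp_pos N0 by (intro AE_I2 mult_nonneg_nonneg add_nonneg_nonneg) auto
  qed (use L_pos T_pos in auto)
  also have "(LINT s|MT T. ?r s) = L * (1 + kp) * W w * ((l * T + 1) * N)"
  proof -
    have "(LINT s|MT T. l * N + norm (u s - w s)) = (l * T + 1) * N"
      using T_pos L2_norm_integrable[OF d] by (simp add: N_def norm_L1_def algebra_simps)
    then show ?thesis by (simp only: integral_mult_right_zero)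
  qed
  also have "norm (P u T - P w T) \<le> L * (l * N)"
    unfolding adjoint_T[OF u] adjoint_T[OF w] N_def
    using L_pos T_pos by (intro order_trans[OF grad_g_lipschitz mult_left_mono[OF state_diff[OF u w]]]) auto
  finally show ?thesis by simp
qed

text \<open>One estimate relaxed in two ways: to \<open>cp\<close>, by \<open>l\<close> \<le>
  \<open>cx\<close>, for differences of Hessians and gradients, and to \<open>kpsi\<close>, the
  factor that \<open>perturbation_estimate\<close> expects in front of the Jacobian
  difference.\<close>

lemma
  assumes u: "u \<in> L2 T" and w: "w \<in> L2 T" and t: "t \<in> {0..T}"
  defines "N \<equiv> norm_L1 T (\<lambda>t. u t - w t)"
  shows adjoint_diff_cp: "norm (P u t - P w t) \<le> cp * W w * N"
    and adjoint_diff_kpsi: "norm (P u t - P w t) \<le> kpsi * W w * N"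
proof -
  have N0: "0 \<le> N" and W1: "1 \<le> W w" by (simp_all add: N_def)
  note pos = L_pos T_pos l_pos kp_pos cx_pos c1_pos
  have A: "L * (l * N) \<le> L * l * W w * N"
    using mult_left_mono[OF W1, of "L * l * N"] pos N0 by (simp add: mult_ac)
  have "norm (P u t - P w t) \<le> exp (L * T) * (L * (l * N) + L * (1 + kp) * W w * ((l * T + 1) * N))"
    unfolding N_def by (rule adjoint_diff[OF u w t])
  also have "\<dots> \<le> exp (L * T) * (L * l * W w * N + L * (1 + kp) * W w * ((l * T + 1) * N))"
    using A by simp
  finally have *: "norm (P u t - P w t) \<le> exp (L * T) * (L * l + L * (1 + kp) * (l * T + 1)) * (W w * N)"
    by (simp add: algebra_simps)
  have "exp (L * T) * (L * l + L * (1 + kp) * (l * T + 1)) \<le> exp (L * T) * (L * cx + L * (1 + kp) * (cx * T + 1))"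
    using l_le_cx pos by (intro mult_left_mono add_mono) auto
  also have "\<dots> \<le> cp"
    by (simp add: C_p_def algebra_simps)
  finally show "norm (P u t - P w t) \<le> cp * W w * N"
    using * N0 W1 by (smt (verit) mult.assoc mult_nonneg_nonneg mult_right_mono)
  have "L * (1 + kp) \<le> c1"
    using c1_ge(4) kp_le_cp L_pos by (smt (verit) mult_left_mono)
  then have "exp (L * T) * (L * l + L * (1 + kp) * (l * T + 1)) \<le> exp (L * T) * (L * l + c1 * (l * T + 1))"
    using pos by (intro mult_left_mono add_mono mult_right_mono) auto
  also have "\<dots> \<le> kpsi" by (rule kpsi_ge)
  finally show "norm (P u t - P w t) \<le> kpsi * W w * N"
    using * N0 W1 by (smt (verit) mult.assoc mult_nonneg_nonneg mult_right_mono)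
qed

lemma cp_W_le: "1 \<le> V \<Longrightarrow> L * (1 + cp * V) \<le> c1 * V"
proof -
  assume V: "1 \<le> V"
  have "L * (1 + cp * V) \<le> L * (V + cp * V)" using V L_pos by (intro mult_left_mono) auto
  also have "\<dots> = L * (1 + cp) * V" by (simp add: algebra_simps)
  also have "\<dots> \<le> c1 * V" using V by (intro mult_right_mono c1_ge) auto
  finally show ?thesis .
qed

lemma norm_adjoint_cp: "u \<in> L2 T \<Longrightarrow> t \<in> {0..T} \<Longrightarrow> norm (P u t) \<le> cp * W u"
  by (rule order_trans[OF norm_adjoint mult_right_mono[OF kp_le_cp]]) auto

lemma norm_lqQ:
  assumes "u \<in> L2 T" "t \<in> {0..T}"
  shows "norm (lqQ u t) \<le> c1 * W u"
proof -
  have "norm (lqQ u t) \<le> L * (1 + norm (P u t))" by (rule norm_hess_ham[OF assms(2)])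
  also have "\<dots> \<le> L * (1 + cp * W u)"
    using norm_adjoint_cp[OF assms] L_pos by (intro mult_left_mono) auto
  also have "\<dots> \<le> c1 * W u" by (rule cp_W_le) simp
  finally show ?thesis .
qed

lemma lq_problem_at:
  assumes u: "u \<in> L2 T"
  shows "lq_problem T L (c1 * W u) (lqD u) (lqQ u) (lqG u)"
proof
  show "lqD u \<in> borel_measurable (MT T)" by (rule measurable_jac[OF Z_measurable[OF u]])
  show "lqQ u \<in> borel_measurable (MT T)"
    by (rule measurable_ham(2)[OF continuous_measurable_MT[OF adjoint_continuous[OF u]] Z_measurable[OF u]])
qed (use T_pos L_pos c1_pos norm_jac norm_lqQ[OF u] g_bounds(2) hess_ham_symmetric g_symmetric in auto)

end

text \<open>Bridges the chosen \<open>linearized_state\<close> and relational solutions, which agree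
  with it only on {0..T}.\<close>

lemma (in lq_problem) bil_cong:
  assumes "\<And>t. t \<in> {0..T} \<Longrightarrow> y t = y' t"
  shows "bil v y v y = bil v y' v y'"
proof -
  have "(LINT t|MT T. join (y t) (v t) \<bullet> (Q t *v join (y t) (v t)))
      = (LINT t|MT T. join (y' t) (v t) \<bullet> (Q t *v join (y' t) (v t)))"
    by (rule Bochner_Integration.integral_cong) (use assms in auto)
  then show ?thesis using assms[of T] T_pos by (simp add: bil_def)
qed

section \<open>Comparison of second derivatives and Taylor expansion of the gradient\<close>

context control_problem
begin

text \<open>\<open>J1 u\<close> is the gradient \<open>J'(u)\<close>, and \<open>J2 u v y \<psi>\<close> is \<open>J''(u) v\<close> whenever \<open>y\<close> and \<open>\<psi>\<close> solve the
  linearized state and adjoint equations, \<open>lst u v y\<close> and \<open>lad u v y \<psi>\<close>.\<close>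

abbreviation "lst u \<equiv> lq_problem.lin_state T (lqD u)"
abbreviation "lad u \<equiv> lq_problem.lin_adjoint T (lqD u) (lqQ u) (lqG u)"
abbreviation "J2 u \<equiv> lq_problem.second_var (lqD u) (lqQ u)"
abbreviation "J1 \<equiv> cost_gradient T b f g x0"

lemma cost_gradient_eq: "t \<in> {0..T} \<Longrightarrow> J1 u t = upart (grad_ham t (P u t) (Z u t))"
  by (simp add: cost_gradient_def grad_u_hamiltonian)

lemma cost_gradient_measurable:
  assumes u: "u \<in> L2 T" shows "J1 u \<in> borel_measurable (MT T)"
proof -
  have "(\<lambda>t. grad_ham t (P u t) (Z u t)) \<in> borel_measurable (MT T)"
    by (rule measurable_ham(1)[OF continuous_measurable_MT[OF adjoint_continuous[OF u]] Z_measurable[OF u]])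
  then have "(\<lambda>t. upart (grad_ham t (P u t) (Z u t))) \<in> borel_measurable (MT T)" by measurable
  then show ?thesis
    by (rule measurable_cong[THEN iffD2, rotated]) (simp add: cost_gradient_eq)
qed

lemma linearized_state_lin_state:
  assumes u: "u \<in> L2 T" and v: "v \<in> L2 T"
  shows "lst u v (linearized_state T b x0 u v)"
proof -
  interpret lq: lq_problem T L "c1 * W u" "lqD u" "lqQ u" "lqG u" by (rule lq_problem_at[OF u])
  let ?F = "\<lambda>t y. jac_x b t (X u t) (u t) *v y + jac_u b t (X u t) (u t) *v v t"
  obtain y where y: "lst u v y" using lq.lin_state_exists[OF v] by blast
  have F: "?F t y = lqD u t *v join y (v t)" if "t \<in> {0..T}" for t y
    by (rule jac_join[OF that])
  have yF: "ode_solution T ?F y" "y 0 = 0"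
    using y T_pos ode_solution_cong[of T "\<lambda>t y. lqD u t *v join y (v t)" y ?F y]
    by (auto simp: lq.lin_state_def F)
  have lip: "norm (?F t p - ?F t q) \<le> L * norm (p - q)" if "t \<in> {0..T}" for t p q
    unfolding F[OF that] by (rule lq.lin_state_lipschitz[OF that])
  have def: "linearized_state T b x0 u v
      = (THE y. y \<in> extensional {0..T} \<and> ode_solution T ?F y \<and> y 0 = 0)"
    by (simp only: linearized_state_def Let_def)
  have "ode_solution T ?F (linearized_state T b x0 u v)" "linearized_state T b x0 u v 0 = 0"
    unfolding def
    by (rule the_ode_solution[where x = y and L = L and T = T]; use yF T_pos L_pos lip in auto)+
  then show ?thesis
    unfolding lq.lin_state_def
    using ode_solution_cong[of T ?F _ "\<lambda>t y. lqD u t *v join y (v t)"] F T_pos by auto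
qed

lemma coercive_at_lq:
  assumes u: "u \<in> L2 T" and co: "coercive_at T b f g x0 u a"
  shows "lq_problem.coercive T (lqD u) (lqQ u) (lqG u) a"
proof -
  interpret lq: lq_problem T L "c1 * W u" "lqD u" "lqQ u" "lqG u" by (rule lq_problem_at[OF u])
  show ?thesis
    unfolding lq.coercive_def
  proof (intro allI impI)
    fix v y assume v: "v \<in> L2 T" and y: "lq.lin_state v y"
    let ?y = "linearized_state T b x0 u v"
    have "a * (norm_L2 T v)\<^sup>2 \<le> lq.bil v ?y v ?y"
      using co v by (simp add: coercive_at_def hamiltonian_quadratic_def terminal_quadratic_def
          lq.bil_def Let_def hess_xu_hamiltonian)
    also have "\<dots> = lq.bil v y v y"
      by (rule lq.bil_cong[OF lq.lin_state_unique[OF linearized_state_lin_state[OF u v] y]])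
    finally show "a * (norm_L2 T v)\<^sup>2 \<le> lq.bil v y v y" .
  qed
qed

lemma newton_objective_lq:
  "newton_objective T b f g x0 u v
    = lq_problem.lq_cost T (lqQ u) (lqG u) (J1 u) v (linearized_state T b x0 u v)"
  if u: "u \<in> L2 T"
proof -
  interpret lq: lq_problem T L "c1 * W u" "lqD u" "lqQ u" "lqG u" by (rule lq_problem_at[OF u])
  show ?thesis
    by (simp add: newton_objective_def hamiltonian_quadratic_def terminal_quadratic_def
        lq.lq_cost_def Let_def hess_xu_hamiltonian)
qed

text \<open>The last estimate explains \<open>C_H\<close>: its first entry, taken T times, collects
  the effect of the differences of adjoints and states, its second entry that of the difference of
  the controls themselves.\<close>

lemma state_control_diff:
  assumes u: "u \<in> L2 T" and w: "w \<in> L2 T" and e: "AE t in MT T. norm (u t - w t) \<le> e"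
  defines "N \<equiv> norm_L1 T (\<lambda>t. u t - w t)"
  shows "N \<le> T * e" and "0 \<le> e"
    and "\<And>t. t \<in> {0..T} \<Longrightarrow> norm (X u t - X w t) \<le> c1 * T * e"
    and "AE t in MT T. norm (X u t - X w t) + norm (u t - w t) \<le> (c1 * T + 1) * e"
    and "AE t in MT T. norm (lqD u t - lqD w t) \<le> L * ((c1 * T + 1) * e)"
    and "AE t in MT T. norm (lqQ u t - lqQ w t) \<le> c1 * (T + 1) * W w * e"
proof -
  note d = L2_diff[OF u w]
  show e0: "0 \<le> e"
    by (rule AE_MT_const[OF T_pos], use e in eventually_elim) (meson norm_ge_zero order_trans)
  show N: "N \<le> T * e"
    unfolding N_def using T_pos by (intro norm_L1_le[OF e L2_measurable[OF d]]) simp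
  have dX: "norm (X u t - X w t) \<le> cx * (T * e)" if "t \<in> {0..T}" for t
    using state_diff[OF u w that] N e0 l_pos l_le_cx T_pos
    by (smt (verit) N_def mult_mono mult_nonneg_nonneg norm_L1_nonneg)
  show X: "norm (X u t - X w t) \<le> c1 * T * e" if "t \<in> {0..T}" for t
    using order_trans[OF dX[OF that] mult_right_mono[OF c1_ge(1)]] T_pos e0 by (simp add: mult_ac)
  show m: "AE t in MT T. norm (X u t - X w t) + norm (u t - w t) \<le> (c1 * T + 1) * e"
    using e AE_space
  proof eventually_elim
    case (elim t)
    then show ?case using X[of t] by (simp add: algebra_simps)
  qed
  show "AE t in MT T. norm (lqD u t - lqD w t) \<le> L * ((c1 * T + 1) * e)"
    using m AE_space
  proof eventually_elim
    case (elim t)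
    then have t: "t \<in> {0..T}" by simp
    have "norm (lqD u t - lqD w t) \<le> L * norm (join (X u t - X w t) (u t - w t))"
      unfolding join_diff by (rule jac_lipschitz[OF t])
    also have "\<dots> \<le> L * ((c1 * T + 1) * e)"
      using norm_join_le[of "X u t - X w t" "u t - w t"] elim(1) L_pos by (intro mult_left_mono) auto
    finally show ?case .
  qed
  show "AE t in MT T. norm (lqQ u t - lqQ w t) \<le> c1 * (T + 1) * W w * e"
    using e AE_space
  proof eventually_elim
    case (elim t)
    then have t: "t \<in> {0..T}" by simp
    have "norm (lqQ u t - lqQ w t) \<le> L * norm (P u t - P w t)
        + L * (1 + norm (P w t)) * (norm (X u t - X w t) + norm (u t - w t))"
      by (rule hess_ham_diff[OF t])
    also have "\<dots> \<le> L * (cp * W w * (T * e)) + L * (1 + cp * W w) * (cx * (T * e) + e)"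
    proof (intro add_mono mult_mono mult_left_mono)
      show "norm (P u t - P w t) \<le> cp * W w * (T * e)"
        using adjoint_diff_cp[OF u w t] N cp_pos
        by (smt (verit) N_def mult_left_mono mult_nonneg_nonneg norm_L1_nonneg)
    qed (use L_pos T_pos norm_adjoint_cp[OF w t] dX[OF t] elim(1) cp_pos in auto)
    also have "\<dots> \<le> L * (cp * W w * (T * e)) + (L * (1 + cp) * W w) * (cx * (T * e) + e)"
    proof (intro add_left_mono mult_right_mono)
      have "1 + cp * W w \<le> (1 + cp) * W w" by (simp add: distrib_right)
      then show "L * (1 + cp * W w) \<le> L * (1 + cp) * W w" using L_pos by (simp add: mult.assoc)
    qed (use cx_pos T_pos e0 in auto)
    also have "\<dots> = (T * (L * (cp + cx + cp * cx)) + L * (1 + cp)) * (W w * e)"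
      by (simp add: algebra_simps)
    also have "\<dots> \<le> (T * c1 + c1) * (W w * e)"
      using T_pos e0 by (intro mult_right_mono add_mono mult_left_mono c1_ge) auto
    finally show ?case by (simp add: algebra_simps)
  qed
qed

lemma second_var_diff:
  assumes u: "u \<in> L2 T" and w: "w \<in> L2 T" and e: "AE t in MT T. norm (u t - w t) \<le> e"
    and v: "v \<in> L2 T" and y: "lst u v y" "lad u v y \<psi>" and y': "lst w v y'" "lad w v y' \<psi>'"
  shows "AE t in MT T. norm (J2 u v y \<psi> t - J2 w v y' \<psi>' t)
    \<le> W w * e * (m3 * norm_L1 T v) + c1 * (T + 1) * W w * e * norm (v t)"
proof -
  interpret u: lq_problem T L "c1 * W u" "lqD u" "lqQ u" "lqG u" by (rule lq_problem_at[OF u])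
  interpret w: lq_problem T L "c1 * W w" "lqD w" "lqQ w" "lqG w" by (rule lq_problem_at[OF w])
  note diff = state_control_diff[OF u w e]
  note pos = T_pos L_pos l_pos c1_pos kpsi_pos diff(2)
  define N where "N = norm_L1 T v"
  have N0: "0 \<le> N" by (simp add: N_def)
  define h where "h = c1 * (T + 1) * W w * e"
  have h0: "0 \<le> h" using pos by (simp add: h_def)
  define A where "A = L * (c1 * T + 1) * e"
  have A0: "0 \<le> A" using pos by (simp add: A_def)
  have ny: "norm (y t) \<le> l * N" "norm (y' t) \<le> l * N" if "t \<in> {0..T}" for t
    using u.lin_state_bound[OF v y(1) that] w.lin_state_bound[OF v y'(1) that] by (simp_all add: N_def)
  have n\<psi>: "norm (\<psi>' t) \<le> kpsi * W w * N" if t: "t \<in> {0..T}" for t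
  proof -
    have "norm (\<psi>' t) \<le> exp (L * T) * (L * (l * N) + c1 * W w * (T * (l * N) + N))"
      using w.lin_adjoint_bound[OF v y' ny(2) t] by (simp add: N_def)
    also have "\<dots> \<le> exp (L * T) * (L * (l * N) * W w + c1 * W w * (T * (l * N) + N))"
    proof (intro mult_left_mono add_right_mono)
      have "L * (l * N) * 1 \<le> L * (l * N) * W w" using pos N0 by (intro mult_left_mono) auto
      then show "L * (l * N) \<le> L * (l * N) * W w" by simp
    qed simp
    also have "\<dots> = exp (L * T) * (L * l + c1 * (l * T + 1)) * (W w * N)"
      by (simp add: algebra_simps)
    also have "\<dots> \<le> kpsi * (W w * N)"
      using N0 by (intro mult_right_mono kpsi_ge) auto
    finally show ?thesis by (simp add: mult.assoc)
  qed
  have j: "norm (join p (v t)) \<le> l * N + norm (v t)" if "norm p \<le> l * N" for p t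
    using norm_join_le[of p "v t"] that by linarith
  have jd: "join (y t) (v t) - join (y' t) (v t) = join (y t - y' t) 0" for t
    by (simp flip: join_diff)
  define R where "R t = (transpose (lqD u t) *v \<psi> t + lqQ u t *v join (y t) (v t))
      - (transpose (lqD w t) *v \<psi>' t + lqQ w t *v join (y' t) (v t))" for t
  have R: "AE t in MT T. norm (R t) \<le> L * norm (\<psi> t - \<psi>' t) + c1 * W w * norm (y t - y' t)
      + (A * (kpsi * W w * N) + h * (l * N + norm (v t)))"
    using diff(5,6) AE_space
  proof eventually_elim
    case (elim t)
    then have t: "t \<in> {0..T}" by simp
    \<comment> \<open>\<open>lqQ w\<close> meets y - y', and the differences of coefficients meet
      \<psi>' and (y, v). With this arrangement only \<open>W w\<close> enters, not
      \<open>W u\<close>.\<close>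
    let ?E = "(transpose (lqD u t) *v (\<psi> t - \<psi>' t) + lqQ w t *v join (y t - y' t) 0)
        + (transpose (lqD u t - lqD w t) *v \<psi>' t + (lqQ u t - lqQ w t) *v join (y t) (v t))"
    have eq: "R t = ?E"
      unfolding R_def jd[symmetric] transpose_minus
      by (simp add: matrix_vector_mult_diff_distrib matrix_vector_mult_diff_rdistrib)
    have "norm ?E \<le> (L * norm (\<psi> t - \<psi>' t) + c1 * W w * norm (y t - y' t))
        + (A * (kpsi * W w * N) + h * (l * N + norm (v t)))"
    proof (rule norm_triangle_le[OF add_mono]; rule norm_triangle_le[OF add_mono])
      show "norm (transpose (lqD u t) *v (\<psi> t - \<psi>' t)) \<le> L * norm (\<psi> t - \<psi>' t)"
        by (rule u.norm_DT_vec[OF t])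
      show "norm (lqQ w t *v join (y t - y' t) 0) \<le> c1 * W w * norm (y t - y' t)"
        using order_trans[OF w.norm_Q_vec[OF t] mult_left_mono[OF norm_join_le[of "y t - y' t" 0]]]
          w.K_nonneg by simp
      have "norm (transpose (lqD u t - lqD w t) *v \<psi>' t) \<le> norm (lqD u t - lqD w t) * norm (\<psi>' t)"
        by (rule norm_transpose_vector_le)
      also have "\<dots> \<le> A * (kpsi * W w * N)"
        using elim(1) A0 by (intro mult_mono n\<psi> t) (auto simp: A_def mult.assoc)
      finally show "norm (transpose (lqD u t - lqD w t) *v \<psi>' t) \<le> A * (kpsi * W w * N)" .
      have "norm ((lqQ u t - lqQ w t) *v join (y t) (v t)) \<le> norm (lqQ u t - lqQ w t) * norm (join (y t) (v t))"
        by (rule norm_matrix_vector_le)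
      also have "\<dots> \<le> h * (l * N + norm (v t))"
        using elim(2) h0 by (intro mult_mono j ny t) (auto simp: h_def)
      finally show "norm ((lqQ u t - lqQ w t) *v join (y t) (v t)) \<le> h * (l * N + norm (v t))" .
    qed
    then show ?case by (simp only: eq)
  qed
  have sy: "ode_solution T (\<lambda>t _. lqD u t *v join (y t) (v t) - lqD w t *v join (y' t) (v t)) (\<lambda>t. y t - y' t)"
    using y(1) y'(1) unfolding u.lin_state_def w.lin_state_def
    by (intro ode_solution_diff[of T "\<lambda>t y. lqD u t *v join y (v t)" y "\<lambda>t y. lqD w t *v join y (v t)" y']) auto
  have s\<psi>: "ode_solution T (\<lambda>t _. - xpart (R t)) (\<lambda>t. \<psi> t - \<psi>' t)"
    using y(2) y'(2) unfolding u.lin_adjoint_def w.lin_adjoint_def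
    by (intro ode_solution_diff[of T "\<lambda>t \<psi>. - xpart (transpose (lqD u t) *v \<psi> + lqQ u t *v join (y t) (v t))" \<psi>
          "\<lambda>t \<psi>. - xpart (transpose (lqD w t) *v \<psi> + lqQ w t *v join (y' t) (v t))" \<psi>'])
      (auto simp: R_def)
  have Fy: "AE t in MT T. norm (lqD u t *v join (y t) (v t) - lqD w t *v join (y' t) (v t))
      \<le> L * norm (y t - y' t) + A * (l * N + norm (v t))"
    using diff(5) AE_space
  proof eventually_elim
    case (elim t)
    then have t: "t \<in> {0..T}" by simp
    let ?E = "lqD u t *v join (y t - y' t) 0 + (lqD u t - lqD w t) *v join (y' t) (v t)"
    have eq: "lqD u t *v join (y t) (v t) - lqD w t *v join (y' t) (v t)
       
        = ?E"
      unfolding jd[symmetric] by (simp add: matrix_vector_mult_diff_distrib matrix_vector_mult_diff_rdistrib)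
    have "norm ?E \<le> L * norm (y t - y' t) + A * (l * N + norm (v t))"
    proof (rule norm_triangle_le[OF add_mono])
      show "norm (lqD u t *v join (y t - y' t) 0) \<le> L * norm (y t - y' t)"
        using order_trans[OF u.norm_D_vec[OF t] mult_left_mono[OF norm_join_le[of "y t - y' t" 0]]]
          L_pos by simp
      have "norm ((lqD u t - lqD w t) *v join (y' t) (v t)) \<le> norm (lqD u t - lqD w t) * norm (join (y' t) (v t))"
        by (rule norm_matrix_vector_le)
      also have "\<dots> \<le> A * (l * N + norm (v t))"
        using elim(1) A0 by (intro mult_mono j ny t) (auto simp: A_def mult.assoc)
      finally show "norm ((lqD u t - lqD w t) *v join (y' t) (v t)) \<le> A * (l * N + norm (v t))" .
    qed
    then show ?case by (simp only: eq)
  qed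
  have \<psi>T: "norm (\<psi> T - \<psi>' T) \<le> L * norm (y T - y' T) + L * (c1 * T * e) * (l * N)"
  proof -
    let ?E = "lqG u *v (y T - y' T) + (lqG u - lqG w) *v y' T"
    have eq: "\<psi> T - \<psi>' T
        = ?E"
      using y(2) y'(2) by (simp add: u.lin_adjoint_def w.lin_adjoint_def matrix_vector_mult_diff_distrib
          matrix_vector_mult_diff_rdistrib)
    have "norm ?E \<le> L * norm (y T - y' T) + L * (c1 * T * e) * (l * N)"
    proof (rule norm_triangle_le[OF add_mono[OF u.norm_G_vec]])
      have "norm (lqG u - lqG w) \<le> L * (c1 * T * e)"
        using order_trans[OF g_bounds(3) mult_left_mono[OF diff(3)]] T_pos L_pos by simp
      then show "norm ((lqG u - lqG w) *v y' T) \<le> L * (c1 * T * e) * (l * N)"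
        using ny(2)[of T] pos
        by (intro order_trans[OF norm_matrix_vector_le] mult_mono) auto
    qed
    then show ?thesis by (simp only: eq)
  qed
  have P\<psi>: "AE t in MT T. norm (- xpart (R t)) \<le> L * norm (\<psi> t - \<psi>' t) + c1 * W w * norm (y t - y' t)
      + (A * (kpsi * W w * N) + h * (l * N + norm (v t)))"
    using R by eventually_elim (use norm_xpart_le order_trans in \<open>auto simp: norm_minus_cancel\<close>)
  have y0: "y 0 - y' 0 = 0" using y(1) y'(1) by (simp add: u.lin_state_def w.lin_state_def)
  have est: "L * norm (\<psi> t - \<psi>' t) + c1 * W w * norm (y t - y' t)
      + (A * (kpsi * W w * N) + h * (l * N + norm (v t))) \<le> W w * e * (m3 * N) + h * norm (v t)"
    if "t \<in> {0..T}" for t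
    unfolding A_def
    by (rule perturbation_estimate(2)[OF sy y0 s\<psi> diff(2) _ h0 _ v N_def Fy[unfolded A_def] P\<psi>[unfolded A_def] \<psi>T that])
      (simp_all add: h_def)
  show ?thesis
    using R AE_space
  proof eventually_elim
    case (elim t)
    have "J2 u v y \<psi> t - J2 w v y' \<psi>' t = upart (R t)"
      by (simp add: R_def u.second_var_def w.second_var_def)
    then have "norm (J2 u v y \<psi> t - J2 w v y' \<psi>' t) \<le> norm (R t)" by (simp add: norm_upart_le)
    then show ?case using elim est[of t] by (simp add: N_def h_def)
  qed
qed

text \<open>The adjoints do not enter the remainder through a difference of Hessians. The term \<open>T * L * cp\<close>
  saved in this way is what makes the contraction factor of Newton's method smaller than one.\<close>

lemma gradient_taylor:
  assumes u: "u \<in> L2 T" and w: "w \<in> L2 T" and e: "AE t in MT T. norm (u t - w t) \<le> e"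
    and y: "lst u (\<lambda>t. u t - w t) y" "lad u (\<lambda>t. u t - w t) y \<psi>"
    and V: "W u \<le> V" "W w \<le> V"
  shows "AE t in MT T. norm (J1 u t - J1 w t - J2 u (\<lambda>t. u t - w t) y \<psi> t)
    \<le> V * e * (m3 * norm_L1 T (\<lambda>t. u t - w t)) + V * e * (c1 * (T + 1) - T * L * cp) * norm (u t - w t)"
proof -
  interpret u: lq_problem T L "c1 * W u" "lqD u" "lqQ u" "lqG u" by (rule lq_problem_at[OF u])
  note diff = state_control_diff[OF u w e]
  note pos = T_pos L_pos l_pos c1_pos kpsi_pos cp_pos cx_pos diff(2)
  let ?v = "\<lambda>t. u t - w t"
  note v = L2_diff[OF u w]
  define N where "N = norm_L1 T ?v"
  have N0: "0 \<le> N" by (simp add: N_def)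
  have V1: "1 \<le> V" using V(1) norm_L1_nonneg[of T u] by linarith
  \<comment> \<open>From T times the first entry of \<open>C_H\<close> the share L cp is removed,
    which only a difference of adjoints would cause.\<close>
  define h where "h = V * e * (c1 * (T + 1) - T * L * cp)"
  have hfac: "T * (L * (cx + cp * cx)) + L * (1 + cp) \<le> c1 * (T + 1) - T * L * cp"
    using mult_left_mono[OF c1_ge(3), of T] c1_ge(4) T_pos by (simp add: algebra_simps)
  moreover have "0 \<le> T * (L * (cx + cp * cx)) + L * (1 + cp)" using pos by simp
  ultimately have "0 \<le> c1 * (T + 1) - T * L * cp" by linarith
  then have h0: "0 \<le> h" unfolding h_def using pos V1 by (intro mult_nonneg_nonneg) auto
  have h1: "h \<le> c1 * (T + 1) * V * e"
  proof -
    have "V * e * (c1 * (T + 1) - T * L * cp) \<le> V * e * (c1 * (T + 1))"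
      using pos V1 by (intro mult_left_mono) auto
    then show ?thesis by (simp add: h_def mult_ac)
  qed
  define A where "A = L * (c1 * T + 1) * e"
  have A0: "0 \<le> A" using pos by (simp add: A_def)
  let ?m = "\<lambda>t. norm (X u t - X w t) + norm (u t - w t)"
  have dX: "norm (X u t - X w t) \<le> l * N" if "t \<in> {0..T}" for t
    using state_diff[OF u w that] by (simp add: N_def)
  have dP: "norm (P u t - P w t) \<le> kpsi * V * N" if "t \<in> {0..T}" for t
  proof -
    have "norm (P u t - P w t) \<le> kpsi * W w * N"
      using adjoint_diff_kpsi[OF u w that] by (simp add: N_def)
    also have "\<dots> \<le> kpsi * V * N"
      using V(2) pos N0 by (intro mult_right_mono mult_left_mono) auto
    finally show ?thesis .
  qed
  have hm: "AE t in MT T. L * (1 + norm (P u t)) * ?m t \<le> h"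
    using e AE_space
  proof eventually_elim
    case (elim t)
    then have t: "t \<in> {0..T}" by simp
    have "norm (P u t) \<le> cp * V"
      using order_trans[OF norm_adjoint_cp[OF u t] mult_left_mono[OF V(1)]] pos by simp
    then have "L * (1 + norm (P u t)) \<le> L * (V + cp * V)"
      using pos V1 by (intro mult_left_mono add_mono) auto
    moreover have "?m t \<le> cx * (T * e) + e"
    proof (intro add_mono)
      have "l * N \<le> cx * (T * e)"
        using l_le_cx diff(1) pos N0 by (intro mult_mono) (auto simp: N_def)
      then show "norm (X u t - X w t) \<le> cx * (T * e)" using dX[OF t] by linarith
    qed (use elim in simp)
    ultimately have "L * (1 + norm (P u t)) * ?m t \<le> L * (V + cp * V) * (cx * (T * e) + e)"
      using pos V1 by (intro mult_mono) auto
    also have "\<dots> = (T * (L * (cx + cp * cx)) + L * (1 + cp)) * (V * e)"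
      by (simp add: algebra_simps)
    also have "\<dots> \<le> (c1 * (T + 1) - T * L * cp) * (V * e)"
      using hfac pos V1 by (intro mult_right_mono) auto
    finally show ?case by (simp add: h_def mult_ac)
  qed
  have dZ: "norm (Z u t - Z w t) \<le> ?m t" for t
    using norm_join_le[of "X u t - X w t" "u t - w t"] by (simp add: join_diff)
  have mN: "?m t \<le> l * N + norm (?v t)" if "t \<in> {0..T}" for t
    using dX[OF that] by simp
  have jd: "Z u t - Z w t - join (y t) (?v t) = join (X u t - X w t - y t) 0" for t
    by (simp flip: join_diff)
  define R where "R t = grad_ham t (P u t) (Z u t) - grad_ham t (P w t) (Z w t)
      - (transpose (lqD u t) *v \<psi> t + lqQ u t *v join (y t) (?v t))" for t
  have R: "AE t in MT T. norm (R t) \<le> L * norm (P u t - P w t - \<psi> t)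
      + c1 * V * norm (X u t - X w t - y t) + (A * (kpsi * V * N) + h * (l * N + norm (?v t)))"
    using diff(5) hm AE_space
  proof eventually_elim
    case (elim t)
    then have t: "t \<in> {0..T}" by simp
    let ?lin = "grad_ham t (P u t) (Z u t) - grad_ham t (P u t) (Z w t) - lqQ u t *v (Z u t - Z w t)"
    \<comment> \<open>The difference of adjoints meets only the difference of Jacobians. The
      nonlinear part \<open>?lin\<close> is taken at the adjoint of \<open>u\<close>, which is why
      \<open>V\<close> has to dominate \<open>W u\<close> as well.\<close>
    let ?E = "(transpose (lqD u t) *v (P u t - P w t - \<psi> t) + lqQ u t *v join (X u t - X w t - y t) 0)
        + (?lin - transpose (lqD u t - lqD w t) *v (P u t - P w t))"
    have "grad_ham t (P w t) (Z w t) = grad_ham t (P u t) (Z w t) - transpose (lqD w t) *v (P u t - P w t)"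
      using grad_ham_diff_adjoint[OF t, of "P u t" "Z w t" "P w t"] by (simp add: algebra_simps)
    then have eq: "R t = ?E"
      unfolding R_def jd[symmetric] transpose_minus
      by (simp add: matrix_vector_mult_diff_distrib matrix_vector_mult_diff_rdistrib)
    have "norm ?E \<le> (L * norm (P u t - P w t - \<psi> t) + c1 * V * norm (X u t - X w t - y t))
        + (h * (l * N + norm (?v t)) + A * (kpsi * V * N))"
    proof (rule norm_triangle_le[OF add_mono], rule norm_triangle_le[OF add_mono])
      show "norm (transpose (lqD u t) *v (P u t - P w t - \<psi> t)) \<le> L * norm (P u t - P w t - \<psi> t)"
        by (rule u.norm_DT_vec[OF t])
      have "norm (lqQ u t *v join (X u t - X w t - y t) 0) \<le> c1 * W u * norm (X u t - X w t - y t)"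
        using order_trans[OF u.norm_Q_vec[OF t] mult_left_mono[OF norm_join_le[of "X u t - X w t - y t" 0]]]
          u.K_nonneg by simp
      also have "\<dots> \<le> c1 * V * norm (X u t - X w t - y t)"
        using V pos by (intro mult_right_mono mult_left_mono) auto
      finally show "norm (lqQ u t *v join (X u t - X w t - y t) 0) \<le> c1 * V * norm (X u t - X w t - y t)" .
      show "norm (?lin - transpose (lqD u t - lqD w t) *v (P u t - P w t))
          \<le> h * (l * N + norm (?v t)) + A * (kpsi * V * N)"
      proof (rule norm_triangle_le_diff[OF add_mono])
        have "norm ?lin \<le> L * (1 + norm (P u t)) * ?m t * norm (Z u t - Z w t)"
          by (rule grad_ham_linearization[OF t])
        also have "\<dots> \<le> h * (l * N + norm (?v t))"
          using elim(2) h0 order_trans[OF dZ mN[OF t]] by (intro mult_mono) auto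
        finally show "norm ?lin \<le> h * (l * N + norm (?v t))" .
        show "norm (transpose (lqD u t - lqD w t) *v (P u t - P w t)) \<le> A * (kpsi * V * N)"
          using elim(1) A0 dP[OF t]
          by (intro order_trans[OF norm_transpose_vector_le] mult_mono) (auto simp: A_def mult.assoc)
      qed
    qed
    then show ?case by (simp only: eq add.commute[of "A * _"])
  qed
  have sy: "ode_solution T (\<lambda>t _. b t (X u t) (u t) - b t (X w t) (w t) - lqD u t *v join (y t) (?v t))
      (\<lambda>t. X u t - X w t - y t)"
    using y(1) unfolding u.lin_state_def
    by (intro ode_solution_diff[OF ode_solution_diff[OF state_ode[OF u] state_ode[OF w],
            of "\<lambda>t _. b t (X u t) (u t) - b t (X w t) (w t)"], of "\<lambda>t y. lqD u t *v join y (?v t)" y]) auto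
  have s\<psi>: "ode_solution T (\<lambda>t _. - xpart (R t)) (\<lambda>t. P u t - P w t - \<psi> t)"
    using y(2) unfolding u.lin_adjoint_def
    by (intro ode_solution_diff[OF ode_solution_diff[OF adjoint_ode[OF u] adjoint_ode[OF w],
            of "\<lambda>t _. - xpart (grad_ham t (P u t) (Z u t)) - (- xpart (grad_ham t (P w t) (Z w t)))"],
          of "\<lambda>t \<psi>. - xpart (transpose (lqD u t) *v \<psi> + lqQ u t *v join (y t) (?v t))" \<psi>])
      (auto simp: R_def)
  have Fy: "AE t in MT T. norm (b t (X u t) (u t) - b t (X w t) (w t) - lqD u t *v join (y t) (?v t))
      \<le> L * norm (X u t - X w t - y t) + A * (l * N + norm (?v t))"
    using diff(4) AE_space
  proof eventually_elim
    case (elim t)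
    then have t: "t \<in> {0..T}" by simp
    let ?E = "lqD u t *v join (X u t - X w t - y t) 0
        + (b t (X u t) (u t) - b t (X w t) (w t) - lqD u t *v (Z u t - Z w t))"
    have eq: "b t (X u t) (u t) - b t (X w t) (w t) - lqD u t *v join (y t) (?v t)
     
        = ?E"
      unfolding jd[symmetric] by (simp add: matrix_vector_mult_diff_distrib)
    have "norm ?E \<le> L * norm (X u t - X w t - y t) + A * (l * N + norm (?v t))"
    proof (rule norm_triangle_le[OF add_mono])
      show "norm (lqD u t *v join (X u t - X w t - y t) 0) \<le> L * norm (X u t - X w t - y t)"
        using order_trans[OF u.norm_D_vec[OF t] mult_left_mono[OF norm_join_le[of "X u t - X w t - y t" 0]]]
          L_pos by simp
      have "norm (b t (X u t) (u t) - b t (X w t) (w t) - lqD u t *v (Z u t - Z w t))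
          \<le> L * (norm (Z u t - Z w t))\<^sup>2"
        by (rule b_linearization[OF t])
      also have "\<dots> \<le> L * (((c1 * T + 1) * e) * (l * N + norm (?v t)))"
        using L_pos order_trans[OF dZ elim(1)] order_trans[OF dZ mN[OF t]] pos
        unfolding power2_eq_square by (intro mult_left_mono mult_mono) auto
      finally show "norm (b t (X u t) (u t) - b t (X w t) (w t) - lqD u t *v (Z u t - Z w t))
          \<le> A * (l * N + norm (?v t))"
        by (simp add: A_def mult.assoc)
    qed
    then show ?case by (simp only: eq)
  qed
  have \<psi>T: "norm (P u T - P w T - \<psi> T) \<le> L * norm (X u T - X w T - y T) + L * (c1 * T * e) * (l * N)"
  proof -
    let ?E = "lqG u *v (X u T - X w T - y T)
        + (grad g (X u T) - grad g (X w T) - lqG u *v (X u T - X w T))"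
    have eq: "P u T - P w T - \<psi> T
        = ?E"
      using y(2) by (simp add: adjoint_T[OF u] adjoint_T[OF w] u.lin_adjoint_def matrix_vector_mult_diff_distrib)
    have "norm ?E \<le> L * norm (X u T - X w T - y T) + L * (c1 * T * e) * (l * N)"
    proof (rule norm_triangle_le[OF add_mono[OF u.norm_G_vec]])
      have "norm (grad g (X u T) - grad g (X w T) - lqG u *v (X u T - X w T)) \<le> L * (norm (X u T - X w T))\<^sup>2"
        by (rule grad_g_linearization)
      also have "\<dots> \<le> L * ((c1 * T * e) * (l * N))"
        using L_pos diff(3)[of T] dX[of T] pos unfolding power2_eq_square
        by (intro mult_left_mono mult_mono) auto
      finally show "norm (grad g (X u T) - grad g (X w T) - lqG u *v (X u T - X w T)) \<le> L * (c1 * T * e) * (l * N)"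
        by (simp add: mult.assoc)
    qed
    then show ?thesis by (simp only: eq)
  qed
  have P\<psi>: "AE t in MT T. norm (- xpart (R t)) \<le> L * norm (P u t - P w t - \<psi> t)
      + c1 * V * norm (X u t - X w t - y t) + (A * (kpsi * V * N) + h * (l * N + norm (?v t)))"
    using R by eventually_elim (use norm_xpart_le order_trans in \<open>auto simp: norm_minus_cancel\<close>)
  have y0: "X u 0 - X w 0 - y 0 = 0"
    using y(1) by (simp add: state_0[OF u] state_0[OF w] u.lin_state_def)
  have est: "L * norm (P u t - P w t - \<psi> t) + c1 * V * norm (X u t - X w t - y t)
      + (A * (kpsi * V * N) + h * (l * N + norm (?v t))) \<le> V * e * (m3 * N) + h * norm (?v t)"
    if "t \<in> {0..T}" for t
    unfolding A_def
    by (rule perturbation_estimate(2)[OF sy y0 s\<psi> diff(2) V1 h0 h1 v N_def Fy[unfolded A_def] P\<psi>[unfolded A_def] \<psi>T that])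
  show ?thesis
    using R AE_space
  proof eventually_elim
    case (elim t)
    then have t: "t \<in> {0..T}" by simp
    have "J1 u t - J1 w t - J2 u ?v y \<psi> t = upart (R t)"
      by (simp add: R_def u.second_var_def cost_gradient_eq[OF t])
    then have "norm (J1 u t - J1 w t - J2 u ?v y \<psi> t) \<le> norm (R t)" by (simp add: norm_upart_le)
    then show ?case using elim est[OF t] by (simp add: N_def h_def)
  qed
qed

end

section \<open>First-order optimality condition\<close>

context control_problem
begin

lemma integrable_running_cost:
  assumes u: "u \<in> L2 T" shows "integrable (MT T) (\<lambda>t. f t (X u t) (u t))"
proof (rule Bochner_Integration.integrable_bound)
  show "integrable (MT T) (\<lambda>t. L * ((norm (X u t))\<^sup>2 + (norm (u t))\<^sup>2 + 1))"
    by (intro integrable_mult_right Bochner_Integration.integrable_add L2_square_integrable u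
        L2_continuous state_continuous) simp
  show "(\<lambda>t. f t (X u t) (u t)) \<in> borel_measurable (MT T)"
    by (rule measurable_b_f(2)[OF continuous_measurable_MT[OF state_continuous[OF u]] L2_measurable[OF u]])
  show "AE t in MT T. norm (f t (X u t) (u t)) \<le> norm (L * ((norm (X u t))\<^sup>2 + (norm (u t))\<^sup>2 + 1))"
    using standing_bounds(6) L_pos by (intro AE_MT_I) (simp add: abs_of_nonneg)
qed

lemma cost_gradient_L2:
  assumes u: "u \<in> L2 T" shows "J1 u \<in> L2 T"
    and "\<And>B. AE t in MT T. norm (u t) \<le> B \<Longrightarrow>
      AE t in MT T. norm (J1 u t) \<le> L * (kp * W u) + L * (cx * W u + B + 1)"
proof -
  have le: "norm (J1 u t) \<le> L * (kp * W u) + L * (cx * W u + norm (u t) + 1)" if t: "t \<in> {0..T}" for t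
  proof -
    have "norm (J1 u t) \<le> norm (grad_ham t (P u t) (Z u t))"
      unfolding cost_gradient_eq[OF t] by (rule norm_upart_le)
    also have "\<dots> \<le> L * norm (P u t) + L * (norm (X u t) + norm (u t) + 1)"
      unfolding grad_ham_eq[OF t] by (intro norm_triangle_le add_mono norm_jac_transpose norm_grad_f t)
    also have "\<dots> \<le> L * (kp * W u) + L * (cx * W u + norm (u t) + 1)"
      using norm_state[OF u t] norm_adjoint[OF u t] L_pos by (intro add_mono mult_left_mono) auto
    finally show ?thesis .
  qed
  show "AE t in MT T. norm (J1 u t) \<le> L * (kp * W u) + L * (cx * W u + B + 1)"
    if "AE t in MT T. norm (u t) \<le> B" for B
    using that AE_space
  proof eventually_elim
    case (elim t)
    have "L * (cx * W u + norm (u t) + 1) \<le> L * (cx * W u + B + 1)"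
      using elim(1) L_pos by (intro mult_left_mono) auto
    then show ?case using le[of t] elim(2) by simp
  qed
  have c: "(\<lambda>t. L * (kp * W u) + L * (cx * W u + norm (u t) + 1)) \<in> L2 T"
    (is "?c \<in> _")
  proof -
    have n: "(\<lambda>t. norm (u t)) \<in> L2 T"
      using u L2_measurable[OF u] by (simp add: L2_def)
    have "(\<lambda>t. L * (kp * W u) + L * (cx * W u + 1)) \<in> L2 T"
      by (intro L2_continuous continuous_intros)
    from L2_add[OF this L2_scale[OF n, of L]] show ?thesis by (simp add: algebra_simps)
  qed
  show "J1 u \<in> L2 T"
    by (rule L2_I_bound[OF cost_gradient_measurable[OF u] c, of 1], rule AE_MT_I)
      (use le order_trans abs_ge_self in \<open>fastforce\<close>)
qed

text \<open>A descent estimate that avoids differentiating the cost in function space. The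
  Hamiltonian is expanded at the adjoint of \<open>w\<close>; pairing the difference of states with
  this adjoint removes the first-order terms in the state, and the rest is quadratic in
  \<open>e\<close>.\<close>

lemma cost_upper_bound:
  assumes u: "u \<in> L2 T" and w: "w \<in> L2 T" and e: "AE t in MT T. norm (u t - w t) \<le> e"
  shows "cost T b f g x0 u - cost T b f g x0 w \<le> (LINT t|MT T. (u t - w t) \<bullet> J1 w t)
    + (T * (L * (1 + kp * W w) * (l * T + 1)\<^sup>2) + L * (l * T)\<^sup>2) * e\<^sup>2"
proof -
  note diff = state_control_diff[OF u w e]
  note pos = T_pos L_pos l_pos kp_pos diff(2)
  note d = L2_diff[OF u w]
  let ?x = "\<lambda>t. X u t - X w t"
  let ?H = "\<lambda>t u'. hamiltonian b f (P w t) t (X u' t) (u' t)"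
  let ?G = "\<lambda>t. grad_ham t (P w t) (Z w t)"
  have sx: "ode_solution T (\<lambda>t _. b t (X u t) (u t) - b t (X w t) (w t)) ?x"
    by (rule ode_solution_diff[OF state_ode[OF u] state_ode[OF w]]) simp
  let ?S = "\<lambda>t. (b t (X u t) (u t) - b t (X w t) (w t)) \<bullet> P w t + ?x t \<bullet> (- xpart (?G t))"
  let ?F = "\<lambda>t. f t (X u t) (u t) - f t (X w t) (w t)"
  have iS: "integrable (MT T) ?S" and S: "?x T \<bullet> P w T = (LINT t|MT T. ?S t)"
    using ode_solution_by_parts[OF sx adjoint_ode[OF w]] T_pos state_0[OF u] state_0[OF w] by simp_all
  have iF: "integrable (MT T) ?F"
    by (intro Bochner_Integration.integrable_diff integrable_running_cost u w)
  have iJ: "integrable (MT T) (\<lambda>t. (u t - w t) \<bullet> J1 w t)"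
    by (rule L2_inner_integrable[OF d cost_gradient_L2(1)[OF w]])
  let ?r = "\<lambda>t. ?F t + ?S t - (u t - w t) \<bullet> J1 w t"
  let ?C = "L * (1 + kp * W w) * ((l * T + 1) * e)\<^sup>2"
  have "(LINT t|MT T. ?r t) \<le> (LINT t|MT T. ?C)"
  proof (rule integral_mono_AE)
    show "integrable (MT T) ?r" using iF iS iJ by simp
    show "AE t in MT T. ?r t \<le> ?C"
      using e AE_space
    proof eventually_elim
      case (elim t)
      then have t: "t \<in> {0..T}" by simp
      have lN: "norm (?x t) \<le> l * (T * e)"
        using state_diff[OF u w t] diff(1) l_pos by (smt (verit) mult_left_mono)
      have "norm (Z u t - Z w t) \<le> norm (?x t) + norm (u t - w t)"
        using norm_join_le[of "?x t" "u t - w t"] by (simp add: join_diff)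
      also have "\<dots> \<le> (l * T + 1) * e"
        using lN elim by (simp add: algebra_simps)
      finally have Z: "norm (Z u t - Z w t) \<le> (l * T + 1) * e" .
      have "?r t = ?H t u - ?H t w - (Z u t - Z w t) \<bullet> ?G t"
        by (simp add: hamiltonian_def cost_gradient_eq[OF t] inner_diff_left algebra_simps inner_join)
      also have "\<dots> \<le> L * (1 + norm (P w t)) * (norm (Z u t - Z w t))\<^sup>2"
        using hamiltonian_linearization[OF t, of "P w t" "X u t" "u t" "X w t" "w t"] by linarith
      also have "\<dots> \<le> ?C"
        using Z norm_adjoint[OF w t] pos by (intro mult_mono mult_left_mono add_left_mono power_mono) auto
      finally show ?case .
    qed
  qed simp
  also have "\<dots> = T * ?C" using T_pos by simp
  finally have r: "(LINT t|MT T. ?F t) + ?x T \<bullet> P w T - (LINT t|MT T. (u t - w t) \<bullet> J1 w t) \<le> T * ?C"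
    using iF iS iJ by (simp add: S)
  have "g (X u T) - g (X w T) - ?x T \<bullet> P w T \<le> L * (norm (?x T))\<^sup>2"
    using g_linearization[of "X u T" "X w T"] by (simp add: adjoint_T[OF w])
  also have "\<dots> \<le> L * (l * (T * e))\<^sup>2"
  proof (intro mult_left_mono power_mono)
    show "norm (?x T) \<le> l * (T * e)"
      using state_diff[OF u w, of T] diff(1) l_pos T_pos
      by (smt (verit) mult_left_mono atLeastAtMost_iff)
  qed (use pos in auto)
  finally have gr: "g (X u T) - g (X w T) - ?x T \<bullet> P w T \<le> L * (l * (T * e))\<^sup>2" .
  have "cost T b f g x0 u - cost T b f g x0 w = (LINT t|MT T. ?F t) + (g (X u T) - g (X w T))"
    using integrable_running_cost[OF u] integrable_running_cost[OF w] by (simp add: cost_def Let_def)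
  then have "cost T b f g x0 u - cost T b f g x0 w
      \<le> (LINT t|MT T. (u t - w t) \<bullet> J1 w t) + T * ?C + L * (l * (T * e))\<^sup>2"
    using r gr by linarith
  moreover have "T * (L * k * (q * e)\<^sup>2) + L * (l * (T * e))\<^sup>2
      = (T * (L * k * q\<^sup>2) + L * (l * T)\<^sup>2) * e\<^sup>2" for k q
    by (simp add: power_mult_distrib algebra_simps)
  note this[of "1 + kp * W w" "l * T + 1"]
  ultimately show ?thesis by linarith
qed

text \<open>The competitor w - s J'(w) gives ||J'(w)||_2^2 \<le> s C for every s > 0. Boundedness of
  \<open>w\<close> makes J'(w) essentially bounded, so this competitor is close to \<open>w\<close>
  in the supremum norm.\<close>

lemma optimal_stationary:
  assumes w: "w \<in> Linf T" and opt: "optimal_control T b f g x0 w"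
  shows "AE t in MT T. J1 w t = 0"
proof -
  have w2: "w \<in> L2 T" by (rule Linf_L2[OF w T_pos])
  define B where "B = L * (kp * W w) + L * (cx * W w + norm_Linf T w + 1)"
  have J: "AE t in MT T. norm (J1 w t) \<le> B"
    unfolding B_def by (rule cost_gradient_L2(2)[OF w2 Linf_AE(1)[OF w T_pos]])
  note J2 = cost_gradient_L2(1)[OF w2]
  define C where "C = (T * (L * (1 + kp * W w) * (l * T + 1)\<^sup>2) + L * (l * T)\<^sup>2) * B\<^sup>2"
  have le: "(norm_L2 T (J1 w))\<^sup>2 \<le> s * C" if s: "0 < s" for s
  proof -
    let ?u = "\<lambda>t. w t - s *\<^sub>R J1 w t"
    have u: "?u \<in> L2 T" by (rule L2_diff[OF w2 L2_scale[OF J2]])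
    have "AE t in MT T. norm (?u t - w t) \<le> s * B"
      using J by eventually_elim (use s in simp)
    note bound = cost_upper_bound[OF u w2 this]
    have "(?u t - w t) \<bullet> J1 w t = - s * (norm (J1 w t))\<^sup>2" for t
      by (simp add: power2_norm_eq_inner)
    then have "(LINT t|MT T. (?u t - w t) \<bullet> J1 w t) = - s * (norm_L2 T (J1 w))\<^sup>2"
      by (simp only: norm_L2_sq integral_mult_right_zero)
    moreover have "cost T b f g x0 w \<le> cost T b f g x0 ?u"
      using opt u unfolding optimal_control_def by blast
    moreover have "(T * (L * (1 + kp * W w) * (l * T + 1)\<^sup>2) + L * (l * T)\<^sup>2) * (s * B)\<^sup>2 = s * (s * C)"
      by (simp only: C_def power_mult_distrib power2_eq_square[of s] mult_ac)
    ultimately have "0 \<le> - s * (norm_L2 T (J1 w))\<^sup>2 + s * (s * C)"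
      using bound by linarith
    then have "s * (norm_L2 T (J1 w))\<^sup>2 \<le> s * (s * C)" by simp
    then show ?thesis using s by simp
  qed
  have "(norm_L2 T (J1 w))\<^sup>2 \<le> 0"
  proof (rule tendsto_lowerbound)
    show "((\<lambda>s. s * C) \<longlongrightarrow> 0) (at_right 0)" by (auto intro!: tendsto_eq_intros)
    show "\<forall>\<^sub>F s in at_right 0. (norm_L2 T (J1 w))\<^sup>2 \<le> s * C"
      using le by (auto simp: eventually_at_right_field intro!: exI[of _ 1])
  qed auto
  then have "(LINT t|MT T. (norm (J1 w t))\<^sup>2) = 0"
    using zero_le_power2[of "norm_L2 T (J1 w)"] unfolding norm_L2_sq by linarith
  then have "AE t in MT T. (norm (J1 w t))\<^sup>2 = 0"
    by (subst (asm) integral_nonneg_eq_0_iff_AE) (auto simp: L2_square_integrable[OF J2])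
  then show ?thesis by simp
qed

text \<open>The upper half of the comparison between gradient and error; the lower half is
  \<open>error_le_gradient\<close>.\<close>

lemma cost_gradient_lipschitz:
  assumes u: "u \<in> L2 T" and w: "w \<in> L2 T" and e: "AE t in MT T. norm (u t - w t) \<le> e"
  shows "AE t in MT T. norm (J1 u t - J1 w t)
    \<le> (L * (cp * W w * T) + L * (1 + cp * W w) * (c1 * T + 1)) * e"
  using state_control_diff(4)[OF u w e] AE_space
proof eventually_elim
  case (elim t)
  then have t: "t \<in> {0..T}" by simp
  note diff = state_control_diff[OF u w e]
  have dP: "norm (P u t - P w t) \<le> cp * W w * (T * e)"
    using adjoint_diff_cp[OF u w t] diff(1) cp_pos
    by (smt (verit) mult_left_mono mult_nonneg_nonneg norm_L1_nonneg)
  have eq: "J1 u t - J1 w t = upart (transpose (lqD u t) *v (P u t - P w t)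
      + (grad_ham t (P w t) (Z u t) - grad_ham t (P w t) (Z w t)))"
    by (simp add: cost_gradient_eq[OF t] flip: grad_ham_diff_adjoint[OF t])
  have "norm (J1 u t - J1 w t) \<le> L * norm (P u t - P w t) + L * (1 + norm (P w t)) * norm (Z u t - Z w t)"
    unfolding eq
    by (intro order_trans[OF norm_upart_le] norm_triangle_le add_mono norm_jac_transpose grad_ham_lipschitz t)
  also have "\<dots> \<le> L * (cp * W w * (T * e)) + L * (1 + cp * W w) * ((c1 * T + 1) * e)"
  proof (rule add_mono[OF mult_left_mono[OF dP] mult_mono])
    show "L * (1 + norm (P w t)) \<le> L * (1 + cp * W w)"
      using norm_adjoint_cp[OF w t] L_pos by (intro mult_left_mono) auto
    show "norm (Z u t - Z w t) \<le> (c1 * T + 1) * e"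
      using norm_join_le[of "X u t - X w t" "u t - w t"] elim(1) by (simp add: join_diff)
  qed (use L_pos cp_pos in auto)
  finally show ?case by (simp add: algebra_simps)
qed

end

context lq_problem
begin

lemma second_var_combine:
  "second_var (\<lambda>t. v t + c *\<^sub>R v' t) (\<lambda>t. y t + c *\<^sub>R y' t) (\<lambda>t. \<psi> t + c *\<^sub>R \<psi>' t) t
    = second_var v y \<psi> t + c *\<^sub>R second_var v' y' \<psi>' t"
  by (simp add: second_var_def join_add join_scaleR matrix_vector_right_distrib
      matrix_vector_mult_scaleR algebra_simps)

lemma lin_adjoint_combine:
  assumes "lin_adjoint v y \<psi>" "lin_adjoint v' y' \<psi>'"
  shows "lin_adjoint (\<lambda>t. v t + c *\<^sub>R v' t) (\<lambda>t. y t + c *\<^sub>R y' t) (\<lambda>t. \<psi> t + c *\<^sub>R \<psi>' t)"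
  unfolding lin_adjoint_def
proof
  show "ode_solution T (\<lambda>t \<psi>. - xpart (transpose (D t) *v \<psi>
      + Q t *v join (y t + c *\<^sub>R y' t) (v t + c *\<^sub>R v' t))) (\<lambda>t. \<psi> t + c *\<^sub>R \<psi>' t)"
    using assms unfolding lin_adjoint_def
    by (intro ode_solution_combine[of T "\<lambda>t \<psi>. - xpart (transpose (D t) *v \<psi> + Q t *v join (y t) (v t))" _
          "\<lambda>t \<psi>. - xpart (transpose (D t) *v \<psi> + Q t *v join (y' t) (v' t))"])
      (auto simp: join_add join_scaleR matrix_vector_right_distrib matrix_vector_mult_scaleR algebra_simps)
qed (use assms in \<open>simp add: lin_adjoint_def matrix_vector_right_distrib matrix_vector_mult_scaleR\<close>)

end

section \<open>Newton iterates near an optimal control\<close>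

locale optimal_problem = control_problem T L x0 b f g
  for T L :: real and x0 :: "real^'n::finite"
    and b :: "real \<Rightarrow> real^'n \<Rightarrow> real^'m::finite \<Rightarrow> real^'n"
    and f :: "real \<Rightarrow> real^'n \<Rightarrow> real^'m \<Rightarrow> real" and g :: "real^'n \<Rightarrow> real" +
  fixes w :: "real \<Rightarrow> real^'m" and \<alpha> :: real
  assumes w_Linf: "w \<in> Linf T" and \<alpha>_pos: "0 < \<alpha>"
    and optimal: "optimal_control T b f g x0 w"
    and coercive: "coercive_at T b f g x0 w \<alpha>"
begin

abbreviation "\<gamma> \<equiv> gamma_const T L x0 \<alpha> w"
abbreviation "r \<equiv> r_3 T L x0 \<alpha> w"
text \<open>The Taylor constant of the gradient near \<open>w\<close>; its ratio to
  \<open>c3\<close> is the contraction factor.\<close>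

abbreviation "\<theta>' \<equiv> c3 - T * L * cp"

lemma w_L2: "w \<in> L2 T" by (rule Linf_L2[OF w_Linf T_pos])

lemma W_ge_1: "1 \<le> W w" by simp

lemma ch_pos: "0 < ch"
  using c1_pos L_pos T_pos by (simp add: C_h_def add_nonneg_pos)

lemma gamma_pos: "0 < \<gamma>" and gamma_le: "\<gamma> \<le> \<alpha>"
proof -
  let ?d = "T * (L * ch + c1 * l) * W w + \<alpha>"
  have "0 \<le> T * (L * ch + c1 * l) * W w"
    using T_pos L_pos ch_pos c1_pos by (intro mult_nonneg_nonneg add_nonneg_nonneg) auto
  then have d: "\<alpha> \<le> ?d" by simp
  have eq: "\<gamma> = \<alpha>\<^sup>2 / ?d" by (simp add: gamma_const_def mult.assoc)
  show "0 < \<gamma>" using d \<alpha>_pos by (simp add: eq)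
  have "\<alpha> * \<alpha> \<le> \<alpha> * ?d" using d \<alpha>_pos by (intro mult_left_mono) auto
  then show "\<gamma> \<le> \<alpha>" using d \<alpha>_pos by (simp add: eq power2_eq_square pos_divide_le_eq)
qed

lemma r_pos: "0 < r"
proof -
  have "c3 * W w < sqrt (c3\<^sup>2 * (W w)\<^sup>2 + c3 * T * \<gamma>)"
    using c3_pos T_pos gamma_pos
    by (intro real_less_rsqrt) (simp add: power_mult_distrib)
  moreover have "0 < c3 * W w" using c3_pos W_ge_1 by (intro mult_pos_pos) linarith+
  ultimately show ?thesis
    using c3_pos T_pos \<alpha>_pos by (simp add: r_3_def)
qed

text \<open>The second entry of the minimum in \<open>r_3\<close> is the positive root of c3 T e^2 +
  2 c3 W e = \<gamma>; the proof completes the square.\<close>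

lemma radius_bound:
  assumes "0 \<le> e" "e \<le> r" shows "c3 * T * e\<^sup>2 + 2 * c3 * W w * e \<le> \<gamma>"
proof -
  let ?s = "sqrt (c3\<^sup>2 * (W w)\<^sup>2 + c3 * T * \<gamma>)"
  have ct: "0 < c3 * T" using c3_pos T_pos by simp
  have "e \<le> (?s - c3 * W w) / (c3 * T)" using assms(2) by (simp add: r_3_def)
  then have "c3 * T * e + c3 * W w \<le> ?s"
    using ct by (simp add: pos_le_divide_eq mult.commute)
  moreover have "0 \<le> c3 * T * e + c3 * W w"
    using ct assms(1) c3_pos T_pos by (intro add_nonneg_nonneg mult_nonneg_nonneg) auto
  ultimately have "(c3 * T * e + c3 * W w)\<^sup>2 \<le> ?s\<^sup>2" by (rule power_mono)
  also have "\<dots> = c3\<^sup>2 * (W w)\<^sup>2 + c3 * T * \<gamma>"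
    using c3_pos T_pos gamma_pos by (intro real_sqrt_pow2) (simp add: add_nonneg_nonneg)
  finally have "c3 * T * (c3 * T * e\<^sup>2 + 2 * c3 * W w * e) \<le> c3 * T * \<gamma>"
    by (simp add: power2_eq_square algebra_simps)
  then show ?thesis using ct by (rule mult_left_le_imp_le)
qed

lemma theta_bounds: "0 \<le> \<theta>'" "\<theta>' < c3"
proof -
  have "L * cp \<le> c1" using c1_ge(4) L_pos by (simp add: distrib_left)
  then have "T * (L * cp) \<le> T * c1" using T_pos by (intro mult_left_mono) auto
  moreover have "T * c1 \<le> c1 * (T + 1)" using c1_pos by (simp add: algebra_simps)
  then have "T * c1 \<le> c3" using c3_eq mult_pos_pos[OF T_pos m3_pos] by linarith
  ultimately show "0 \<le> \<theta>'" by (simp add: mult.assoc)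
  show "\<theta>' < c3" using T_pos L_pos cp_pos by simp
qed

sublocale lqw: lq_problem T L "c1 * W w" "lqD w" "lqQ w" "lqG w"
  by (rule lq_problem_at[OF w_L2])

lemma coercive_w: "lqw.coercive \<alpha>"
  by (rule coercive_at_lq[OF w_L2 coercive])

text \<open>One summand in the constant of \<open>inverse_bound\<close> lacks the factor
  \<open>W w\<close>. Supplying it turns the constant into (L C_h + C_1 l) W, and the sum with the
  first term into exactly \<omega> / \<gamma>; this is the origin of \<open>C_h\<close> and
  \<gamma>.\<close>

lemma inverse_bound_w:
  assumes v: "v \<in> L2 T" "lst w v y" "lad w v y \<psi>" and \<omega>: "AE t in MT T. norm (J2 w v y \<psi> t) \<le> \<omega>"
  shows "AE t in MT T. norm (v t) \<le> \<omega> / \<gamma>"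
  using lqw.inverse_bound[OF coercive_w \<alpha>_pos v \<omega>]
proof eventually_elim
  case (elim t)
  have \<omega>0: "0 \<le> \<omega>"
    by (rule AE_MT_const[OF T_pos], use \<omega> in eventually_elim) (meson norm_ge_zero order_trans)
  let ?k = "L * (exp (L * T) * (L * l + c1 * W w * (T * l + 1))) + c1 * W w * l"
  let ?K = "(L * ch + c1 * l) * W w"
  have "exp (L * T) * (L * l) = L\<^sup>2 * exp (2 * L * T)"
    by (simp add: power2_eq_square exp_double[symmetric] mult.assoc flip: exp_add)
  then have "ch = c1 * exp (L * T) * (T * l + 1) + exp (L * T) * (L * l)"
    by (simp add: C_h_def mult.assoc)
  then have "?K = ?k + L * (exp (L * T) * (L * l)) * norm_L1 T w"
    by (simp add: algebra_simps)
  moreover have "0 \<le> L * (exp (L * T) * (L * l)) * norm_L1 T w" using L_pos by simp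
  ultimately have k: "?k \<le> ?K" by linarith
  have "norm (v t) \<le> \<omega> / \<alpha> + ?k * (T * \<omega> / \<alpha>) / \<alpha>" using elim .
  also have "\<dots> \<le> \<omega> / \<alpha> + ?K * (T * \<omega> / \<alpha>) / \<alpha>"
    using k \<omega>0 \<alpha>_pos T_pos by (intro add_left_mono divide_right_mono mult_right_mono) auto
  also have "\<dots> = \<omega> * (T * (L * ch + c1 * l) * W w + \<alpha>) / \<alpha>\<^sup>2"
    using \<alpha>_pos by (simp add: field_simps power2_eq_square)
  also have "\<dots> = \<omega> / \<gamma>"
    by (simp add: gamma_const_def mult.assoc)
  finally show ?case .
qed

text \<open>The difference of the second derivatives is paired with \<open>v\<close>; ||v||_1^2
  \<le> T ||v||_2^2 turns \<open>m3\<close> into T m3, so the loss is again governed by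
  \<open>c3\<close>. This makes the Newton subproblem at the iterate strictly convex.\<close>

lemma coercive_near:
  assumes u: "u \<in> L2 T" and e: "AE t in MT T. norm (u t - w t) \<le> e"
  shows "lq_problem.coercive T (lqD u) (lqQ u) (lqG u) (\<alpha> - c3 * W w * e)"
proof -
  interpret u: lq_problem T L "c1 * W u" "lqD u" "lqQ u" "lqG u" by (rule lq_problem_at[OF u])
  note e0 = state_control_diff(2)[OF u w_L2 e]
  show ?thesis
    unfolding u.coercive_def
  proof (intro allI impI)
    fix v y assume v: "v \<in> L2 T" and y: "u.lin_state v y"
    obtain \<psi> where \<psi>: "u.lin_adjoint v y \<psi>" using u.lin_adjoint_exists[OF v y] by blast
    obtain y' where y': "lqw.lin_state v y'" using lqw.lin_state_exists[OF v] by blast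
    obtain \<psi>' where \<psi>': "lqw.lin_adjoint v y' \<psi>'" using lqw.lin_adjoint_exists[OF v y'] by blast
    let ?a = "W w * e * (m3 * norm_L1 T v)" and ?b = "c1 * (T + 1) * W w * e"
    have i: "integrable (MT T) (\<lambda>t. J2 u v y \<psi> t \<bullet> v t)" "integrable (MT T) (\<lambda>t. J2 w v y' \<psi>' t \<bullet> v t)"
      by (intro L2_inner_integrable u.second_var_L2[OF v y \<psi>] lqw.second_var_L2[OF v y' \<psi>'] v)+
    have "(LINT t|MT T. J2 w v y' \<psi>' t \<bullet> v t)
        \<le> (LINT t|MT T. J2 u v y \<psi> t \<bullet> v t + (?a * norm (v t) + ?b * (norm (v t))\<^sup>2))"
    proof (rule integral_mono_AE)
      show "integrable (MT T) (\<lambda>t. J2 u v y \<psi> t \<bullet> v t + (?a * norm (v t) + ?b * (norm (v t))\<^sup>2))"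
        by (intro Bochner_Integration.integrable_add i integrable_mult_right L2_norm_integrable
            L2_square_integrable v)
      show "AE t in MT T. J2 w v y' \<psi>' t \<bullet> v t
          \<le> J2 u v y \<psi> t \<bullet> v t + (?a * norm (v t) + ?b * (norm (v t))\<^sup>2)"
        using second_var_diff[OF u w_L2 e v y \<psi> y' \<psi>']
      proof eventually_elim
        case (elim t)
        have "(J2 w v y' \<psi>' t - J2 u v y \<psi> t) \<bullet> v t \<le> norm (J2 w v y' \<psi>' t - J2 u v y \<psi> t) * norm (v t)"
          by (rule norm_cauchy_schwarz)
        also have "\<dots> \<le> (?a + ?b * norm (v t)) * norm (v t)"
          using elim by (intro mult_right_mono) (auto simp: norm_minus_commute)
        finally show ?case by (simp add: inner_diff_left algebra_simps power2_eq_square)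
      qed
    qed (rule i)
    also have "\<dots> = (LINT t|MT T. J2 u v y \<psi> t \<bullet> v t) + (?a * norm_L1 T v + ?b * (norm_L2 T v)\<^sup>2)"
      using i L2_norm_integrable[OF v] L2_square_integrable[OF v] by (simp add: norm_L1_def norm_L2_sq)
    finally have "lqw.bil v y' v y' \<le> u.bil v y v y + (?a * norm_L1 T v + ?b * (norm_L2 T v)\<^sup>2)"
      using u.bil_second_var[OF v y \<psi> v y] lqw.bil_second_var[OF v y' \<psi>' v y'] by simp
    moreover have "\<alpha> * (norm_L2 T v)\<^sup>2 \<le> lqw.bil v y' v y'"
      using coercive_w v y' unfolding lqw.coercive_def by blast
    moreover have "?a * norm_L1 T v \<le> W w * e * m3 * (T * (norm_L2 T v)\<^sup>2)"
    proof -
      have "W w * e * m3 * (norm_L1 T v)\<^sup>2 \<le> W w * e * m3 * (T * (norm_L2 T v)\<^sup>2)"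
        using norm_L1_sq_le[OF v T_pos] e0 m3_pos by (intro mult_left_mono) auto
      then show ?thesis by (simp add: power2_eq_square mult_ac)
    qed
    moreover have "W w * e * m3 * (T * (norm_L2 T v)\<^sup>2) + ?b * (norm_L2 T v)\<^sup>2 = c3 * W w * e * (norm_L2 T v)\<^sup>2"
      by (simp add: c3_eq algebra_simps)
    ultimately show "(\<alpha> - c3 * W w * e) * (norm_L2 T v)\<^sup>2 \<le> u.bil v y v y"
      by (simp add: left_diff_distrib)
  qed
qed

abbreviation "err u \<equiv> norm_Linf T (\<lambda>t. u t - w t)"

definition near :: "(real \<Rightarrow> real^'m) \<Rightarrow> bool" where
  "near u \<longleftrightarrow> u \<in> Linf T \<and> err u \<le> r"

lemma nearD:
  assumes "near u"
  shows "u \<in> Linf T" "u \<in> L2 T" "(\<lambda>t. u t - w t) \<in> Linf T"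
    "AE t in MT T. norm (u t - w t) \<le> err u" "0 \<le> err u" "err u \<le> r"
proof -
  show u: "u \<in> Linf T" "err u \<le> r" using assms by (auto simp: near_def)
  show "u \<in> L2 T" by (rule Linf_L2[OF u(1) T_pos])
  show d: "(\<lambda>t. u t - w t) \<in> Linf T" by (rule Linf_diff[OF u(1) w_Linf T_pos])
  show "AE t in MT T. norm (u t - w t) \<le> err u" "0 \<le> err u" by (rule Linf_AE[OF d T_pos])+
qed

text \<open>\<open>radius_bound\<close> read in three ways: as the contraction inequality, as a
  lower bound uniform over the ball and, through \<gamma> \<le> \<alpha>, as coercivity at the
  iterate.\<close>

lemma slack:
  assumes "near u"
  shows "c3 * (W w + T * err u) * err u \<le> \<gamma> - c3 * W w * err u"
    and "\<gamma> / 2 \<le> \<gamma> - c3 * W w * err u"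
    and "0 < \<alpha> - c3 * W w * err u"
proof -
  note r = radius_bound[OF nearD(5,6)[OF assms]]
  have "c3 * T * (err u)\<^sup>2 + 2 * (c3 * W w * err u) \<le> \<gamma>" using r by (simp add: mult.assoc)
  moreover have "0 \<le> c3 * T * (err u)\<^sup>2" using c3_pos T_pos by simp
  moreover have "c3 * (W w + T * err u) * err u = c3 * W w * err u + c3 * T * (err u)\<^sup>2"
    by (simp only: distrib_left distrib_right power2_eq_square mult.assoc)
  ultimately show "c3 * (W w + T * err u) * err u \<le> \<gamma> - c3 * W w * err u"
    "\<gamma> / 2 \<le> \<gamma> - c3 * W w * err u" "0 < \<alpha> - c3 * W w * err u"
    using gamma_pos gamma_le by linarith+
qed

text \<open>Optimality removes J'(w) from the expansion. The factor W w + T e dominates both growth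
  factors, since the L1 norm of \<open>u\<close> is at most that of \<open>w\<close> plus T
  e.\<close>

lemma taylor_near:
  assumes u: "near u" and y: "lst u (\<lambda>t. u t - w t) y" "lad u (\<lambda>t. u t - w t) y \<psi>"
  shows "AE t in MT T. norm (J1 u t - J2 u (\<lambda>t. u t - w t) y \<psi> t) \<le> \<theta>' * (W w + T * err u) * (err u)\<^sup>2"
proof -
  note n = nearD[OF u]
  let ?N = "norm_L1 T (\<lambda>t. u t - w t)" and ?V = "W w + T * err u" and ?e = "err u"
  have N: "?N \<le> T * ?e" by (rule state_control_diff(1)[OF n(2) w_L2 n(4)])
  have V: "W u \<le> ?V" "W w \<le> ?V"
    using norm_L1_triangle[OF L2_diff[OF n(2) w_L2] w_L2] N n(5) T_pos by auto
  have VE: "0 \<le> ?V * ?e" using n(5) T_pos by simp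
  have q0: "0 \<le> c1 * (T + 1) - T * L * cp"
  proof -
    have "L * cp \<le> c1" using c1_ge(4) L_pos by (simp add: distrib_left)
    then have "T * (L * cp) \<le> T * c1" using T_pos by (intro mult_left_mono) auto
    then show ?thesis using c1_pos by (simp add: algebra_simps)
  qed
  show ?thesis
    using gradient_taylor[OF n(2) w_L2 n(4) y V] optimal_stationary[OF w_Linf optimal] n(4)
  proof eventually_elim
    case (elim t)
    have "norm (J1 u t - J2 u (\<lambda>t. u t - w t) y \<psi> t)
        \<le> ?V * ?e * (m3 * ?N) + ?V * ?e * (c1 * (T + 1) - T * L * cp) * norm (u t - w t)"
      using elim(1,2) by simp
    also have "\<dots> \<le> ?V * ?e * (m3 * (T * ?e)) + ?V * ?e * (c1 * (T + 1) - T * L * cp) * ?e"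
      by (rule add_mono[OF mult_left_mono[OF mult_left_mono[OF N less_imp_le[OF m3_pos]] VE]
            mult_left_mono[OF elim(3) mult_nonneg_nonneg[OF VE q0]]])
    also have "\<dots> = (T * m3 + c1 * (T + 1) - T * L * cp) * (?V * (?e)\<^sup>2)"
      by (simp add: algebra_simps power2_eq_square)
    finally show ?case by (simp only: c3_eq mult.assoc)
  qed
qed

text \<open>Transfers a bound from J''(u) v to J''(w) v, because the inverse bound with \<gamma> is
  established at \<open>w\<close>. The supremum of \<open>v\<close> reappears on the right and is
  absorbed later by \<open>slack\<close>.\<close>

lemma second_var_shift:
  assumes u: "near u" and v: "v \<in> L2 T" "lst u v y" "lad u v y \<psi>" and y': "lst w v y'" "lad w v y' \<psi>'"
    and c: "AE t in MT T. norm (v t) \<le> c" and s: "AE t in MT T. norm (J2 u v y \<psi> t) \<le> s"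
  shows "AE t in MT T. norm (J2 w v y' \<psi>' t) \<le> s + c3 * W w * err u * c"
  using second_var_diff[OF nearD(2)[OF u] w_L2 nearD(4)[OF u] v y'] c s
proof eventually_elim
  case (elim t)
  note n = nearD[OF u]
  have N: "norm_L1 T v \<le> T * c" by (rule norm_L1_le[OF c L2_measurable[OF v(1)]]) (use T_pos in simp)
  have "norm (J2 w v y' \<psi>' t) \<le> norm (J2 u v y \<psi> t) + norm (J2 u v y \<psi> t - J2 w v y' \<psi>' t)"
    using norm_triangle_sub[of "J2 w v y' \<psi>' t" "J2 u v y \<psi> t"] by (simp add: norm_minus_commute)
  also have "\<dots> \<le> s + (W w * err u * (m3 * (T * c)) + c1 * (T + 1) * W w * err u * c)"
  proof (intro add_mono elim(3) order_trans[OF elim(1)] mult_left_mono N elim(2))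
  qed (use n(5) m3_pos c1_pos T_pos in auto)
  also have "\<dots> = s + c3 * W w * err u * c"
    by (simp add: c3_eq algebra_simps)
  finally show ?case .
qed

text \<open>The inverse bound is applied to u - w itself, with J''(u)(u - w) replaced by J'(u) up to
  the Taylor remainder. Inside the ball the gradient therefore vanishes only at
  \<open>w\<close>.\<close>

lemma error_le_gradient:
  assumes u: "near u" and \<omega>: "AE t in MT T. norm (J1 u t) \<le> \<omega>"
  shows "(1 - \<theta>' / c3) * (\<gamma> / 2) * err u \<le> \<omega>"
proof -
  note n = nearD[OF u]
  let ?d = "\<lambda>t. u t - w t" and ?V = "W w + T * err u" and ?e = "err u"
  interpret u: lq_problem T L "c1 * W u" "lqD u" "lqQ u" "lqG u" by (rule lq_problem_at[OF n(2)])
  note d = L2_diff[OF n(2) w_L2]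
  obtain y where y: "lst u ?d y" using u.lin_state_exists[OF d] by blast
  obtain \<psi> where \<psi>: "lad u ?d y \<psi>" using u.lin_adjoint_exists[OF d y] by blast
  obtain y' where y': "lst w ?d y'" using lqw.lin_state_exists[OF d] by blast
  obtain \<psi>' where \<psi>': "lad w ?d y' \<psi>'" using lqw.lin_adjoint_exists[OF d y'] by blast
  have "AE t in MT T. norm (J2 u ?d y \<psi> t) \<le> \<omega> + \<theta>' * ?V * ?e\<^sup>2"
    using taylor_near[OF u y \<psi>] \<omega>
  proof eventually_elim
    case (elim t)
    then show ?case using norm_triangle_sub[of "J2 u ?d y \<psi> t" "J1 u t"] by (simp add: norm_minus_commute)
  qed
  from inverse_bound_w[OF d y' \<psi>' second_var_shift[OF u d y \<psi> y' \<psi>' n(4) this]]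
  have "?e \<le> (\<omega> + \<theta>' * ?V * ?e\<^sup>2 + c3 * W w * ?e * ?e) / \<gamma>"
    by (intro Linf_I(2)[OF L2_measurable[OF d] _ T_pos])
  then have "?e * \<gamma> \<le> \<omega> + \<theta>' * ?V * ?e\<^sup>2 + c3 * W w * ?e * ?e"
    using gamma_pos by (simp only: pos_le_divide_eq)
  moreover have eq: "\<theta>' / c3 * (c3 * ?V * ?e) = \<theta>' * ?V * ?e" using c3_pos by simp
  ultimately have *: "((\<gamma> - c3 * W w * ?e) - \<theta>' / c3 * (c3 * ?V * ?e)) * ?e \<le> \<omega>"
    unfolding eq by (simp add: algebra_simps power2_eq_square)
  have t01: "0 \<le> \<theta>' / c3" "\<theta>' / c3 < 1" using theta_bounds c3_pos by auto
  \<comment> \<open>The remainder consumes at most the fraction \<theta>' / c3 of the slack, and the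
    slack is at least \<gamma> / 2, so a positive multiple of the error survives.\<close>
  have "(1 - \<theta>' / c3) * (\<gamma> / 2) \<le> (1 - \<theta>' / c3) * (\<gamma> - c3 * W w * ?e)"
    using t01 slack(2)[OF u] by (intro mult_left_mono) auto
  also have "\<dots> = (\<gamma> - c3 * W w * ?e) - \<theta>' / c3 * (\<gamma> - c3 * W w * ?e)"
    by (simp only: left_diff_distrib mult_1)
  also have "\<dots> \<le> (\<gamma> - c3 * W w * ?e) - \<theta>' / c3 * (c3 * ?V * ?e)"
    using mult_left_mono[OF slack(1)[OF u] t01(1)] by linarith
  finally have "(1 - \<theta>' / c3) * (\<gamma> / 2) * ?e \<le> ((\<gamma> - c3 * W w * ?e) - \<theta>' / c3 * (c3 * ?V * ?e)) * ?e"
    using n(5) by (rule mult_right_mono)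
  with * show ?thesis by linarith
qed

text \<open>The stationary point of the subproblem is its unique minimizer, since the objective
  exceeds its value there by a coercive quadratic form. It is essentially bounded, which keeps the
  iterates in L\<infinity> although the subproblem is posed in L2.\<close>

lemma newton_step:
  assumes u: "near u"
  obtains v where "newton_direction T b f g x0 u v" "v \<in> Linf T"
    "\<And>v'. newton_direction T b f g x0 u v' \<Longrightarrow> ae_eq T v v'"
    "err (\<lambda>t. u t + v t) \<le> \<theta>' / c3 * err u"
    "err (\<lambda>t. u t + v t) \<le> 2 * \<theta>' * (W w + T * r) / \<gamma> * (err u)\<^sup>2"
proof -
  note n = nearD[OF u]
  let ?d = "\<lambda>t. u t - w t" and ?V = "W w + T * err u" and ?e = "err u"
  interpret u: lq_problem T L "c1 * W u" "lqD u" "lqQ u" "lqG u" by (rule lq_problem_at[OF n(2)])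
  note co = coercive_near[OF n(2,4)] and a = slack(3)[OF u]
  note d = L2_diff[OF n(2) w_L2]
  note J1L2 = cost_gradient_L2(1)[OF n(2)]
  obtain v y \<psi> B where v: "v \<in> borel_measurable (MT T)" "AE t in MT T. norm (v t) \<le> B"
    "u.lin_state v y" "u.lin_adjoint v y \<psi>" and crit: "AE t in MT T. u.second_var v y \<psi> t = - J1 u t"
    by (rule u.stationary_point_exists[OF co a L2_measurable[OF J1L2]
          cost_gradient_L2(2)[OF n(2) Linf_AE(1)[OF n(1) T_pos]]])
  have vLinf: "v \<in> Linf T" by (rule Linf_I(1)[OF v(1,2) T_pos])
  have vL2: "v \<in> L2 T" by (rule Linf_L2[OF vLinf T_pos])
  let ?y = "linearized_state T b x0 u"
  have ly: "u.lin_state h (?y h)" if "h \<in> L2 T" for h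
    by (rule linearized_state_lin_state[OF n(2) that])
  have cost: "newton_objective T b f g x0 u h = u.lq_cost (J1 u) v y
      + u.bil (\<lambda>t. h t - v t) (\<lambda>t. ?y h t - y t) (\<lambda>t. h t - v t) (\<lambda>t. ?y h t - y t) / 2"
    if "h \<in> L2 T" for h
    unfolding newton_objective_lq[OF n(2)]
    by (rule u.lq_cost_expansion[OF J1L2 vL2 v(3,4) crit that ly[OF that]])
  have bil: "(\<alpha> - c3 * W w * ?e) * (norm_L2 T (\<lambda>t. h t - v t))\<^sup>2
      \<le> u.bil (\<lambda>t. h t - v t) (\<lambda>t. ?y h t - y t) (\<lambda>t. h t - v t) (\<lambda>t. ?y h t - y t)"
    if h: "h \<in> L2 T" for h
    using co L2_diff[OF h vL2] u.lin_state_diff[OF ly[OF h] v(3)] unfolding u.coercive_def by blast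
  have v_cost: "newton_objective T b f g x0 u v = u.lq_cost (J1 u) v y"
  proof -
    have "u.bil (\<lambda>t. v t - v t) (\<lambda>t. ?y v t - y t) (\<lambda>t. v t - v t) (\<lambda>t. ?y v t - y t)
        = u.bil (\<lambda>t. v t - v t) (\<lambda>t. 0) (\<lambda>t. v t - v t) (\<lambda>t. 0)"
      by (rule u.bil_cong) (simp add: u.lin_state_unique[OF ly[OF vL2] v(3)])
    also have "\<dots> = 0" by (simp add: u.bil_def)
    finally show ?thesis using cost[OF vL2] by simp
  qed
  have dir: "newton_direction T b f g x0 u v"
    unfolding newton_direction_def
  proof (intro conjI ballI vL2)
    fix h :: "real \<Rightarrow> real^'m" assume h: "h \<in> L2 T"
    have "0 \<le> (\<alpha> - c3 * W w * ?e) * (norm_L2 T (\<lambda>t. h t - v t))\<^sup>2" using a by simp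
    then show "newton_objective T b f g x0 u v \<le> newton_objective T b f g x0 u h"
      using cost[OF h] bil[OF h] v_cost by linarith
  qed
  have uniq: "ae_eq T v v'" if v': "newton_direction T b f g x0 u v'" for v'
  proof -
    have L2: "v' \<in> L2 T" and le: "newton_objective T b f g x0 u v' \<le> newton_objective T b f g x0 u v"
      using v' vL2 by (auto simp: newton_direction_def)
    have "(\<alpha> - c3 * W w * ?e) * (norm_L2 T (\<lambda>t. v' t - v t))\<^sup>2 \<le> 0"
      using cost[OF L2] bil[OF L2] v_cost le by linarith
    then have "(norm_L2 T (\<lambda>t. v' t - v t))\<^sup>2 \<le> 0"
      using a by (simp add: mult_le_0_iff)
    then have "(LINT t|MT T. (norm (v' t - v t))\<^sup>2) = 0"
      using zero_le_power2[of "norm_L2 T (\<lambda>t. v' t - v t)"] unfolding norm_L2_sq by linarith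
    then have "AE t in MT T. (norm (v' t - v t))\<^sup>2 = 0"
      by (subst (asm) integral_nonneg_eq_0_iff_AE) (auto simp: L2_square_integrable[OF L2_diff[OF L2 vL2]])
    then show ?thesis unfolding ae_eq_def by eventually_elim simp
  qed
  \<comment> \<open>\<open>?p\<close> is the new error. By linearity J''(u) maps it to J''(u)(u - w)
    - J'(u), which is a Taylor remainder, so the inverse bound applies to the new error
    directly.\<close>
  let ?p = "\<lambda>t. ?d t + 1 *\<^sub>R v t"
  have pe: "(\<lambda>t. (u t + v t) - w t) = ?p" by (simp add: fun_eq_iff)
  have pLinf: "?p \<in> Linf T" by (rule Linf_add[OF n(3) vLinf T_pos])
  have pL2: "?p \<in> L2 T" by (rule Linf_L2[OF pLinf T_pos])
  note pAE = Linf_AE[OF pLinf T_pos]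
  obtain z where z: "u.lin_state ?d z" using u.lin_state_exists[OF d] by blast
  obtain \<zeta> where \<zeta>: "u.lin_adjoint ?d z \<zeta>" using u.lin_adjoint_exists[OF d z] by blast
  have z1: "u.lin_state ?p (\<lambda>t. z t + 1 *\<^sub>R y t)" by (rule u.lin_state_combine[OF z v(3)])
  have \<zeta>1: "u.lin_adjoint ?p (\<lambda>t. z t + 1 *\<^sub>R y t) (\<lambda>t. \<zeta> t + 1 *\<^sub>R \<psi> t)"
    by (rule u.lin_adjoint_combine[OF \<zeta> v(4)])
  have "AE t in MT T. norm (u.second_var ?p (\<lambda>t. z t + 1 *\<^sub>R y t) (\<lambda>t. \<zeta> t + 1 *\<^sub>R \<psi> t) t)
      \<le> \<theta>' * ?V * ?e\<^sup>2"
    using taylor_near[OF u z \<zeta>] crit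
  proof eventually_elim
    case (elim t)
    then show ?case unfolding u.second_var_combine by (simp add: norm_minus_commute)
  qed
  moreover obtain y' where y': "lst w ?p y'" using lqw.lin_state_exists[OF pL2] by blast
  moreover obtain \<psi>' where \<psi>': "lad w ?p y' \<psi>'" using lqw.lin_adjoint_exists[OF pL2 y'] by blast
  ultimately have "AE t in MT T. norm (?p t) \<le> (\<theta>' * ?V * ?e\<^sup>2 + c3 * W w * ?e * norm_Linf T ?p) / \<gamma>"
    by (intro inverse_bound_w[OF pL2 y' \<psi>'] second_var_shift[OF u pL2 z1 \<zeta>1 y' \<psi>' pAE(1)])
  then have "norm_Linf T ?p \<le> (\<theta>' * ?V * ?e\<^sup>2 + c3 * W w * ?e * norm_Linf T ?p) / \<gamma>"
    by (intro Linf_I(2)[OF L2_measurable[OF pL2] _ T_pos])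
  then have "norm_Linf T ?p * \<gamma> \<le> \<theta>' * ?V * ?e\<^sup>2 + c3 * W w * ?e * norm_Linf T ?p"
    using gamma_pos by (simp only: pos_le_divide_eq)
  then have *: "(\<gamma> - c3 * W w * ?e) * norm_Linf T ?p \<le> \<theta>' * ?V * ?e\<^sup>2"
    by (simp add: algebra_simps)
  \<comment> \<open>\<open>slack\<close> bounds the remainder by \<theta>' / c3 times the old error
    times the very factor that multiplies the new error in \<open>*\<close>; that factor
    cancels.\<close>
  have lin: "norm_Linf T ?p \<le> \<theta>' / c3 * ?e"
  proof -
    have x: "0 < \<gamma> - c3 * W w * ?e" using slack(2)[OF u] gamma_pos by linarith
    have "\<theta>' * ?V * ?e\<^sup>2 = \<theta>' / c3 * ?e * (c3 * ?V * ?e)"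
      using c3_pos by (simp add: power2_eq_square)
    also have "\<dots> \<le> \<theta>' / c3 * ?e * (\<gamma> - c3 * W w * ?e)"
      using theta_bounds c3_pos n(5) by (intro mult_left_mono slack(1)[OF u]) auto
    finally have "(\<gamma> - c3 * W w * ?e) * norm_Linf T ?p \<le> (\<gamma> - c3 * W w * ?e) * (\<theta>' / c3 * ?e)"
      using * by (simp add: mult.commute)
    then show ?thesis using x by (rule mult_left_le_imp_le)
  qed
  have quad: "norm_Linf T ?p \<le> 2 * \<theta>' * (W w + T * r) / \<gamma> * ?e\<^sup>2"
  proof -
    have "\<gamma> / 2 * norm_Linf T ?p \<le> (\<gamma> - c3 * W w * ?e) * norm_Linf T ?p"
      using slack(2)[OF u] pAE(2) by (rule mult_right_mono)
    also have "\<dots> \<le> \<theta>' * (W w + T * r) * ?e\<^sup>2"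
      using theta_bounds n(6) T_pos
      by (intro order_trans[OF *] mult_right_mono mult_left_mono add_left_mono) auto
    finally show ?thesis using gamma_pos by (simp add: field_simps)
  qed
  show ?thesis
    by (rule that[OF dir vLinf uniq]) (use lin quad in \<open>simp_all only: pe\<close>)
qed

end

section \<open>The iteration and its rates\<close>

context optimal_problem
begin

text \<open>Iterates are prescribed only up to null sets, so closeness must not depend on the
  representative.\<close>

lemma near_cong:
  assumes u: "near u" and eq: "ae_eq T u' u"
  shows "near u'" "err u' \<le> err u"
proof -
  note n = nearD[OF u]
  have m: "u' \<in> borel_measurable (MT T)"
    by (rule borel_measurable_AE_MT[OF Linf_measurable[OF n(1)]])
      (use eq in \<open>simp add: ae_eq_def eq_commute\<close>)
  have "AE t in MT T. norm (u' t) \<le> norm_Linf T u"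
    using eq[unfolded ae_eq_def] Linf_AE(1)[OF n(1) T_pos] by eventually_elim simp
  then have Linf: "u' \<in> Linf T" by (intro Linf_I(1)[OF m _ T_pos])
  have "AE t in MT T. norm (u' t - w t) \<le> err u"
    using eq[unfolded ae_eq_def] n(4) by eventually_elim simp
  then show "err u' \<le> err u"
    by (intro Linf_I(2)[OF Linf_measurable[OF Linf_diff[OF Linf w_Linf T_pos]] _ T_pos])
  with Linf n(6) show "near u'" by (simp add: near_def)
qed

abbreviation "q \<equiv> \<theta>' / c3"
abbreviation "quad \<equiv> 2 * \<theta>' * (W w + T * r) / \<gamma>"

lemma q_bounds: "0 \<le> q" "q < 1"
  using theta_bounds c3_pos by auto

lemma quad_nonneg: "0 \<le> quad"
  using theta_bounds T_pos r_pos gamma_pos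
  by (intro divide_nonneg_pos mult_nonneg_nonneg add_nonneg_nonneg) auto

text \<open>If the method stops, \<open>error_le_gradient\<close> forces the error to be 0 and the
  constant continuation meets both rates. Otherwise uniqueness identifies the given direction with
  the one from \<open>newton_step\<close>.\<close>

lemma newton_successor:
  assumes u: "near u"
    and succ: "if stationary T b f g x0 u then ae_eq T u' u
      else \<exists>v. newton_direction T b f g x0 u v \<and> ae_eq T u' (\<lambda>t. u t + v t)"
  shows "near u'" "err u' \<le> q * err u" "err u' \<le> quad * (err u)\<^sup>2"
proof -
  note n = nearD[OF u]
  have "near u' \<and> err u' \<le> q * err u \<and> err u' \<le> quad * (err u)\<^sup>2"
  proof (cases "stationary T b f g x0 u")
    case True
    then have "AE t in MT T. norm (J1 u t) \<le> 0" by (simp add: stationary_def ae_eq_def)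
    from error_le_gradient[OF u this] have "err u \<le> 0"
      using q_bounds gamma_pos by (simp add: mult_le_0_iff)
    then have "err u = 0" using n(5) by simp
    then show ?thesis using near_cong[OF u] succ True by simp
  next
    case False
    then obtain v' where v': "newton_direction T b f g x0 u v'" "ae_eq T u' (\<lambda>t. u t + v' t)"
      using succ by auto
    obtain v where v: "newton_direction T b f g x0 u v" "v \<in> Linf T"
      "\<And>v'. newton_direction T b f g x0 u v' \<Longrightarrow> ae_eq T v v'"
      "err (\<lambda>t. u t + v t) \<le> q * err u" "err (\<lambda>t. u t + v t) \<le> quad * (err u)\<^sup>2"
      using newton_step[OF u] by blast
    have eq: "ae_eq T u' (\<lambda>t. u t + v t)"
      using v'(2) v(3)[OF v'(1)] unfolding ae_eq_def by eventually_elim simp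
    have "(\<lambda>t. u t + v t) \<in> Linf T" using Linf_add[OF n(1) v(2) T_pos, of 1] by simp
    moreover have "q * err u \<le> r"
      using q_bounds n(5,6) by (smt (verit) mult_left_le_one_le)
    ultimately have nr: "near (\<lambda>t. u t + v t)" using v(4) by (simp add: near_def)
    then show ?thesis using near_cong[OF nr eq] v(4,5) by linarith
  qed
  then show "near u'" "err u' \<le> q * err u" "err u' \<le> quad * (err u)\<^sup>2" by blast+
qed

lemma newton_sequence_near:
  assumes "near u0" "newton_sequence T b f g x0 u0 u"
  shows "near (u k)"
proof (induction k)
  case 0
  show ?case using near_cong(1)[OF assms(1)] assms(2) by (simp add: newton_sequence_def)
next
  case (Suc k)
  show ?case using newton_successor(1)[OF Suc] assms(2) by (simp add: newton_sequence_def)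
qed

text \<open>Dependent choice with \<open>near\<close> as invariant builds one sequence. The
  uniqueness claim concerns every Newton sequence, and all iterates of each of them stay
  near.\<close>

lemma newton_well_defined_near:
  assumes u0: "near u0"
  shows "newton_well_defined T b f g x0 u0"
  unfolding newton_well_defined_def
proof (intro conjI allI impI)
  let ?succ = "\<lambda>u u'. if stationary T b f g x0 u then ae_eq T u' u
      else \<exists>v. newton_direction T b f g x0 u v \<and> ae_eq T u' (\<lambda>t. u t + v t)"
  have refl: "ae_eq T u u" for u :: "real \<Rightarrow> real^'m" by (simp add: ae_eq_def)
  have "\<exists>u. \<forall>k. (near (u k) \<and> (k = 0 \<longrightarrow> u k = u0)) \<and> ?succ (u k) (u (Suc k))"
  proof (rule dependent_nat_choice)
    show "\<exists>u. near u \<and> (0 = (0::nat) \<longrightarrow> u = u0)" using u0 by blast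
    fix u and k :: nat assume "near u \<and> (k = 0 \<longrightarrow> u = u0)"
    then have u: "near u" by blast
    obtain v where v: "newton_direction T b f g x0 u v"
      using newton_step[OF u] by blast
    obtain u' where u': "?succ u u'"
    proof (cases "stationary T b f g x0 u")
      case True
      then show ?thesis using that[of u] refl[of u] by simp
    next
      case False
      then show ?thesis using that[of "\<lambda>t. u t + v t"] v refl[of "\<lambda>t. u t + v t"] by auto
    qed
    then show "\<exists>u'. (near u' \<and> (Suc k = 0 \<longrightarrow> u' = u0)) \<and> ?succ u u'"
      using newton_successor(1)[OF u u'] by blast
  qed
  then show "\<exists>u. newton_sequence T b f g x0 u0 u"
    unfolding newton_sequence_def using refl by metis
next
  fix u k assume u: "newton_sequence T b f g x0 u0 u"
  have nk: "near (u k)" by (rule newton_sequence_near[OF u0 u])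
  obtain v where v: "newton_direction T b f g x0 (u k) v"
    "\<And>v'. newton_direction T b f g x0 (u k) v' \<Longrightarrow> ae_eq T v v'"
    using newton_step[OF nk] by blast
  have "ae_eq T v1 v2" if "newton_direction T b f g x0 (u k) v1" "newton_direction T b f g x0 (u k) v2" for v1 v2
    using v(2)[OF that(1)] v(2)[OF that(2)] unfolding ae_eq_def by eventually_elim simp
  then show "unique_newton_direction T b f g x0 (u k)"
    unfolding unique_newton_direction_def using v(1) by blast
qed

lemma newton_sequence_errors:
  assumes u0: "near u0" and u: "newton_sequence T b f g x0 u0 u"
  shows "err (u (Suc k)) \<le> quad * (err (u k))\<^sup>2" and "(\<lambda>k. err (u k)) \<longlonglongrightarrow> 0"
proof -
  have succ: "if stationary T b f g x0 (u k) then ae_eq T (u (Suc k)) (u k)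
      else \<exists>v. newton_direction T b f g x0 (u k) v \<and> ae_eq T (u (Suc k)) (\<lambda>t. u k t + v t)" for k
    using u by (simp add: newton_sequence_def)
  note near = newton_sequence_near[OF u0 u]
  show "err (u (Suc k)) \<le> quad * (err (u k))\<^sup>2" by (rule newton_successor(3)[OF near succ])
  have le: "err (u k) \<le> q ^ k * err (u 0)" for k
  proof (induction k)
    case (Suc k)
    have "err (u (Suc k)) \<le> q * err (u k)" by (rule newton_successor(2)[OF near succ])
    also have "\<dots> \<le> q * (q ^ k * err (u 0))" using Suc q_bounds by (intro mult_left_mono) auto
    finally show ?case by (simp only: power_Suc mult.assoc)
  qed simp
  have "(\<lambda>k. q ^ k * err (u 0)) \<longlonglongrightarrow> 0 * err (u 0)"
    using q_bounds by (intro tendsto_mult LIMSEQ_power_zero tendsto_const) simp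
  then have lim: "(\<lambda>k. q ^ k * err (u 0)) \<longlonglongrightarrow> 0" by simp
  show "(\<lambda>k. err (u k)) \<longlonglongrightarrow> 0"
    by (rule tendsto_sandwich[OF _ _ tendsto_const lim]) (use le nearD(5)[OF near] in auto)
qed

lemma quadratic_convergence:
  assumes u0: "near u0" and u: "newton_sequence T b f g x0 u0 u"
  shows "quadratically_convergent_Linf T u w"
    and "quadratically_convergent_Linf T (\<lambda>k. J1 (u k)) (\<lambda>t. 0)"
proof -
  note near = newton_sequence_near[OF u0 u] and errs = newton_sequence_errors[OF u0 u]
  \<comment> \<open>\<open>quad\<close> is only known to be nonnegative, while quadratic convergence
    asks for a positive constant.\<close>
  have "err (u (Suc k)) \<le> (quad + 1) * (err (u k))\<^sup>2" for k
    using errs(1)[of k] by (simp only: distrib_right) (smt (verit) mult_1 zero_le_power2)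
  moreover have "0 < quad + 1" using quad_nonneg by linarith
  ultimately show "quadratically_convergent_Linf T u w"
    unfolding quadratically_convergent_Linf_def using w_Linf nearD(1)[OF near] errs(2) by blast
  let ?G = "\<lambda>k. norm_Linf T (J1 (u k))"
  define c where "c = (1 - q) * (\<gamma> / 2)"
  define d where "d = L * (cp * W w * T) + L * (1 + cp * W w) * (c1 * T + 1)"
  have c: "0 < c" using q_bounds gamma_pos by (simp add: c_def)
  have d: "0 < d"
  proof -
    have "0 \<le> cp * W w" using cp_pos by simp
    then have "0 < 1 + cp * W w" "0 \<le> L * (cp * W w * T)" using L_pos T_pos by simp_all
    moreover have "0 < c1 * T + 1" using c1_pos T_pos by (simp add: add_pos_pos)
    ultimately show ?thesis
      unfolding d_def using L_pos by (metis add_nonneg_pos mult_pos_pos)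
  qed
  have J_meas: "J1 (u k) \<in> borel_measurable (MT T)" for k
    by (rule cost_gradient_measurable[OF nearD(2)[OF near]])
  have up: "AE t in MT T. norm (J1 (u k) t) \<le> d * err (u k)" for k
    using cost_gradient_lipschitz[OF nearD(2)[OF near] w_L2 nearD(4)[OF near], of k]
      optimal_stationary[OF w_Linf optimal]
    unfolding d_def by eventually_elim simp
  have Linf: "J1 (u k) \<in> Linf T" and G_le: "?G k \<le> d * err (u k)" for k
    by (rule Linf_I[OF J_meas up T_pos])+
  have e_le: "err (u k) \<le> ?G k / c" for k
    using error_le_gradient[OF near Linf_AE(1)[OF Linf T_pos], of k] c
    unfolding c_def[symmetric] by (simp add: pos_le_divide_eq mult.commute)
  \<comment> \<open>Upper comparison of gradient and error at step k + 1, quadratic decrease of the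
    error, then the lower comparison at step k.\<close>
  have G_quad: "?G (Suc k) \<le> (d * (quad + 1) / c\<^sup>2) * (?G k)\<^sup>2" for k
  proof -
    have "?G (Suc k) \<le> d * err (u (Suc k))" by (rule G_le)
    also have "\<dots> \<le> d * (quad * (err (u k))\<^sup>2)"
      using d errs(1)[of k] by (intro mult_left_mono) auto
    also have "\<dots> \<le> d * ((quad + 1) * (?G k / c)\<^sup>2)"
      using d quad_nonneg e_le[of k] nearD(5)[OF near, of k]
      by (intro mult_left_mono mult_mono power_mono) auto
    finally show ?thesis by (simp add: power_divide)
  qed
  have "(\<lambda>k. d * err (u k)) \<longlonglongrightarrow> d * 0" by (intro tendsto_mult tendsto_const errs(2))
  then have lim: "(\<lambda>k. d * err (u k)) \<longlonglongrightarrow> 0" by simp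
  have G0: "?G \<longlonglongrightarrow> 0"
    by (rule tendsto_sandwich[OF _ _ tendsto_const lim]) (use G_le Linf_AE(2)[OF Linf T_pos] in auto)
  have zero: "(\<lambda>t. 0 :: real^'m) \<in> Linf T" by (rule Linf_I(1)[of _ _ 0]) (use T_pos in auto)
  have "0 < d * (quad + 1) / c\<^sup>2"
    using d c quad_nonneg by (intro divide_pos_pos mult_pos_pos add_nonneg_pos) auto
  then show "quadratically_convergent_Linf T (\<lambda>k. J1 (u k)) (\<lambda>t. 0)"
    unfolding quadratically_convergent_Linf_def diff_zero
    using zero Linf G0 G_quad by blast
qed

end

theorem theorem5p4:
  fixes T L \<alpha> :: real
    and x0 :: "real^'n"
    and b :: "real \<Rightarrow> real^'n \<Rightarrow> real^'m \<Rightarrow> real^'n"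
    and f :: "real \<Rightarrow> real^'n \<Rightarrow> real^'m \<Rightarrow> real"
    and g :: "real^'n \<Rightarrow> real"
    and ubar :: "real \<Rightarrow> real^'m"
  assumes "T > 0" and "L > 0"
    and "standing_assumptions T L b f g"
    and "ubar \<in> Linf T"
    and "optimal_control T b f g x0 ubar"
    and "\<alpha> > 0"
    and "coercive_at T b f g x0 ubar \<alpha>"
  shows "r_3 T L x0 \<alpha> ubar > 0 \<and>
    (\<forall>u0 \<in> Linf T. norm_Linf T (\<lambda>t. u0 t - ubar t) \<le> r_3 T L x0 \<alpha> ubar \<longrightarrow>
       newton_well_defined T b f g x0 u0 \<and>
       (\<forall>u. newton_sequence T b f g x0 u0 u \<longrightarrow>
          quadratically_convergent_Linf T u ubar \<and>
          quadratically_convergent_Linf T (\<lambda>k. cost_gradient T b f g x0 (u k)) (\<lambda>t. 0)))"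
proof -
  interpret optimal_problem T L x0 b f g ubar \<alpha>
    by unfold_locales (use assms in auto)
  have "near u0" if "u0 \<in> Linf T" "norm_Linf T (\<lambda>t. u0 t - ubar t) \<le> r_3 T L x0 \<alpha> ubar" for u0
    using that by (simp add: near_def)
  then show ?thesis
    using r_pos newton_well_defined_near quadratic_convergence by blast
qed

end
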